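(* Let $g(\cdot,t)=u(\cdot,t)\,ds_p^2$, $t\in(-\infty,0)$, be an ancient solution of the Ricci flow $\partial_t g_{ij}=-2R_{ij}$ on $S^2$ which becomes singular at time $t=0$, where $u>0$ is smooth on $S^2\times(-\infty,0)$ and satisfies $u_t=\Delta_{S^2}\log u-2$ in $S^2\times(-\infty,0)$. Let $v=u^{-1}$. Assume that the coordinates $(\psi,\theta)$ on $S^2$ are chosen such that $\lim_{t\to-\infty}v(\psi,\theta,t)=C_0\cos^2\psi$ for all $|\psi|\le\pi/2$, $0\le\theta\le 2\pi$, with a constant $C_0>0$, and that there exist constants $0<a<3$, $T_0<0$ and $C'>0$ such that $v_\theta^2\le C'\,v^{1+a}\cos^2\psi$ on $S^2\times(-\infty,T_0]$. Then $v=v(\psi,t)$ is independent of $\theta$. Let $H(\psi,t)$ be the function built from $v$ as defined in the context. Then for any $t_0<0$ there exists a constant $C>0$ such that $$H(\psi,t)\le C\quad\forall |\psi|<\frac{\pi}{2},\ t\le t_0.$$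
   Context: $ds_p^2=d\psi^2+\cos^2\psi\,d\theta^2$ is the standard round metric on the unit sphere $S^2$ with latitude-longitude coordinates $(\psi,\theta)$, $-\pi/2\le\psi\le\pi/2$, $0\le\theta\le 2\pi$; the poles are $\psi=\pm\pi/2$. $\Delta_{S^2}$ is its Laplacian, $\Delta_{S^2}f=f_{\psi\psi}-(\tan\psi)f_\psi+(\sec^2\psi)f_{\theta\theta}$. "Ancient" means defined for all $t<0$. By known results, $v(\cdot,t)$ decreases as $t\to-\infty$ and converges in $C^{1,\alpha}(S^2)$ for every $0<\alpha<1$; after a conformal change of $S^2$ the limit has the form $C_0\cos^2\psi$ with $C_0\ge 0$, and the assumption on the coordinates refers to this normalization. Independence of $\theta$ under these assumptions is a separate theorem of the paper and is recalled only to justify the notation $v(\psi,t)$. Definition of $H$. Mercator's projection relates $\psi\in(-\pi/2,\pi/2)$ and $x\in\mathbb{R}$ by $\cosh x=\sec\psi$, $\sinh x=\tan\psi$, so $dx/d\psi=\sec\psi$. Define $w(x,t)$ by $v(\psi,t)=w(x,t)\cos^2\psi$, then $Q(x,t)=w_{xx}(x,t)-4w(x,t)$ and $F(x,t)=Q_x(x,t)^2$. Finally $H(\psi,t)=F(x,t)$ where $x=x(\psi)$ corresponds to $\psi$ under Mercator's projection. *)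

theory Defs
  imports "HOL-Analysis.Analysis"
begin

section \<open>Smooth functions\<close>

primrec Ck_on :: "nat \<Rightarrow> 'a::real_normed_vector set \<Rightarrow> ('a \<Rightarrow> real) \<Rightarrow> bool" where
  "Ck_on 0 W f \<longleftrightarrow> continuous_on W f"
| "Ck_on (Suc k) W f \<longleftrightarrow>
     (\<forall>x\<in>W. f differentiable (at x)) \<and>
     (\<forall>e. Ck_on k W (\<lambda>x. frechet_derivative f (at x) e))"

text \<open>
  \<^term>\<open>Ck_on\<close> is only meaningful on open sets. On an arbitrary subset of a Euclidean space, such as
  the sphere times an open time interval, smooth means being the restriction of a
  smooth function on an open neighbourhood; on an embedded submanifold this
  is the usual notion.
\<close>

definition smooth_on :: "'a::real_normed_vector set \<Rightarrow> ('a \<Rightarrow> real) \<Rightarrow> bool" where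
  "smooth_on A f \<longleftrightarrow>
     (\<exists>W F. open W \<and> A \<subseteq> W \<and> (\<forall>k. Ck_on k W F) \<and> (\<forall>x\<in>A. F x = f x))"


section \<open>Metrics in a coordinate chart and the Ricci flow\<close>

definition pd :: "'n \<Rightarrow> (real^'n::finite \<Rightarrow> real) \<Rightarrow> real^'n \<Rightarrow> real" where
  "pd k f y = deriv (\<lambda>s. f (y + s *\<^sub>R axis k 1)) 0"

text \<open>\<^term>\<open>christoffel G k i j y\<close> has upper index \<open>k\<close> and lower indices \<open>i\<close>, \<open>j\<close>.\<close>

definition christoffel ::
  "(real^'n::finite \<Rightarrow> real^'n^'n) \<Rightarrow> 'n \<Rightarrow> 'n \<Rightarrow> 'n \<Rightarrow> real^'n \<Rightarrow> real" where
  "christoffel G k i j y =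
     (1/2) * (\<Sum>l\<in>UNIV. matrix_inv (G y) $ k $ l *
        (pd i (\<lambda>z. G z $ j $ l) y + pd j (\<lambda>z. G z $ i $ l) y - pd l (\<lambda>z. G z $ i $ j) y))"

definition ricci ::
  "(real^'n::finite \<Rightarrow> real^'n^'n) \<Rightarrow> 'n \<Rightarrow> 'n \<Rightarrow> real^'n \<Rightarrow> real" where
  "ricci G i j y =
     (\<Sum>k\<in>UNIV. pd k (christoffel G k i j) y - pd j (christoffel G k i k) y
       + (\<Sum>l\<in>UNIV. christoffel G k k l y * christoffel G l i j y
                   - christoffel G k j l y * christoffel G l i k y))"

definition scalar_curvature ::
  "(real^'n::finite \<Rightarrow> real^'n^'n) \<Rightarrow> real^'n \<Rightarrow> real" where
  "scalar_curvature G y = (\<Sum>i\<in>UNIV. \<Sum>j\<in>UNIV. matrix_inv (G y) $ i $ j * ricci G i j y)"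


section \<open>The unit sphere in latitude-longitude coordinates\<close>

abbreviation S2 :: "(real^3) set" where
  "S2 \<equiv> sphere 0 1"

definition sph :: "real \<Rightarrow> real \<Rightarrow> real^3" where
  "sph \<psi> \<theta> = vector [cos \<psi> * cos \<theta>, cos \<psi> * sin \<theta>, sin \<psi>]"

text \<open>
  Away from the poles, the coordinates are \<open>y $ 1 = \<psi>\<close> with \<open>\<bar>\<psi>\<bar> < pi/2\<close> and \<open>y $ 2 = \<theta>\<close>,
  where \<open>\<theta>\<close> runs over all of \<open>\<real>\<close> (everything is \<open>2 * pi\<close>-periodic).
\<close>

definition conf_metric :: "(real^3 \<Rightarrow> real) \<Rightarrow> real^2 \<Rightarrow> real^2^2" where
  "conf_metric f y = f (sph (y $ 1) (y $ 2)) *\<^sub>R vector [vector [1, 0], vector [0, (cos (y $ 1))\<^sup>2]]"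

text \<open>
  The coordinate expression of the Laplacian degenerates at the two poles. Equations involving
  it are imposed on the dense open chart; for smooth functions they then hold on
  the whole sphere by continuity.
\<close>

definition laplacian_S2 :: "(real^3 \<Rightarrow> real) \<Rightarrow> real \<Rightarrow> real \<Rightarrow> real" where
  "laplacian_S2 f \<psi> \<theta> =
     deriv (deriv (\<lambda>p. f (sph p \<theta>))) \<psi>
     - tan \<psi> * deriv (\<lambda>p. f (sph p \<theta>)) \<psi>
     + (1 / cos \<psi>)\<^sup>2 * deriv (deriv (\<lambda>q. f (sph \<psi> q))) \<theta>"

definition ancient_ricci_flow_S2 :: "(real^3 \<Rightarrow> real \<Rightarrow> real) \<Rightarrow> bool" where
  "ancient_ricci_flow_S2 u \<longleftrightarrow>
     (\<forall>t<0. \<forall>y. \<bar>y $ 1\<bar> < pi/2 \<longrightarrow> (\<forall>i j.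
        ((\<lambda>s. conf_metric (\<lambda>p. u p s) y $ i $ j) has_real_derivative
           - 2 * ricci (conf_metric (\<lambda>p. u p t)) i j y) (at t)))"

definition log_diffusion_S2 :: "(real^3 \<Rightarrow> real \<Rightarrow> real) \<Rightarrow> bool" where
  "log_diffusion_S2 u \<longleftrightarrow>
     (\<forall>t<0. \<forall>\<psi> \<theta>. \<bar>\<psi>\<bar> < pi/2 \<longrightarrow>
        ((\<lambda>s. u (sph \<psi> \<theta>) s) has_real_derivative
           laplacian_S2 (\<lambda>p. ln (u p t)) \<psi> \<theta> - 2) (at t))"

text \<open>The curvature blows up as \<open>t\<close> tends to \<open>0\<close> from below.\<close>

definition singular_at_0 :: "(real^3 \<Rightarrow> real \<Rightarrow> real) \<Rightarrow> bool" where
  "singular_at_0 u \<longleftrightarrow>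
     (\<forall>M. \<forall>\<tau><0. \<exists>t y. \<tau> < t \<and> t < 0 \<and> \<bar>y $ 1\<bar> < pi/2 \<and>
        \<bar>scalar_curvature (conf_metric (\<lambda>p. u p t)) y\<bar> > M)"


section \<open>Mercator's projection and the function \<open>H\<close>\<close>

text \<open>
  The relations \<open>cosh x = 1 / cos \<psi>\<close> and \<open>sinh x = tan \<psi>\<close> for \<open>\<bar>\<psi>\<bar> < pi/2\<close> are solved by the
  following two mutually inverse maps.
\<close>

definition mercator :: "real \<Rightarrow> real" where
  "mercator \<psi> = arsinh (tan \<psi>)"

definition inv_mercator :: "real \<Rightarrow> real" where
  "inv_mercator x = arctan (sinh x)"

lemma inv_mercator_bounds: "\<bar>inv_mercator x\<bar> < pi/2"
  using arctan_bounded[of "sinh x"] by (auto simp: inv_mercator_def)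

lemma sinh_mercator: "sinh (mercator \<psi>) = tan \<psi>"
  by (simp add: mercator_def)

lemma cosh_mercator:
  assumes "\<bar>\<psi>\<bar> < pi/2"
  shows "cosh (mercator \<psi>) = 1 / cos \<psi>"
proof -
  have c: "cos \<psi> > 0"
    using assms by (intro cos_gt_zero_pi) auto
  have "(cosh (mercator \<psi>))\<^sup>2 = 1 + (tan \<psi>)\<^sup>2"
    by (simp add: cosh_square_eq sinh_mercator)
  also have "\<dots> = (1 / cos \<psi>)\<^sup>2"
    using tan_sec[of \<psi>] c by (simp add: inverse_eq_divide)
  finally show ?thesis
    using c by (simp add: power2_eq_iff_nonneg)
qed

lemma inv_mercator_mercator:
  assumes "\<bar>\<psi>\<bar> < pi/2"
  shows "inv_mercator (mercator \<psi>) = \<psi>"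
  using assms by (simp add: inv_mercator_def sinh_mercator arctan_tan abs_less_iff)

lemma mercator_inv_mercator: "mercator (inv_mercator x) = x"
  by (simp add: mercator_def inv_mercator_def tan_arctan arsinh_sinh_real)

text \<open>In the following, \<open>v\<close> is a function of \<open>(\<psi>, t)\<close>.\<close>

definition w_of :: "(real \<Rightarrow> real \<Rightarrow> real) \<Rightarrow> real \<Rightarrow> real \<Rightarrow> real" where
  "w_of v x t = v (inv_mercator x) t / (cos (inv_mercator x))\<^sup>2"

definition Q_of :: "(real \<Rightarrow> real \<Rightarrow> real) \<Rightarrow> real \<Rightarrow> real \<Rightarrow> real" where
  "Q_of v x t = deriv (deriv (\<lambda>z. w_of v z t)) x - 4 * w_of v x t"

definition F_of :: "(real \<Rightarrow> real \<Rightarrow> real) \<Rightarrow> real \<Rightarrow> real \<Rightarrow> real" where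
  "F_of v x t = (deriv (\<lambda>z. Q_of v z t) x)\<^sup>2"

definition H_of :: "(real \<Rightarrow> real \<Rightarrow> real) \<Rightarrow> real \<Rightarrow> real \<Rightarrow> real" where
  "H_of v \<psi> t = F_of v (mercator \<psi>) t"

end

theory Submission
  imports Defs
begin

text \<open>
  In Mercator coordinates the flow lives on a cylinder: \<open>1 / w\<close> is the conformal factor with respect
  to \<open>dx\<^sup>2 + d\<theta>\<^sup>2\<close>, and the hypothesis on the limit says that \<open>w\<close> tends to the constant \<open>C0\<close>.
  The conclusion holds in the sharp form \<open>H = 0\<close>.

  Solutions of \<open>u_t = \<Delta> ln u\<close> contract in \<open>L\<^sup>1\<close>. Comparing \<open>1 / w\<close> with its parabolic rescalings
  shows that \<open>w\<close> is nondecreasing in time, hence \<open>w \<ge> C0\<close>. With this, the bound on \<open>v_\<theta>\<close> and \<open>a < 3\<close>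
  make the difference of \<open>1 / w\<close> and a rotation of it at most a multiple of \<open>exp (- a \<bar>x\<bar>)\<close>. By
  dominated convergence the \<open>L\<^sup>1\<close> norm of this difference tends to 0 as \<open>t \<rightarrow> -\<infinity>\<close>, so by contraction it
  vanishes at all times.

  For rotationally symmetric \<open>w\<close> let \<open>R = w_xx - w_x\<^sup>2 / w\<close> be the curvature,
  \<open>\<tau> = 4 w - 2 w_xx + w_x\<^sup>2 / w\<close> and \<open>q = w_xxx - 4 w_x\<close>. The maximum principle gives \<open>\<tau> \<ge> 0\<close>. Moreover
  \<open>4 (t - s) w q\<^sup>2 + \<tau>\<^sup>2\<close> is a subsolution, whence
  \<open>4 (t - s) w q\<^sup>2 \<le> sup \<tau>(s)\<^sup>2 \<le> 4 (\<rho>\<^sub>+ + \<rho>\<^sub>-)\<^sup>2\<close> with the curvatures \<open>\<rho>\<^sub>+\<close>, \<open>\<rho>\<^sub>-\<close> of the poles at time \<open>s\<close>.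
  If \<open>q\<close> did not vanish, the curvature of the poles would be at least of order \<open>sqrt (- s)\<close>, and since
  \<open>- \<rho>\<close> is the time derivative of \<open>ln u\<close> at the pole, \<open>ln u\<close> would grow superlinearly in \<open>- s\<close> there. But
  \<open>ln w\<close> is convex in \<open>x\<close>, so a large \<open>ln u\<close> at the pole forces a large area, proportional up to a
  factor logarithmic in \<open>\<rho>\<close>, while the area is linear in time.
\<close>

section \<open>The maximum principle on the line\<close>

text \<open>The bound has to be uniform over all past times, while compactness yields only constants
  depending on the time interval. Compactness is therefore used qualitatively, to justify the
  maximum principle and the boundary terms on an unbounded line where w grows like (cosh x)^2. The
  quantitative estimates start at a time s, depend only on what is known at time s, and gain from s
  tending to minus infinity. The combination tau = N - 2 R tends to 0 at both poles, although N and
  2 R separately need not. Its derivative -2 q - p tau contains q, so that tau^2 can pay for w q^2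
  in a Bernstein type estimate. The initial value of tau is not bounded a priori. It is measured by
  the curvature of the poles, so a nonzero q produces a differential inequality for ln u at the
  poles in backward time. This inequality forces blow-up after a finite backward time, which
  contradicts existence for all t < 0.\<close>

lemma global_max_second_derivative_nonpos:
  fixes h h' :: "real \<Rightarrow> real"
  assumes d: "\<And>y. (h has_real_derivative h' y) (at y)"
    and d2: "(h' has_real_derivative h2) (at x)"
    and max: "\<And>y. h y \<le> h x"
  shows "h2 \<le> 0"
proof (rule ccontr)
  assume "\<not> h2 \<le> 0"
  then have "0 < h2" by simp
  have 0: "h' x = 0"
    by (rule DERIV_local_max[OF d[of x], of 1]) (use max in auto)
  obtain \<delta> where \<delta>: "\<delta> > 0" "\<And>k. k > 0 \<Longrightarrow> k < \<delta> \<Longrightarrow> h' x < h' (x + k)"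
    using DERIV_pos_inc_right[OF d2 \<open>0 < h2\<close>] by blast
  obtain z where z: "x < z" "z < x + \<delta>/2" "h (x + \<delta>/2) - h x = (x + \<delta>/2 - x) * h' z"
    using MVT2[of x "x + \<delta>/2" h h'] d \<delta>(1) by auto
  have "h' z > 0"
    using \<delta>(2)[of "z - x"] z \<delta>(1) 0 by auto
  then have "h (x + \<delta>/2) > h x"
    using z(3) \<delta>(1) by (simp add: algebra_simps) (smt (verit) mult_pos_pos)
  with max[of "x + \<delta>/2"] show False by simp
qed

lemma ln_cosh_ge: "ln (cosh x) \<ge> \<bar>x\<bar> - ln 2" for x :: real
proof -
  have "exp \<bar>x\<bar> / 2 \<le> cosh x"
    by (auto simp: cosh_def abs_if)
  then have "ln (exp \<bar>x\<bar> / 2) \<le> ln (cosh x)"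
    by (subst ln_le_cancel_iff) auto
  then show ?thesis by (simp add: ln_div)
qed

lemma one_minus_tanh_square: "1 - (tanh x)\<^sup>2 = 1 / (cosh x)\<^sup>2" for x :: real
proof -
  have "1 - (tanh x)\<^sup>2 = ((cosh x)\<^sup>2 - (sinh x)\<^sup>2) / (cosh x)\<^sup>2"
    by (simp add: tanh_def power_divide diff_divide_distrib)
  then show ?thesis by (simp add: hyperbolic_pythagoras)
qed

text \<open>
  The barrier \<open>ln (cosh x)\<close>, whose second derivative is \<open>1 / (cosh x)\<^sup>2\<close>, makes up for the
  missing boundary condition at infinity: the two ends of the line are the poles of the sphere,
  which have zero capacity.
\<close>

lemma max_principle_line:
  fixes f fx fxx ft a :: "real \<Rightarrow> real \<Rightarrow> real"
  assumes cont: "continuous_on (UNIV \<times> {s..t1}) (\<lambda>(x,t). f x t)"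
    and bdd: "\<And>x t. t \<in> {s..t1} \<Longrightarrow> f x t \<le> B"
    and dx: "\<And>x t. t \<in> {s<..t1} \<Longrightarrow> ((\<lambda>x. f x t) has_real_derivative fx x t) (at x)"
    and dxx: "\<And>x t. t \<in> {s<..t1} \<Longrightarrow> ((\<lambda>x. fx x t) has_real_derivative fxx x t) (at x)"
    and dt: "\<And>x t. t \<in> {s<..t1} \<Longrightarrow> ((\<lambda>t. f x t) has_real_derivative ft x t) (at t)"
    and a0: "\<And>x t. t \<in> {s<..t1} \<Longrightarrow> 0 \<le> a x t"
    and aM: "\<And>x t. t \<in> {s<..t1} \<Longrightarrow> a x t \<le> M * (cosh x)\<^sup>2"
    and init: "\<And>x. f x s \<le> c"
    and ineq: "\<And>x t. t \<in> {s<..t1} \<Longrightarrow> f x t > c \<Longrightarrow> ft x t \<le> a x t * fxx x t"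
    and t0: "t0 \<in> {s..t1}"
  shows "f x0 t0 \<le> c"
proof (rule ccontr)
  assume "\<not> f x0 t0 \<le> c"
  then have gt: "f x0 t0 > c" by simp
  then have "t0 \<noteq> s" using init[of x0] by auto
  then have t0': "t0 \<in> {s<..t1}" using t0 by auto
  have M0: "M \<ge> 0"
    using a0[OF t0', of 0] aM[OF t0', of 0] by simp
  define b where "b = (\<lambda>x::real. ln (cosh x))"
  have b0: "b x \<ge> 0" for x by (simp add: b_def cosh_real_ge_1)
  have b1: "(b has_real_derivative tanh x) (at x)" for x
    unfolding b_def by (auto intro!: derivative_eq_intros simp: tanh_def)
  have b2: "(tanh has_real_derivative 1 / (cosh x)\<^sup>2) (at x)" for x :: real
    using has_field_derivative_tanh[OF _ DERIV_ident, of x] unfolding one_minus_tanh_square by simp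
  \<comment> \<open>\<open>E\<close> is the value of the barrier at the target point. Dividing the
    excess over \<open>c\<close> by \<open>E + 1\<close> keeps \<open>g x0 t0\<close> above
    \<open>c\<close> and also covers \<open>E = 0\<close>.\<close>
  define E where "E = b x0 + (M+1) * (t0 - s)"
  have E0: "E \<ge> 0" using b0[of x0] M0 t0 by (simp add: E_def)
  define \<epsilon> where "\<epsilon> = (f x0 t0 - c) / (E + 1)"
  have \<epsilon>0: "\<epsilon> > 0" using E0 gt by (simp add: \<epsilon>_def)
  \<comment> \<open>At a spatial maximum of \<open>g\<close> the diffusion term is at most
    \<open>\<epsilon> * M\<close>, as \<open>a\<close> is at most M (cosh x)^2 and the barrier has
    second derivative 1 / (cosh x)^2. The rate \<open>M + 1\<close> exceeds this, so
    \<open>g\<close> strictly decreases in time there, against maximality.\<close>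
  define g where "g = (\<lambda>x t. f x t - \<epsilon> * (b x + (M+1) * (t - s)))"
  have "\<epsilon> * E < \<epsilon> * (E + 1)"
    using \<epsilon>0 by simp
  also have "\<dots> = f x0 t0 - c"
    using E0 by (simp add: \<epsilon>_def)
  finally have g0: "g x0 t0 > c" by (simp add: g_def E_def)
  \<comment> \<open>Beyond this distance the barrier outweighs the upper bound \<open>B\<close>, so
    the supremum of \<open>g\<close> is attained on a compact set.\<close>
  define X where "X = \<bar>x0\<bar> + \<bar>B - c\<bar> / \<epsilon> + ln 2"
  have Xpos: "X \<ge> \<bar>x0\<bar>" using \<epsilon>0 by (simp add: X_def)
  have far: "g x t \<le> c" if "\<bar>x\<bar> > X" "t \<in> {s..t1}" for x t
  proof -
    have "b x \<ge> \<bar>B - c\<bar> / \<epsilon>"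
      using ln_cosh_ge[of x] that(1) unfolding b_def X_def by linarith
    then have "\<epsilon> * b x \<ge> \<bar>B - c\<bar>"
      using \<epsilon>0 by (simp add: field_simps)
    moreover have "\<epsilon> * ((M+1) * (t - s)) \<ge> 0"
      using that(2) M0 \<epsilon>0 by simp
    ultimately show ?thesis
      using bdd[OF that(2), of x] unfolding g_def ring_distribs by linarith
  qed
  have bcont: "continuous_on UNIV b"
    using b1 DERIV_continuous_on by blast
  have gcont: "continuous_on ({-X..X} \<times> {s..t1}) (\<lambda>(x,t). g x t)"
    unfolding g_def split_beta
    using continuous_on_subset[OF cont, of "{-X..X} \<times> {s..t1}"]
    by (intro continuous_intros continuous_on_compose2[OF bcont]) (auto simp: split_beta)
  have "(x0, t0) \<in> {-X..X} \<times> {s..t1}" using Xpos t0 by auto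
  moreover have "compact ({-X..X} \<times> {s..t1})" by (intro compact_Times compact_Icc)
  ultimately have "\<exists>p\<in>{-X..X} \<times> {s..t1}. \<forall>q\<in>{-X..X} \<times> {s..t1}.
     (case q of (x,t) \<Rightarrow> g x t) \<le> (case p of (x,t) \<Rightarrow> g x t)"
    by (intro continuous_attains_sup[OF _ _ gcont]) blast+
  then obtain p where p: "p \<in> {-X..X} \<times> {s..t1}"
     "\<And>q. q \<in> {-X..X} \<times> {s..t1} \<Longrightarrow> (case q of (x,t) \<Rightarrow> g x t) \<le> (case p of (x,t) \<Rightarrow> g x t)"
    by blast
  obtain x t where xt: "p = (x, t)" by (cases p)
  have mx: "g y r \<le> g x t" if "r \<in> {s..t1}" for y r
  proof (cases "\<bar>y\<bar> > X")
    case True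
    then have "g y r \<le> g x0 t0" using far that g0 by force
    also have "\<dots> \<le> g x t" using p(2)[of "(x0,t0)"] Xpos t0 xt by (auto simp: abs_le_iff)
    finally show ?thesis .
  next
    case False
    then show ?thesis using p(2)[of "(y,r)"] that xt by (auto simp: abs_le_iff not_less)
  qed
  have t: "t \<in> {s..t1}" using p xt by auto
  have gx: "g x t > c" using mx[OF t0, of x0] g0 by simp
  have "\<epsilon> * (b x + (M+1) * (t - s)) \<ge> 0"
    using b0 \<epsilon>0 M0 t by simp
  then have fgt: "f x t > c" using gx unfolding g_def by linarith
  then have "t \<noteq> s" using init[of x] by auto
  then have t': "t \<in> {s<..t1}" using t by auto
  have "fxx x t - \<epsilon> * (1 / (cosh x)\<^sup>2) \<le> 0"
  proof (rule global_max_second_derivative_nonpos[where h="\<lambda>y. g y t" and h'="\<lambda>y. fx y t - \<epsilon> * tanh y"])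
    show "((\<lambda>y. g y t) has_real_derivative fx y t - \<epsilon> * tanh y) (at y)" for y
      unfolding g_def by (auto intro!: derivative_eq_intros dx[OF t'] b1)
    show "((\<lambda>y. fx y t - \<epsilon> * tanh y) has_real_derivative fxx x t - \<epsilon> * (1 / (cosh x)\<^sup>2)) (at x)"
      by (auto intro!: derivative_eq_intros dxx[OF t'] b2 simp: one_minus_tanh_square)
    show "g y t \<le> g x t" for y using mx t by simp
  qed
  then have "fxx x t \<le> \<epsilon> / (cosh x)\<^sup>2" by simp
  then have "a x t * fxx x t \<le> a x t * (\<epsilon> / (cosh x)\<^sup>2)"
    using a0[OF t'] by (intro mult_left_mono) auto
  also have "\<dots> \<le> M * (cosh x)\<^sup>2 * (\<epsilon> / (cosh x)\<^sup>2)"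
    using aM[OF t'] \<epsilon>0 by (intro mult_right_mono) auto
  also have "\<dots> = M * \<epsilon>" by simp
  finally have ft: "ft x t \<le> M * \<epsilon>" using ineq[OF t' fgt] by simp
  have gt: "((\<lambda>r. g x r) has_real_derivative ft x t - \<epsilon> * (M+1)) (at t)"
    unfolding g_def by (auto intro!: derivative_eq_intros dt[OF t'])
  have neg: "ft x t - \<epsilon> * (M+1) < 0" using ft \<epsilon>0 by (simp add: algebra_simps)
  obtain d where d: "d > 0" "\<And>h. h > 0 \<Longrightarrow> h < d \<Longrightarrow> g x t < g x (t - h)"
    using DERIV_neg_dec_left[OF gt neg] by blast
  define h where "h = min (d/2) (t - s)"
  have "h > 0" "h < d" "t - h \<in> {s..t1}" using d(1) t' by (auto simp: h_def min_def)
  then show False using d(2)[of h] mx[of "t-h" x] by force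
qed

text \<open>Only \<open>ftx\<close> is known to be continuous, so \<open>ft\<close> is integrated in
  time, differentiated in x under the integral, and the result is differentiated in time by the
  fundamental theorem of calculus.\<close>

lemma mixed_partial:
  fixes f fx ft ftx :: "real \<Rightarrow> real \<Rightarrow> real"
  assumes dx: "\<And>x t. t < 0 \<Longrightarrow> ((\<lambda>x. f x t) has_real_derivative fx x t) (at x)"
    and dt: "\<And>x t. t < 0 \<Longrightarrow> ((\<lambda>t. f x t) has_real_derivative ft x t) (at t)"
    and dtx: "\<And>x t. t < 0 \<Longrightarrow> ((\<lambda>x. ft x t) has_real_derivative ftx x t) (at x)"
    and cont: "continuous_on (UNIV \<times> {..<0}) (\<lambda>(x,t). ftx x t)"
    and t: "t < 0"
  shows "((\<lambda>t. fx x t) has_real_derivative ftx x t) (at t)"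
proof -
  define a b where "a = t - 1" and "b = t / 2"
  have ab: "a < t" "t < b" "b < 0" using t by (auto simp: a_def b_def)
  have ftc: "((\<lambda>r. ft y r) has_integral (f y \<tau> - f y a)) {a..\<tau>}" if "\<tau> \<in> {a..b}" for y \<tau>
  proof (rule fundamental_theorem_of_calculus)
    show "a \<le> \<tau>" using that by simp
    fix r assume "r \<in> {a..\<tau>}"
    then have "r < 0" using that ab by auto
    then show "((\<lambda>t. f y t) has_vector_derivative ft y r) (at r within {a..\<tau>})"
      using dt[of r y] has_real_derivative_iff_has_vector_derivative has_vector_derivative_at_within by blast
  qed
  have "fx x \<tau> - fx x a = integral {a..\<tau>} (\<lambda>r. ftx x r)" if \<tau>: "\<tau> \<in> {a..b}" for \<tau>
  proof -
    have "((\<lambda>y. integral (cbox a \<tau>) (\<lambda>r. ft y r)) has_field_derivative integral (cbox a \<tau>) (\<lambda>r. ftx x r)) (at x within UNIV)"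
    proof (rule leibniz_rule_field_derivative)
      show "continuous_on (UNIV \<times> cbox a \<tau>) (\<lambda>(x, t). ftx x t)"
        by (rule continuous_on_subset[OF cont]) (use \<tau> ab in auto)
    qed (use ftc[OF \<tau>] dtx \<tau> ab in \<open>auto simp: integrable_on_def\<close>)
    moreover have "integral (cbox a \<tau>) (\<lambda>r. ft y r) = f y \<tau> - f y a" for y
      using ftc[OF \<tau>, of y] by (simp add: integral_unique)
    ultimately have 1: "((\<lambda>y. f y \<tau> - f y a) has_real_derivative integral {a..\<tau>} (\<lambda>r. ftx x r)) (at x)"
      by simp
    have 2: "((\<lambda>y. f y \<tau> - f y a) has_real_derivative fx x \<tau> - fx x a) (at x)"
      using \<tau> ab by (auto intro!: derivative_eq_intros dx)
    show ?thesis using DERIV_unique[OF 2 1] .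
  qed
  then have eq: "fx x \<tau> = fx x a + integral {a..\<tau>} (\<lambda>r. ftx x r)" if "\<tau> \<in> {a..b}" for \<tau>
    using that by force
  have "continuous_on {a..b} (\<lambda>r. ftx x r)"
    using continuous_on_compose2[OF cont, of "{a..b}" "\<lambda>r. (x, r)"] ab
    by (auto simp: continuous_on_Pair image_subset_iff)
  then have "((\<lambda>\<tau>. integral {a..\<tau>} (\<lambda>r. ftx x r)) has_real_derivative ftx x t) (at t within {a..b})"
    by (rule integral_has_real_derivative) (use ab in auto)
  then have "((\<lambda>\<tau>. fx x a + integral {a..\<tau>} (\<lambda>r. ftx x r)) has_real_derivative ftx x t) (at t within {a..b})"
    by (auto intro!: derivative_eq_intros)
  then have "((\<lambda>\<tau>. fx x \<tau>) has_real_derivative ftx x t) (at t within {a..b})"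
    by (rule has_field_derivative_transform_within[where d=1]) (use eq[symmetric] ab in auto)
  then show ?thesis
    using ab by (simp add: at_within_Icc_at)
qed

section \<open>Rotationally symmetric solutions\<close>

text \<open>\<open>bounds\<close> records what smoothness of u on the closed sphere means on the
  line: u = (cosh x)^2 / w is pinched between positive constants, the curvature is bounded, and
  x-derivatives of the curvature and of ln u are O(1 / cosh x). The constant may depend on the time
  interval. \<open>incr\<close> is monotonicity of w in time, read through
  \<open>evol\<close>.\<close>

locale line_flow =
  fixes w w1 w2 w3 w4 w5 :: "real \<Rightarrow> real \<Rightarrow> real"
  assumes dw0: "t < 0 \<Longrightarrow> ((\<lambda>x. w x t) has_real_derivative w1 x t) (at x)"
    and dw1: "t < 0 \<Longrightarrow> ((\<lambda>x. w1 x t) has_real_derivative w2 x t) (at x)"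
    and dw2: "t < 0 \<Longrightarrow> ((\<lambda>x. w2 x t) has_real_derivative w3 x t) (at x)"
    and dw3: "t < 0 \<Longrightarrow> ((\<lambda>x. w3 x t) has_real_derivative w4 x t) (at x)"
    and dw4: "t < 0 \<Longrightarrow> ((\<lambda>x. w4 x t) has_real_derivative w5 x t) (at x)"
    and c0: "continuous_on (UNIV \<times> {..<0}) (\<lambda>(x,t). w x t)"
    and c1: "continuous_on (UNIV \<times> {..<0}) (\<lambda>(x,t). w1 x t)"
    and c2: "continuous_on (UNIV \<times> {..<0}) (\<lambda>(x,t). w2 x t)"
    and c3: "continuous_on (UNIV \<times> {..<0}) (\<lambda>(x,t). w3 x t)"
    and c4: "continuous_on (UNIV \<times> {..<0}) (\<lambda>(x,t). w4 x t)"
    and c5: "continuous_on (UNIV \<times> {..<0}) (\<lambda>(x,t). w5 x t)"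
    and pos: "t < 0 \<Longrightarrow> w x t > 0"
    and evol: "t < 0 \<Longrightarrow> ((\<lambda>t. w x t) has_real_derivative w x t * w2 x t - (w1 x t)\<^sup>2) (at t)"
    and incr: "t < 0 \<Longrightarrow> (w1 x t)\<^sup>2 \<le> w x t * w2 x t"
    and bounds: "s \<le> t1 \<Longrightarrow> t1 < 0 \<Longrightarrow> \<exists>K>0. \<forall>x. \<forall>t\<in>{s..t1}.
       (cosh x)\<^sup>2 \<le> K * w x t \<and> w x t \<le> K * (cosh x)\<^sup>2 \<and>
       w2 x t - (w1 x t)\<^sup>2 / w x t \<le> K \<and>
       \<bar>w3 x t - 2 * w1 x t * w2 x t / w x t + (w1 x t)^3 / (w x t)\<^sup>2\<bar> \<le> K / cosh x \<and>
       \<bar>w1 x t / w x t - 2 * tanh x\<bar> \<le> K / cosh x"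
begin

text \<open>
  \<open>R\<close> is the scalar curvature of the metric \<open>(dx\<^sup>2 + d\<theta>\<^sup>2) / w\<close>, and \<open>p\<close> is the slope of \<open>ln w\<close>.
  The stationary cylinder, the cigar and the Rosenau solution all satisfy \<open>q = 0\<close>.
\<close>

definition "R x t = w2 x t - (w1 x t)\<^sup>2 / w x t"
definition "R' x t = w3 x t - 2 * w1 x t * w2 x t / w x t + (w1 x t)^3 / (w x t)\<^sup>2"
definition "p x t = w1 x t / w x t"
definition "N x t = 4 * w x t - (w1 x t)\<^sup>2 / w x t"
definition "tau x t = 4 * w x t - 2 * w2 x t + (w1 x t)\<^sup>2 / w x t"
definition "tau' x t = 4 * w1 x t - 2 * w3 x t + 2 * w1 x t * w2 x t / w x t - (w1 x t)^3 / (w x t)\<^sup>2"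
definition "q x t = w3 x t - 4 * w1 x t"

lemmas dw = dw0 dw1 dw2 dw3 dw4

lemma ne: "t < 0 \<Longrightarrow> w x t \<noteq> 0"
  using pos[of t x] by simp

lemma dt1: "t < 0 \<Longrightarrow> ((\<lambda>t. w1 x t) has_real_derivative w x t * w3 x t - w1 x t * w2 x t) (at t)"
  by (rule mixed_partial[OF dw0 evol])
     (auto intro!: derivative_eq_intros dw continuous_intros c0[unfolded split_beta] c1[unfolded split_beta]
        c2[unfolded split_beta] c3[unfolded split_beta] simp: split_beta power2_eq_square algebra_simps)

lemma dt2: "t < 0 \<Longrightarrow> ((\<lambda>t. w2 x t) has_real_derivative w x t * w4 x t - (w2 x t)\<^sup>2) (at t)"
  by (rule mixed_partial[OF dw1 dt1])
     (auto intro!: derivative_eq_intros dw continuous_intros c0[unfolded split_beta] c1[unfolded split_beta]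
        c2[unfolded split_beta] c4[unfolded split_beta] simp: split_beta power2_eq_square algebra_simps)

lemma dt3: "t < 0 \<Longrightarrow> ((\<lambda>t. w3 x t) has_real_derivative
    w x t * w5 x t + w1 x t * w4 x t - 2 * w2 x t * w3 x t) (at t)"
  by (rule mixed_partial[OF dw2 dt2])
     (auto intro!: derivative_eq_intros dw continuous_intros c0[unfolded split_beta] c1[unfolded split_beta]
        c2[unfolded split_beta] c3[unfolded split_beta] c4[unfolded split_beta] c5[unfolded split_beta]
        simp: split_beta power2_eq_square algebra_simps)

lemma R_nonneg: "t < 0 \<Longrightarrow> R x t \<ge> 0"
  using incr[of t x] pos[of t x] by (simp add: R_def field_simps)

lemma dR: "t < 0 \<Longrightarrow> ((\<lambda>x. R x t) has_real_derivative R' x t) (at x)"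
  unfolding R_def R'_def using pos[of t x]
  by (auto intro!: derivative_eq_intros dw simp: field_simps power2_eq_square power3_eq_cube)

lemma dp: "t < 0 \<Longrightarrow> ((\<lambda>x. p x t) has_real_derivative R x t / w x t) (at x)"
  unfolding R_def p_def using pos[of t x]
  by (auto intro!: derivative_eq_intros dw simp: field_simps power2_eq_square)

lemma dN: "t < 0 \<Longrightarrow> ((\<lambda>x. N x t) has_real_derivative p x t * tau x t) (at x)"
  unfolding N_def p_def tau_def using pos[of t x]
  by (auto intro!: derivative_eq_intros dw simp: field_simps power2_eq_square power3_eq_cube)

lemma dtau: "t < 0 \<Longrightarrow> ((\<lambda>x. tau x t) has_real_derivative tau' x t) (at x)"
  unfolding tau_def tau'_def using pos[of t x]
  by (auto intro!: derivative_eq_intros dw simp: field_simps power2_eq_square power3_eq_cube)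

text \<open>Since N / w = 4 - p^2 and p_x = R / w, the terms with p R cancel and only R' survives.
  As R' / w decays like exp (-3 |x|), this identity is the source of the decay of tau at the
  poles.\<close>

lemma dtau_over_w: "t < 0 \<Longrightarrow> ((\<lambda>x. tau x t / w x t) has_real_derivative - 2 * R' x t / w x t) (at x)"
  unfolding tau_def R'_def using pos[of t x]
  by (auto intro!: derivative_eq_intros dw simp: field_simps power2_eq_square power3_eq_cube)

lemma tau_eq: "tau x t = N x t - 2 * R x t"
  by (simp add: tau_def N_def R_def)

lemma q_eq: "t < 0 \<Longrightarrow> q x t = R' x t - p x t * tau x t"
  unfolding q_def R'_def p_def tau_def using pos[of t x]
  by (simp add: field_simps power2_eq_square power3_eq_cube)

lemma tau'_eq: "t < 0 \<Longrightarrow> tau' x t = - 2 * q x t - p x t * tau x t"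
  unfolding q_def tau'_def p_def tau_def using pos[of t x]
  by (simp add: field_simps power2_eq_square power3_eq_cube)

lemma bounds':
  assumes "s \<le> t1" "t1 < 0"
  obtains K where "K > 0" "\<And>x t. t \<in> {s..t1} \<Longrightarrow> (cosh x)\<^sup>2 \<le> K * w x t"
     "\<And>x t. t \<in> {s..t1} \<Longrightarrow> w x t \<le> K * (cosh x)\<^sup>2"
     "\<And>x t. t \<in> {s..t1} \<Longrightarrow> R x t \<le> K"
     "\<And>x t. t \<in> {s..t1} \<Longrightarrow> \<bar>R' x t\<bar> \<le> K / cosh x"
     "\<And>x t. t \<in> {s..t1} \<Longrightarrow> \<bar>p x t - 2 * tanh x\<bar> \<le> K / cosh x"
proof -
  obtain K where "K > 0" "\<forall>x. \<forall>t\<in>{s..t1}. (cosh x)\<^sup>2 \<le> K * w x t \<and> w x t \<le> K * (cosh x)\<^sup>2 \<and>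
      R x t \<le> K \<and> \<bar>R' x t\<bar> \<le> K / cosh x \<and> \<bar>p x t - 2 * tanh x\<bar> \<le> K / cosh x"
    using bounds[OF assms] unfolding R_def[symmetric] R'_def[symmetric] p_def[symmetric] by blast
  then show thesis by (intro that[of K]) auto
qed

text \<open>The equation is invariant under x to -x. Estimates are proved at the pole x = +infinity
  and transferred to the other one by this interpretation.\<close>

lemma mirror:
  "line_flow (\<lambda>x t. w (- x) t) (\<lambda>x t. - w1 (- x) t) (\<lambda>x t. w2 (- x) t)
     (\<lambda>x t. - w3 (- x) t) (\<lambda>x t. w4 (- x) t) (\<lambda>x t. - w5 (- x) t)"
proof -
  have cont: "continuous_on (UNIV \<times> {..<0}) (\<lambda>(x, t). f (- x) t)"
    if "continuous_on (UNIV \<times> {..<0}) (\<lambda>(x,t). f x t)" for f :: "real \<Rightarrow> real \<Rightarrow> real"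
  proof -
    have "continuous_on (UNIV \<times> {..<0}) (\<lambda>z. case (- fst z, snd z) of (x, t) \<Rightarrow> f x t)"
      by (rule continuous_on_compose2[OF that]) (auto intro!: continuous_intros)
    then show ?thesis by (simp add: split_beta)
  qed
  have cont': "continuous_on (UNIV \<times> {..<0}) (\<lambda>(x, t). - f (- x) t)"
    if "continuous_on (UNIV \<times> {..<0}) (\<lambda>(x,t). f x t)" for f :: "real \<Rightarrow> real \<Rightarrow> real"
    using continuous_on_minus[OF cont[OF that]] by (simp add: split_beta)
  have d: "((\<lambda>x. f (- x) t) has_real_derivative - g (- x) t) (at x)"
    "((\<lambda>x. - f (- x) t) has_real_derivative g (- x) t) (at x)"
    if "\<And>x t. t < 0 \<Longrightarrow> ((\<lambda>x. f x t) has_real_derivative g x t) (at x)" "t < 0"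
    for f g :: "real \<Rightarrow> real \<Rightarrow> real" and x t
  proof -
    show 1: "((\<lambda>x. f (- x) t) has_real_derivative - g (- x) t) (at x)"
      using that(1)[OF that(2), of "- x"] by (subst (asm) DERIV_mirror)
    show "((\<lambda>x. - f (- x) t) has_real_derivative g (- x) t) (at x)"
      using DERIV_minus[OF 1] by simp
  qed
  show ?thesis
  proof unfold_locales
    fix s t1 :: real assume "s \<le> t1" "t1 < 0"
    from bounds[OF this] obtain K where K: "K > 0" "\<And>x t. t \<in> {s..t1} \<Longrightarrow>
       (cosh x)\<^sup>2 \<le> K * w x t \<and> w x t \<le> K * (cosh x)\<^sup>2 \<and>
       w2 x t - (w1 x t)\<^sup>2 / w x t \<le> K \<and>
       \<bar>w3 x t - 2 * w1 x t * w2 x t / w x t + (w1 x t)^3 / (w x t)\<^sup>2\<bar> \<le> K / cosh x \<and>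
       \<bar>w1 x t / w x t - 2 * tanh x\<bar> \<le> K / cosh x" by blast
    show "\<exists>K>0. \<forall>x. \<forall>t\<in>{s..t1}.
       (cosh x)\<^sup>2 \<le> K * w (- x) t \<and> w (- x) t \<le> K * (cosh x)\<^sup>2 \<and>
       w2 (- x) t - (- w1 (- x) t)\<^sup>2 / w (- x) t \<le> K \<and>
       \<bar>- w3 (- x) t - 2 * - w1 (- x) t * w2 (- x) t / w (- x) t + (- w1 (- x) t)^3 / (w (- x) t)\<^sup>2\<bar> \<le> K / cosh x \<and>
       \<bar>- w1 (- x) t / w (- x) t - 2 * tanh x\<bar> \<le> K / cosh x"
    proof (intro exI[of _ K] conjI allI ballI K(1))
      fix x t assume t: "t \<in> {s..t1}"
      show "\<bar>- w3 (- x) t - 2 * - w1 (- x) t * w2 (- x) t / w (- x) t + (- w1 (- x) t)^3 / (w (- x) t)\<^sup>2\<bar> \<le> K / cosh x"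
        using K(2)[OF t, of "- x"] by (simp add: abs_if split: if_splits)
      show "\<bar>- w1 (- x) t / w (- x) t - 2 * tanh x\<bar> \<le> K / cosh x"
        using K(2)[OF t, of "- x"] by (simp add: abs_if split: if_splits)
    qed (use K(2)[of _ "- _"] in auto)
  next
    fix t x :: real assume t: "t < 0"
    show "0 < w (- x) t" by (rule pos[OF t])
    show "((\<lambda>t. w (- x) t) has_real_derivative w (- x) t * w2 (- x) t - (- w1 (- x) t)\<^sup>2) (at t)"
      using evol[OF t, of "- x"] by simp
    show "(- w1 (- x) t)\<^sup>2 \<le> w (- x) t * w2 (- x) t" using incr[OF t, of "- x"] by simp
  qed (rule cont cont' d dw c0 c1 c2 c3 c4 c5; assumption?)+
qed

section \<open>Convexity of ln w and its slope at the poles\<close>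

lemma p_mono:
  assumes "t < 0" "x \<le> y"
  shows "p x t \<le> p y t"
proof (rule DERIV_nonneg_imp_nondecreasing[OF assms(2)])
  fix z
  show "\<exists>d. ((\<lambda>x. p x t) has_real_derivative d) (at z) \<and> 0 \<le> d"
    using dp[OF assms(1)] R_nonneg[OF assms(1)] pos[OF assms(1)] by (meson divide_nonneg_pos)
qed

lemma one_over_cosh_lim: "((\<lambda>x::real. 1 / cosh x) \<longlongrightarrow> 0) at_top" "((\<lambda>x::real. 1 / cosh x) \<longlongrightarrow> 0) at_bot"
  using cosh_real_at_top cosh_real_at_bot
  by (auto intro!: tendsto_divide_0[OF tendsto_const] filterlim_at_top_imp_at_infinity)

lemma p_lim:
  assumes t: "t < 0"
  shows "((\<lambda>x. p x t) \<longlongrightarrow> 2) at_top" "((\<lambda>x. p x t) \<longlongrightarrow> -2) at_bot"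
proof -
  obtain K where K: "\<And>x. \<bar>p x t - 2 * tanh x\<bar> \<le> K / cosh x"
    using bounds'[of t t] t by (metis atLeastAtMost_singleton order_refl singletonI)
  have 1: "((\<lambda>x. p x t - 2 * tanh x) \<longlongrightarrow> 0) at_top"
    by (rule tendsto_0_le[OF one_over_cosh_lim(1), of _ K]) (use K in auto)
  have 2: "((\<lambda>x. p x t - 2 * tanh x) \<longlongrightarrow> 0) at_bot"
    by (rule tendsto_0_le[OF one_over_cosh_lim(2), of _ K]) (use K in auto)
  show "((\<lambda>x. p x t) \<longlongrightarrow> 2) at_top"
    using tendsto_add[OF 1 tendsto_mult[OF tendsto_const[of 2] tanh_real_at_top]] by simp
  show "((\<lambda>x. p x t) \<longlongrightarrow> -2) at_bot"
    using tendsto_add[OF 2 tendsto_mult[OF tendsto_const[of 2] tanh_real_at_bot]] by simp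
qed

lemma p_bounds:
  assumes t: "t < 0"
  shows "p x t \<le> 2" "- 2 \<le> p x t"
proof -
  show "p x t \<le> 2"
    by (rule tendsto_lowerbound[OF p_lim(1)[OF t] eventually_at_top_linorderI[of x]])
       (auto intro: p_mono[OF t])
  show "- 2 \<le> p x t"
    by (rule tendsto_upperbound[OF p_lim(2)[OF t] eventually_at_bot_linorderI[of x]])
       (auto intro: p_mono[OF t])
qed

lemma N_eq: "t < 0 \<Longrightarrow> N x t = w x t * ((2 - p x t) * (2 + p x t))"
  unfolding N_def p_def using pos[of t x] by (simp add: field_simps power2_eq_square)

lemma N_nonneg: "t < 0 \<Longrightarrow> N x t \<ge> 0"
  using p_bounds[of t x] pos[of t x] by (simp add: N_eq)

section \<open>Nonnegativity of tau\<close>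

lemma cont_slice:
  assumes "t1 < 0"
  shows "continuous_on (UNIV \<times> {s..t1}) (\<lambda>z. w (fst z) (snd z))"
    "continuous_on (UNIV \<times> {s..t1}) (\<lambda>z. w1 (fst z) (snd z))"
    "continuous_on (UNIV \<times> {s..t1}) (\<lambda>z. w2 (fst z) (snd z))"
    "continuous_on (UNIV \<times> {s..t1}) (\<lambda>z. w3 (fst z) (snd z))"
  using assms by (auto intro!: continuous_on_subset[OF c0[unfolded split_beta]]
    continuous_on_subset[OF c1[unfolded split_beta]] continuous_on_subset[OF c2[unfolded split_beta]]
    continuous_on_subset[OF c3[unfolded split_beta]])

text \<open>X = R - \<gamma> N satisfies X_t = w X_xx - k R^2 + \<gamma> p^2 w (N - 2 R) with k = 2
  \<gamma> - 1. Where X > 0 the last term is nonpositive because \<gamma> > 1/2, and R >= X, so X is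
  compared with the solution 1 / (k (t - s)) of y' = - k y^2, whatever its initial value. An ancient
  solution allows s to tend to minus infinity.\<close>

lemma R_le_gamma_N_aux:
  assumes \<gamma>: "\<gamma> > 1/2" and t: "s < t" "t < 0"
  shows "(2*\<gamma> - 1) * (t - s) * (R x t - \<gamma> * N x t) \<le> 1"
proof -
  define k where "k = 2*\<gamma> - 1"
  have k: "k > 0" using \<gamma> by (simp add: k_def)
  define X where "X = (\<lambda>x t. R x t - \<gamma> * N x t)"
  define Xx where "Xx = (\<lambda>x t. R' x t - \<gamma> * (p x t * tau x t))"
  define Xxx where "Xxx = (\<lambda>x t. w4 x t - (1-\<gamma>) * (2 * (w2 x t)\<^sup>2 / w x t + 2 * w1 x t * w3 x t / w x t
     - 5 * (w1 x t)\<^sup>2 * w2 x t / (w x t)\<^sup>2 + 2 * (w1 x t)^4 / (w x t)^3) - 4*\<gamma>*w2 x t)"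
  define Xt where "Xt = (\<lambda>x t. w x t * Xxx x t - k * (R x t)\<^sup>2 + \<gamma> * ((w1 x t)\<^sup>2 / w x t) * (N x t - 2 * R x t))"
  obtain K where K: "K > 0" "\<And>x r. r \<in> {s..t} \<Longrightarrow> w x r \<le> K * (cosh x)\<^sup>2" "\<And>x r. r \<in> {s..t} \<Longrightarrow> R x r \<le> K"
    using bounds'[of s t] t by (metis less_imp_le)
  have XR: "X x r \<le> R x r" if "r < 0" for x r
    using N_nonneg[OF that, of x] \<gamma> by (simp add: X_def)
  have dXx: "((\<lambda>x. X x r) has_real_derivative Xx x r) (at x)" if "r < 0" for x r
    unfolding X_def Xx_def using that by (auto intro!: derivative_eq_intros dR dN)
  have dXxx: "((\<lambda>x. Xx x r) has_real_derivative Xxx x r) (at x)" if "r < 0" for x r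
    unfolding Xx_def Xxx_def R'_def p_def tau_def using that pos[OF that, of x]
    by (auto intro!: derivative_eq_intros dw) (simp add: field_simps power2_eq_square power3_eq_cube power4_eq_xxxx)
  have dXt: "((\<lambda>r. X x r) has_real_derivative Xt x r) (at r)" if "r < 0" for x r
    unfolding X_def Xt_def Xxx_def R_def N_def k_def using that pos[OF that, of x]
    by (auto intro!: derivative_eq_intros evol dt1 dt2)
       (simp add: field_simps power2_eq_square power3_eq_cube power4_eq_xxxx)
  have "k * (t - s) * X x t \<le> 1"
  proof (rule max_principle_line[where f="\<lambda>x r. k * (r - s) * X x r" and s=s and ?t1.0=t and B="k * (t - s) * K"
        and fx="\<lambda>x r. k * (r - s) * Xx x r" and fxx="\<lambda>x r. k * (r - s) * Xxx x r"
        and ft="\<lambda>x r. k * (X x r + (r - s) * Xt x r)" and a=w and M=K])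
    show "continuous_on (UNIV \<times> {s..t}) (\<lambda>(x, r). k * (r - s) * X x r)"
      unfolding split_beta X_def R_def N_def
      by (intro continuous_intros cont_slice) (use t ne in auto)
  next
    fix x r assume r: "r \<in> {s..t}"
    have "k * (r - s) * X x r \<le> k * (r - s) * K"
      using XR[of r x] K(3)[OF r, of x] r t k by (intro mult_left_mono) auto
    also have "\<dots> \<le> k * (t - s) * K"
      using r k K(1) by (intro mult_right_mono mult_left_mono) auto
    finally show "k * (r - s) * X x r \<le> k * (t - s) * K" .
  next
    fix x r assume r: "r \<in> {s<..t}"
    then have r0: "r < 0" using t by auto
    show "((\<lambda>x. k * (r - s) * X x r) has_real_derivative k * (r - s) * Xx x r) (at x)"
      by (intro DERIV_cmult dXx r0)
    show "((\<lambda>x. k * (r - s) * Xx x r) has_real_derivative k * (r - s) * Xxx x r) (at x)"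
      by (intro DERIV_cmult dXxx r0)
    show "((\<lambda>r. k * (r - s) * X x r) has_real_derivative k * (X x r + (r - s) * Xt x r)) (at r)"
      by (auto intro!: derivative_eq_intros dXt r0 simp: algebra_simps)
    show "0 \<le> w x r" using pos[OF r0, of x] by simp
    show "w x r \<le> K * (cosh x)\<^sup>2" using K(2) r by simp
    assume gt: "1 < k * (r - s) * X x r"
    have krs: "k * (r - s) > 0" using k r by simp
    then have X0: "X x r > 0" using gt by (smt (verit) mult_nonneg_nonpos)
    have "\<gamma> * N x r \<ge> 1/2 * N x r" using \<gamma> N_nonneg[OF r0, of x] by (intro mult_right_mono) auto
    then have "N x r - 2 * R x r \<le> 0" using X0 by (simp add: X_def)
    then have "\<gamma> * ((w1 x r)\<^sup>2 / w x r) * (N x r - 2 * R x r) \<le> 0"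
      using \<gamma> pos[OF r0, of x] by (intro mult_nonneg_nonpos) auto
    then have "Xt x r \<le> w x r * Xxx x r - k * (R x r)\<^sup>2" by (simp add: Xt_def)
    then have 1: "(r - s) * Xt x r \<le> (r - s) * (w x r * Xxx x r - k * (R x r)\<^sup>2)"
      using r by (intro mult_left_mono) auto
    \<comment> \<open>The factor \<open>r - s\<close> creates an extra term X under the time
      derivative. Inserting \<open>k * (r - s) * X x r\<close>, which exceeds 1 here, bounds it by k
      (r - s) R^2, exactly what the damping supplies.\<close>
    have "X x r \<le> 1 * R x r" using XR[OF r0] by simp
    also have "\<dots> \<le> k * (r - s) * X x r * R x r"
      using gt R_nonneg[OF r0] by (intro mult_right_mono) auto
    also have "\<dots> \<le> k * (r - s) * R x r * R x r"
      using krs XR[OF r0, of x] R_nonneg[OF r0] by (intro mult_right_mono mult_left_mono) auto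
    finally have "X x r + (r - s) * Xt x r \<le> (r - s) * (w x r * Xxx x r)"
      using 1 by (simp add: algebra_simps power2_eq_square)
    then have "k * (X x r + (r - s) * Xt x r) \<le> k * ((r - s) * (w x r * Xxx x r))"
      using k by (intro mult_left_mono) auto
    then show "k * (X x r + (r - s) * Xt x r) \<le> w x r * (k * (r - s) * Xxx x r)"
      by (simp add: algebra_simps)
  qed (use t in auto)
  then show ?thesis by (simp add: k_def X_def)
qed

lemma tau_nonneg:
  assumes t: "t < 0"
  shows "tau x t \<ge> 0"
proof -
  have le: "R x t \<le> \<gamma> * N x t" if \<gamma>: "\<gamma> > 1/2" for \<gamma>
  proof (rule ccontr)
    assume "\<not> ?thesis"
    then have X: "R x t - \<gamma> * N x t > 0" by simp
    \<comment> \<open>With this starting time the left side of \<open>R_le_gamma_N_aux\<close>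
      equals 2.\<close>
    define s where "s = t - 2 / ((2*\<gamma>-1) * (R x t - \<gamma> * N x t))"
    have kX: "(2*\<gamma>-1) * (R x t - \<gamma> * N x t) > 0" using X \<gamma> by simp
    then have "s < t" by (simp add: s_def)
    from R_le_gamma_N_aux[OF \<gamma> this t, of x] have "2 \<le> (1::real)"
      using kX X \<gamma> by (simp add: s_def)
    then show False by simp
  qed
  show ?thesis
  proof (cases "N x t = 0")
    case True
    then show ?thesis using le[of 1] by (simp add: tau_eq)
  next
    case False
    then have Np: "N x t > 0" using N_nonneg[OF t, of x] by simp
    show ?thesis
    proof (rule ccontr)
      assume "\<not> ?thesis"
      then have half: "2 * R x t > N x t" by (simp add: tau_eq)
      \<comment> \<open>This \<gamma> is the midpoint of 1/2 and R / N, so it lies strictly below R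
        / N.\<close>
      have "(2 * R x t + N x t) / (4 * N x t) > 1/2" using half Np by (simp add: field_simps)
      then have "R x t \<le> (2 * R x t + N x t) / (4 * N x t) * N x t" by (rule le)
      also have "\<dots> = (2 * R x t + N x t) / 4" using Np by simp
      finally show False using half by simp
    qed
  qed
qed

section \<open>Boundedness and decay at the poles\<close>

lemma tau_le_N: "t < 0 \<Longrightarrow> tau x t \<le> N x t"
  using R_nonneg[of t x] by (simp add: tau_eq)

text \<open>The factor w in N = w (2 - p) (2 + p) is unbounded, so p has to approach 2 and -2 at an
  exponential rate. The rate comes from p_x = R / w <= K^2 / (cosh x)^2: subtracting K^2 tanh x
  makes p nonincreasing, and its limits at both ends are known.\<close>

lemma N_bounded:
  assumes "s \<le> t1" "t1 < 0"
  obtains C where "\<And>x t. t \<in> {s..t1} \<Longrightarrow> N x t \<le> C"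
proof -
  obtain K where K: "K > 0" "\<And>x t. t \<in> {s..t1} \<Longrightarrow> (cosh x)\<^sup>2 \<le> K * w x t"
     "\<And>x t. t \<in> {s..t1} \<Longrightarrow> w x t \<le> K * (cosh x)\<^sup>2"
     "\<And>x t. t \<in> {s..t1} \<Longrightarrow> R x t \<le> K"
    using bounds'[OF assms] by metis
  have "N x t \<le> K^5" if t: "t \<in> {s..t1}" for x t
  proof -
    have t0: "t < 0" using t assms by simp
    define h where "h = (\<lambda>x. p x t - K\<^sup>2 * tanh x)"
    have dh: "(h has_real_derivative R y t / w y t - K\<^sup>2 / (cosh y)\<^sup>2) (at y)" for y
      unfolding h_def using t0 by (auto intro!: derivative_eq_intros dp simp: one_minus_tanh_square)
    have dh0: "R y t / w y t - K\<^sup>2 / (cosh y)\<^sup>2 \<le> 0" for y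
    proof -
      have "R y t * (cosh y)\<^sup>2 \<le> K * (K * w y t)"
        using K R_nonneg[OF t0] t by (intro mult_mono) auto
      then show ?thesis using pos[OF t0, of y] by (simp add: field_simps power2_eq_square)
    qed
    have hmono: "h y \<ge> h z" if "y \<le> z" for y z
      by (rule DERIV_nonpos_imp_nonincreasing[OF that]) (use dh dh0 in blast)
    have "(h \<longlongrightarrow> 2 - K\<^sup>2 * 1) at_top"
      unfolding h_def by (intro tendsto_intros p_lim t0 tanh_real_at_top)
    then have "2 - K\<^sup>2 * 1 \<le> h x"
      by (rule tendsto_upperbound[OF _ eventually_at_top_linorderI[of x]]) (auto intro: hmono)
    then have 1: "2 - p x t \<le> K\<^sup>2 * (1 - tanh x)" by (simp add: h_def algebra_simps)
    have "(h \<longlongrightarrow> -2 - K\<^sup>2 * (-1)) at_bot"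
      unfolding h_def by (intro tendsto_intros p_lim t0 tanh_real_at_bot)
    then have "-2 - K\<^sup>2 * (-1) \<ge> h x"
      by (rule tendsto_lowerbound[OF _ eventually_at_bot_linorderI[of x]]) (auto intro: hmono)
    then have 2: "2 + p x t \<le> K\<^sup>2 * (1 + tanh x)" by (simp add: h_def algebra_simps)
    have "(2 - p x t) * (2 + p x t) \<le> (K\<^sup>2 * (1 - tanh x)) * (K\<^sup>2 * (1 + tanh x))"
      using p_bounds[OF t0, of x] 1 2 by (intro mult_mono) auto
    also have "\<dots> = K^4 * (1 - (tanh x)\<^sup>2)"
      by (simp add: algebra_simps power2_eq_square power4_eq_xxxx)
    also have "\<dots> = K^4 / (cosh x)\<^sup>2" by (simp add: one_minus_tanh_square)
    finally have "N x t \<le> w x t * (K^4 / (cosh x)\<^sup>2)"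
      using pos[OF t0, of x] unfolding N_eq[OF t0] by (intro mult_left_mono) auto
    also have "\<dots> \<le> (K * (cosh x)\<^sup>2) * (K^4 / (cosh x)\<^sup>2)"
      using K(3)[OF t] by (intro mult_right_mono) auto
    also have "\<dots> = K^5" by (simp add: field_simps eval_nat_numeral)
    finally show ?thesis .
  qed
  then show thesis by (rule that)
qed

lemma one_over_cosh_le: "1 / cosh x \<le> 2 * exp (- x)" for x :: real
proof -
  have "exp x \<le> 2 * cosh x" by (simp add: cosh_def)
  then show ?thesis by (simp add: field_simps exp_minus)
qed

lemma tau_over_w_lim:
  assumes t: "t < 0"
  shows "((\<lambda>x. tau x t / w x t) \<longlongrightarrow> 0) at_top"
proof -
  obtain K where K: "K > 0" "\<And>x. (cosh x)\<^sup>2 \<le> K * w x t"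
    using bounds'[of t t] t by (metis atLeastAtMost_singleton order_refl singletonI)
  obtain C where C: "\<And>x. N x t \<le> C"
    using N_bounded[of t t] t by (metis atLeastAtMost_singleton order_refl singletonI)
  have le: "norm (tau x t / w x t) \<le> norm (1 / cosh x) * (C * K)" for x
  proof -
    have C0: "C \<ge> 0" using C[of x] N_nonneg[OF t, of x] by simp
    have "cosh x \<le> (cosh x)\<^sup>2" using cosh_real_ge_1[of x] by (simp add: power2_eq_square)
    then have "cosh x \<le> K * w x t" using K(2)[of x] by simp
    then have "tau x t * cosh x \<le> C * (K * w x t)"
      using tau_le_N[OF t, of x] C[of x] C0 by (intro mult_mono) auto
    then show ?thesis
      using pos[OF t, of x] tau_nonneg[OF t, of x] by (simp add: field_simps)
  qed
  show ?thesis
    by (rule tendsto_0_le[OF one_over_cosh_lim(1), of _ "C * K"]) (intro always_eventually allI le)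
qed

lemma tau_over_w_decay:
  assumes "s \<le> t1" "t1 < 0"
  obtains C where "C > 0" "\<And>x t. t \<in> {s..t1} \<Longrightarrow> tau x t / w x t \<le> C * exp (- 3 * x)"
proof -
  obtain K where K: "K > 0" "\<And>x t. t \<in> {s..t1} \<Longrightarrow> (cosh x)\<^sup>2 \<le> K * w x t"
     "\<And>x t. t \<in> {s..t1} \<Longrightarrow> \<bar>R' x t\<bar> \<le> K / cosh x"
    using bounds'[OF assms] by metis
  \<comment> \<open>The derivative of tau / w is at most 2 K^2 / (cosh x)^3 <= 16 K^2 exp (-3 x) in
    absolute value; integrating from x to infinity, where tau / w vanishes, gives the factor
    16/3.\<close>
  have "tau x t / w x t \<le> 16/3 * K\<^sup>2 * exp (- 3 * x)" if t: "t \<in> {s..t1}" for x t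
  proof -
    have t0: "t < 0" using t assms by simp
    have d: "\<bar>- 2 * R' y t / w y t\<bar> \<le> 16 * K\<^sup>2 * exp (- 3 * y)" for y
    proof -
      have "\<bar>R' y t\<bar> * (cosh y)\<^sup>2 \<le> K / cosh y * (K * w y t)"
        using K t by (intro mult_mono) auto
      then have "\<bar>- 2 * R' y t / w y t\<bar> \<le> 2 * K\<^sup>2 * (1 / cosh y)^3"
        using pos[OF t0, of y] by (simp add: field_simps abs_mult power2_eq_square power3_eq_cube)
      also have "\<dots> \<le> 2 * K\<^sup>2 * (2 * exp (- y))^3"
        using one_over_cosh_le[of y] by (intro mult_left_mono power_mono) auto
      also have "(2 * exp (- y))^3 = 8 * exp (- 3 * y)"
        using exp_of_nat_mult[of 3 "-y"] by (simp add: power_mult_distrib)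
      finally show ?thesis by simp
    qed
    define g where "g = (\<lambda>y. tau y t / w y t - 16/3 * K\<^sup>2 * exp (- 3 * y))"
    have "(g has_real_derivative - 2 * R' y t / w y t + 16 * K\<^sup>2 * exp (- 3 * y)) (at y)" for y
      unfolding g_def by (rule derivative_eq_intros dtau_over_w t0 refl | simp)+
    moreover have "- 2 * R' y t / w y t + 16 * K\<^sup>2 * exp (- 3 * y) \<ge> 0" for y
      using d[of y] by linarith
    ultimately have mono: "g y \<le> g z" if "y \<le> z" for y z
      using DERIV_nonneg_imp_nondecreasing[OF that, of g] by blast
    have "((\<lambda>y::real. exp (- 3 * y)) \<longlongrightarrow> 0) at_top"
      by (rule filterlim_compose[OF exp_at_bot])
         (auto simp: filterlim_uminus_at_bot intro!: filterlim_tendsto_pos_mult_at_top[OF tendsto_const] filterlim_ident)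
    then have "(g \<longlongrightarrow> 0 - 16/3 * K\<^sup>2 * 0) at_top"
      unfolding g_def by (intro tendsto_intros tau_over_w_lim t0)
    then have "g x \<le> 0 - 16/3 * K\<^sup>2 * 0"
      by (rule tendsto_lowerbound[OF _ eventually_at_top_linorderI[of x]]) (auto intro: mono)
    then show ?thesis by (simp add: g_def)
  qed
  then show thesis using K(1) by (intro that[of "16/3 * K\<^sup>2"]) auto
qed

text \<open>w grows at most like exp (2 |x|), so the rate 3 for tau / w leaves rate 1 for
  tau.\<close>

lemma tau_decay:
  assumes "s \<le> t1" "t1 < 0"
  obtains C where "C > 0" "\<And>x t. t \<in> {s..t1} \<Longrightarrow> tau x t \<le> C * exp (- \<bar>x\<bar>)"
proof -
  interpret m: line_flow "\<lambda>x t. w (- x) t" "\<lambda>x t. - w1 (- x) t" "\<lambda>x t. w2 (- x) t"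
     "\<lambda>x t. - w3 (- x) t" "\<lambda>x t. w4 (- x) t" "\<lambda>x t. - w5 (- x) t"
    by (rule mirror)
  have mtau: "m.tau x t = tau (- x) t" for x t by (simp add: m.tau_def tau_def)
  obtain K where K: "K > 0" "\<And>x t. t \<in> {s..t1} \<Longrightarrow> w x t \<le> K * (cosh x)\<^sup>2"
    using bounds'[OF assms] by metis
  obtain A where A: "A > 0" "\<And>x t. t \<in> {s..t1} \<Longrightarrow> tau x t / w x t \<le> A * exp (- 3 * x)"
    using tau_over_w_decay[OF assms] by metis
  obtain B where B: "B > 0" "\<And>x t. t \<in> {s..t1} \<Longrightarrow> tau (- x) t / w (- x) t \<le> B * exp (- 3 * x)"
    using m.tau_over_w_decay[OF assms] unfolding mtau by metis
  have "tau x t \<le> max A B * K * exp (- \<bar>x\<bar>)" if t: "t \<in> {s..t1}" for x t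
  proof -
    have t0: "t < 0" using t assms by simp
    have "tau x t / w x t \<le> A * exp (- 3 * \<bar>x\<bar>) \<or> tau x t / w x t \<le> B * exp (- 3 * \<bar>x\<bar>)"
      using A(2)[OF t, of x] B(2)[OF t, of "- x"] by (cases "x \<ge> 0") auto
    moreover have "A * exp (- 3 * \<bar>x\<bar>) \<le> max A B * exp (- 3 * \<bar>x\<bar>)" "B * exp (- 3 * \<bar>x\<bar>) \<le> max A B * exp (- 3 * \<bar>x\<bar>)"
      by (intro mult_right_mono; simp)+
    ultimately have "tau x t / w x t \<le> max A B * exp (- 3 * \<bar>x\<bar>)" by (meson order_trans)
    then have "tau x t \<le> w x t * (max A B * exp (- 3 * \<bar>x\<bar>))"
      using pos[OF t0, of x] by (simp add: field_simps)
    also have "\<dots> \<le> (K * exp (2 * \<bar>x\<bar>)) * (max A B * exp (- 3 * \<bar>x\<bar>))"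
    proof (rule mult_right_mono)
      have "cosh x \<le> exp \<bar>x\<bar>" by (auto simp: cosh_def abs_if)
      then have "(cosh x)\<^sup>2 \<le> (exp \<bar>x\<bar>)\<^sup>2" by (intro power_mono) auto
      then have "(cosh x)\<^sup>2 \<le> exp (2 * \<bar>x\<bar>)" by (simp add: exp_double)
      then show "w x t \<le> K * exp (2 * \<bar>x\<bar>)"
        using K(2)[OF t, of x] K(1) by (smt (verit) mult_left_mono)
      show "0 \<le> max A B * exp (- 3 * \<bar>x\<bar>)" using A(1) by (simp add: less_max_iff_disj less_imp_le)
    qed
    also have "\<dots> = max A B * K * (exp (2 * \<bar>x\<bar>) * exp (- 3 * \<bar>x\<bar>))"
      by (simp only: mult_ac)
    also have "exp (2 * \<bar>x\<bar>) * exp (- 3 * \<bar>x\<bar>) = exp (- \<bar>x\<bar>)"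
      by (simp flip: exp_add)
    finally show ?thesis .
  qed
  then show thesis using K(1) A(1) by (intro that[of "max A B * K"]) (auto simp: less_max_iff_disj)
qed

text \<open>The definition q = w3 - 4 w1 hides a cancellation between growing terms. In the form q =
  R' - p tau both summands are O(1 / cosh x), which compensates the growth of w.\<close>

lemma S_bounded:
  assumes "s \<le> t1" "t1 < 0"
  obtains C where "\<And>x t. t \<in> {s..t1} \<Longrightarrow> w x t * (q x t)\<^sup>2 \<le> C"
proof -
  obtain K where K: "K > 0" "\<And>x t. t \<in> {s..t1} \<Longrightarrow> w x t \<le> K * (cosh x)\<^sup>2"
     "\<And>x t. t \<in> {s..t1} \<Longrightarrow> \<bar>R' x t\<bar> \<le> K / cosh x"
    using bounds'[OF assms] by metis
  obtain C where C: "C > 0" "\<And>x t. t \<in> {s..t1} \<Longrightarrow> tau x t \<le> C * exp (- \<bar>x\<bar>)"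
    using tau_decay[OF assms] by metis
  have "w x t * (q x t)\<^sup>2 \<le> K * (K + 2 * C)\<^sup>2" if t: "t \<in> {s..t1}" for x t
  proof -
    have t0: "t < 0" using t assms by simp
    have ce: "cosh x \<le> exp \<bar>x\<bar>" by (auto simp: cosh_def abs_if)
    have "\<bar>p x t * tau x t\<bar> \<le> 2 * (C * exp (- \<bar>x\<bar>))"
      unfolding abs_mult using p_bounds[OF t0, of x] C(2)[OF t, of x] tau_nonneg[OF t0, of x]
      by (intro mult_mono) auto
    also have "exp (- \<bar>x\<bar>) \<le> 1 / cosh x" using ce by (simp add: exp_minus field_simps)
    finally have "\<bar>p x t * tau x t\<bar> \<le> 2 * C / cosh x" using C(1) by (simp add: field_simps)
    then have "\<bar>q x t\<bar> \<le> (K + 2 * C) / cosh x"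
      using K(3)[OF t, of x] unfolding q_eq[OF t0] add_divide_distrib by linarith
    then have "\<bar>q x t\<bar>\<^sup>2 \<le> ((K + 2 * C) / cosh x)\<^sup>2" by (intro power_mono) auto
    then have "w x t * (q x t)\<^sup>2 \<le> (K * (cosh x)\<^sup>2) * ((K + 2 * C) / cosh x)\<^sup>2"
      using K(2)[OF t, of x] pos[OF t0, of x] by (intro mult_mono) auto
    then show ?thesis by (simp add: power_divide)
  qed
  then show thesis by (rule that)
qed

text \<open>Since tau_t = w tau_xx - p^2 w tau, the square tau^2 produces the good term 2 w (tau_x^2
  + p^2 tau^2). It pays for the term 4 w q^2 that appears when the factor t - s is differentiated; w
  q^2 alone is already a subsolution because w w_xx >= w_x^2.\<close>

lemma S_decay:
  assumes st: "s < t" "t < 0" and c: "\<And>x. tau x s \<le> c"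
  shows "4 * (t - s) * (w x t * (q x t)\<^sup>2) \<le> c\<^sup>2"
proof -
  have s0: "s < 0" using st by simp
  define q' where "q' = (\<lambda>x t. w4 x t - 4 * w2 x t)"
  define q2 where "q2 = (\<lambda>x t. w5 x t - 4 * w3 x t)"
  define tau2 where "tau2 = (\<lambda>x t. 4 * w2 x t - 2 * w4 x t + 2 * (w2 x t)\<^sup>2 / w x t + 2 * w1 x t * w3 x t / w x t
     - 5 * (w1 x t)\<^sup>2 * w2 x t / (w x t)\<^sup>2 + 2 * (w1 x t)^4 / (w x t)^3)"
  have dq: "((\<lambda>x. q x r) has_real_derivative q' x r) (at x)" if "r < 0" for x r
    unfolding q_def q'_def using that by (auto intro!: derivative_eq_intros dw)
  have dq': "((\<lambda>x. q' x r) has_real_derivative q2 x r) (at x)" if "r < 0" for x r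
    unfolding q2_def q'_def using that by (auto intro!: derivative_eq_intros dw)
  have dqt: "((\<lambda>r. q x r) has_real_derivative w x r * q2 x r + w1 x r * q' x r - 2 * w2 x r * q x r) (at r)"
    if "r < 0" for x r
    unfolding q_def q'_def q2_def using that
    by (auto intro!: derivative_eq_intros dt1 dt3 simp: algebra_simps)
  have dtau': "((\<lambda>x. tau' x r) has_real_derivative tau2 x r) (at x)" if "r < 0" for x r
    unfolding tau'_def tau2_def using that pos[OF that, of x]
    by (auto intro!: derivative_eq_intros dw) (simp add: field_simps power2_eq_square power3_eq_cube power4_eq_xxxx)
  have dtaut: "((\<lambda>r. tau x r) has_real_derivative w x r * tau2 x r - (w1 x r)\<^sup>2 / w x r * tau x r) (at r)"
    if "r < 0" for x r
    unfolding tau_def tau2_def using that pos[OF that, of x]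
    by (auto intro!: derivative_eq_intros evol dt1 dt2)
       (simp add: field_simps power2_eq_square power3_eq_cube power4_eq_xxxx)
  have tau_at_s: "tau x s \<ge> 0" for x by (rule tau_nonneg[OF s0])
  have c0: "c \<ge> 0" using tau_at_s[of 0] c[of 0] by simp
  obtain C where C: "\<And>x r. r \<in> {s..t} \<Longrightarrow> w x r * (q x r)\<^sup>2 \<le> C"
    using S_bounded[of s t] st by (metis less_imp_le)
  obtain D where D: "\<And>x r. r \<in> {s..t} \<Longrightarrow> N x r \<le> D"
    using N_bounded[of s t] st by (metis less_imp_le)
  obtain K where K: "\<And>x r. r \<in> {s..t} \<Longrightarrow> w x r \<le> K * (cosh x)\<^sup>2"
    using bounds'[of s t] st by (metis less_imp_le)
  define f where "f = (\<lambda>x r. 4 * (r - s) * (w x r * (q x r)\<^sup>2) + (tau x r)\<^sup>2)"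
  define fx where "fx = (\<lambda>x r. 4 * (r - s) * (w1 x r * (q x r)\<^sup>2 + 2 * w x r * q x r * q' x r) + 2 * tau x r * tau' x r)"
  define fxx where "fxx = (\<lambda>x r. 4 * (r - s) * (w2 x r * (q x r)\<^sup>2 + 4 * w1 x r * q x r * q' x r
     + 2 * w x r * (q' x r)\<^sup>2 + 2 * w x r * q x r * q2 x r) + 2 * (tau' x r)\<^sup>2 + 2 * tau x r * tau2 x r)"
  define ft where "ft = (\<lambda>x r. 4 * (w x r * (q x r)\<^sup>2) + 4 * (r - s) * ((w x r * w2 x r - (w1 x r)\<^sup>2) * (q x r)\<^sup>2
     + 2 * w x r * q x r * (w x r * q2 x r + w1 x r * q' x r - 2 * w2 x r * q x r))
     + 2 * tau x r * (w x r * tau2 x r - (w1 x r)\<^sup>2 / w x r * tau x r))"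
  have "f x t \<le> c\<^sup>2"
  proof (rule max_principle_line[where f=f and fx=fx and fxx=fxx and ft=ft and a=w and s=s and ?t1.0=t and M=K
        and B="4 * (t - s) * C + D\<^sup>2"])
    show "continuous_on (UNIV \<times> {s..t}) (\<lambda>(x, r). f x r)"
      unfolding split_beta f_def q_def tau_def
      by (intro continuous_intros cont_slice) (use st ne in auto)
  next
    fix x r assume r: "r \<in> {s..t}"
    then have r0: "r < 0" using st by auto
    have S0: "w x r * (q x r)\<^sup>2 \<ge> 0" using pos[OF r0, of x] by simp
    have "4 * (r - s) * (w x r * (q x r)\<^sup>2) \<le> 4 * (t - s) * C"
      using C[OF r, of x] S0 r by (intro mult_mono) auto
    moreover have "(tau x r)\<^sup>2 \<le> D\<^sup>2"
      using tau_nonneg[OF r0, of x] tau_le_N[OF r0, of x] D[OF r, of x] by (intro power_mono) auto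
    ultimately show "f x r \<le> 4 * (t - s) * C + D\<^sup>2" by (simp add: f_def)
  next
    fix x r assume r: "r \<in> {s<..t}"
    then have r0: "r < 0" using st by auto
    show "((\<lambda>x. f x r) has_real_derivative fx x r) (at x)"
      unfolding f_def fx_def using r0
      by (auto intro!: derivative_eq_intros dw dq dtau simp: algebra_simps power2_eq_square)
    show "((\<lambda>x. fx x r) has_real_derivative fxx x r) (at x)"
      unfolding fx_def fxx_def using r0
      by (auto intro!: derivative_eq_intros dw dq dq' dtau dtau' simp: algebra_simps power2_eq_square)
    show "((\<lambda>r. f x r) has_real_derivative ft x r) (at r)"
      unfolding f_def ft_def using r0
      by (auto intro!: derivative_eq_intros evol dqt dtaut simp: algebra_simps power2_eq_square)
    show "0 \<le> w x r" using pos[OF r0, of x] by simp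
    show "w x r \<le> K * (cosh x)\<^sup>2" using K r by simp
    have wne: "w x r \<noteq> 0" by (rule ne[OF r0])
    have "w x r * fxx x r - ft x r = 4 * (r - s) * (2 * w x r * w1 x r * q x r * q' x r + 2 * (w x r)\<^sup>2 * (q' x r)\<^sup>2
        + (w1 x r)\<^sup>2 * (q x r)\<^sup>2 + 4 * (w x r * w2 x r) * (q x r)\<^sup>2)
        + w x r * (2 * (tau' x r)\<^sup>2 + 2 * (p x r * tau x r)\<^sup>2 - 4 * (q x r)\<^sup>2)"
      unfolding fxx_def ft_def p_def using wne by (simp add: field_simps power2_eq_square)
    \<comment> \<open>Substituting tau_x = -2 q - p tau leaves a perfect square. The factor 4 in
      \<open>f\<close> is the largest one for which this quadratic form in q and p tau is
      nonnegative.\<close>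
    also have "2 * (tau' x r)\<^sup>2 + 2 * (p x r * tau x r)\<^sup>2 - 4 * (q x r)\<^sup>2 = (2 * q x r + 2 * (p x r * tau x r))\<^sup>2"
      unfolding tau'_eq[OF r0] by (simp add: algebra_simps power2_eq_square)
    finally have eq: "w x r * fxx x r - ft x r = 4 * (r - s) * (2 * w x r * w1 x r * q x r * q' x r + 2 * (w x r)\<^sup>2 * (q' x r)\<^sup>2
        + (w1 x r)\<^sup>2 * (q x r)\<^sup>2 + 4 * (w x r * w2 x r) * (q x r)\<^sup>2)
        + w x r * (2 * q x r + 2 * (p x r * tau x r))\<^sup>2" .
    \<comment> \<open>Completing the square absorbs the mixed term q q' without using the term with
      w w2, which is nonnegative by itself.\<close>
    have "(w x r * w2 x r) * (q x r)\<^sup>2 \<ge> (w1 x r)\<^sup>2 * (q x r)\<^sup>2"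
      using incr[OF r0, of x] by (intro mult_right_mono) auto
    then have "2 * w x r * w1 x r * q x r * q' x r + 2 * (w x r)\<^sup>2 * (q' x r)\<^sup>2
        + (w1 x r)\<^sup>2 * (q x r)\<^sup>2 + 4 * (w x r * w2 x r) * (q x r)\<^sup>2
        \<ge> (w x r * q' x r + w1 x r * q x r)\<^sup>2 + (w x r * q' x r)\<^sup>2 + 4 * ((w1 x r)\<^sup>2 * (q x r)\<^sup>2)"
      by (simp add: algebra_simps power2_eq_square)
    moreover have "(w x r * q' x r + w1 x r * q x r)\<^sup>2 + (w x r * q' x r)\<^sup>2 + 4 * ((w1 x r)\<^sup>2 * (q x r)\<^sup>2) \<ge> 0"
      by simp
    ultimately have "0 \<le> 2 * w x r * w1 x r * q x r * q' x r + 2 * (w x r)\<^sup>2 * (q' x r)\<^sup>2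
        + (w1 x r)\<^sup>2 * (q x r)\<^sup>2 + 4 * (w x r * w2 x r) * (q x r)\<^sup>2" (is "0 \<le> ?E") by linarith
    then have "0 \<le> 4 * (r - s) * ?E" using r by (intro mult_nonneg_nonneg) auto
    moreover have "0 \<le> w x r * (2 * q x r + 2 * (p x r * tau x r))\<^sup>2"
      using pos[OF r0, of x] by simp
    ultimately have "w x r * fxx x r - ft x r \<ge> 0" unfolding eq by simp
    then show "ft x r \<le> w x r * fxx x r" by simp
  next
    show "f x s \<le> c\<^sup>2" for x
      using c[of x] tau_at_s[of x] by (simp add: f_def power_mono)
  qed (use st in auto)
  then show ?thesis unfolding f_def by (smt (verit) zero_le_power2)
qed

end

section \<open>Curvature at the poles\<close>

text \<open>From r >= sqrt (c \<sigma>) the function G grows at least like \<sigma>^(3/2). The upper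
  bound then forces ln (1 + r) to be at least of order sqrt \<sigma>, so r is eventually larger than
  a multiple of G^2. As r = G', this is a Riccati inequality, and G becomes infinite at a finite
  \<sigma>.\<close>

lemma no_slow_superlinear_growth:
  fixes G r :: "real \<Rightarrow> real"
  assumes dG: "\<And>\<sigma>. \<sigma> \<ge> 0 \<Longrightarrow> (G has_real_derivative r \<sigma>) (at \<sigma>)"
    and r0: "\<And>\<sigma>. \<sigma> \<ge> 0 \<Longrightarrow> r \<sigma> \<ge> 0"
    and c: "c > 0" and rc: "\<And>\<sigma>. \<sigma> > 0 \<Longrightarrow> c * \<sigma> \<le> (r \<sigma>)\<^sup>2"
    and K: "K > 0" and GK: "\<And>\<sigma>. \<sigma> \<ge> 0 \<Longrightarrow> G \<sigma> \<le> K * (1 + \<sigma>) * (1 + ln (1 + r \<sigma>))"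
  shows False
proof -
  \<comment> \<open>Over \<open>{\<sigma>/2..\<sigma>}\<close> the function G gains at least 2 k
    \<sigma>^(3/2); half of this gain is reserved to absorb \<open>G 0\<close>.\<close>
  define k where "k = sqrt (c / 2) / 4"
  have k: "k > 0" using c by (simp add: k_def)
  have G1: "G \<sigma> \<ge> G 0 + 2 * k * (\<sigma> * sqrt \<sigma>)" if s: "\<sigma> > 0" for \<sigma>
  proof -
    have mono: "G 0 \<le> G (\<sigma>/2)"
      by (rule DERIV_nonneg_imp_nondecreasing) (use s dG r0 in force)+
    obtain z where z: "\<sigma>/2 < z" "z < \<sigma>" "G \<sigma> - G (\<sigma>/2) = (\<sigma> - \<sigma>/2) * r z"
      using MVT2[of "\<sigma>/2" \<sigma> G r] s dG by auto
    have "c / 2 * \<sigma> \<le> c * z" using z c s by (simp add: field_simps)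
    also have "\<dots> \<le> (r z)\<^sup>2" using rc[of z] z s by auto
    finally have "sqrt (c / 2 * \<sigma>) \<le> r z" using r0[of z] z s by (intro real_le_lsqrt) auto
    then have "sqrt (c / 2) * sqrt \<sigma> \<le> r z" by (simp only: real_sqrt_mult)
    then have "\<sigma>/2 * (sqrt (c / 2) * sqrt \<sigma>) \<le> \<sigma>/2 * r z" using s by (intro mult_left_mono) auto
    then show ?thesis using z(3) mono by (simp add: k_def algebra_simps)
  qed
  define \<sigma>0 where "\<sigma>0 = max 1 (\<bar>G 0\<bar> / k)"
  have G2: "G \<sigma> \<ge> k * (\<sigma> * sqrt \<sigma>)" "G \<sigma> \<ge> k * \<sigma>" if s: "\<sigma> \<ge> \<sigma>0" for \<sigma>
  proof -
    have s1: "\<sigma> \<ge> 1" "\<bar>G 0\<bar> / k \<le> \<sigma>" using s by (auto simp: \<sigma>0_def)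
    have "\<sigma> * 1 \<le> \<sigma> * sqrt \<sigma>" using s1 by (intro mult_left_mono) auto
    then have 1: "k * \<sigma> \<le> k * (\<sigma> * sqrt \<sigma>)" using k by (intro mult_left_mono) auto
    have "\<bar>G 0\<bar> \<le> k * \<sigma>" using s1 k by (simp add: field_simps)
    then show "G \<sigma> \<ge> k * (\<sigma> * sqrt \<sigma>)" using G1[of \<sigma>] s1 1 by linarith
    then show "G \<sigma> \<ge> k * \<sigma>" using 1 by linarith
  qed
  define C where "C = (12 * K)^6 * exp 1"
  have C: "C > 0" using K by (simp add: C_def)
  define c1 where "c1 = k^4 / C"
  have c1: "c1 > 0" using k C by (simp add: c1_def)
  have key: "c1 * (G \<sigma>)\<^sup>2 \<le> 1 + r \<sigma>" if s: "\<sigma> \<ge> \<sigma>0" for \<sigma>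
  proof -
    have s1: "\<sigma> \<ge> 1" using s by (simp add: \<sigma>0_def)
    have rp: "r \<sigma> \<ge> 0" using r0 s1 by simp
    define y where "y = 1 + ln (1 + r \<sigma>)"
    have y1: "y \<ge> 1" using rp by (simp add: y_def)
    \<comment> \<open>The sixth power is chosen so that \<sigma> cancels: G^6 is at most C
      \<sigma>^6 (1 + r), while G^4 is at least k^4 \<sigma>^6. The quotient leaves exactly
      G^2.\<close>
    have "y / 6 \<le> exp (y / 6)" using exp_ge_add_one_self[of "y/6"] by linarith
    then have "(y / 6)^6 \<le> exp (y / 6)^6" using y1 by (intro power_mono) auto
    also have "exp (y / 6)^6 = exp y" using exp_of_nat_mult[of 6 "y/6"] by simp
    also have "\<dots> = exp 1 * (1 + r \<sigma>)" using rp by (simp add: y_def exp_add)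
    finally have y6: "y^6 \<le> 6^6 * (exp 1 * (1 + r \<sigma>))" by (simp add: power_divide field_simps)
    have Gp: "G \<sigma> > 0" using G2(2)[OF s] k s1 by (smt (verit) mult_pos_pos)
    have "G \<sigma> \<le> K * (1 + \<sigma>) * y" using GK[of \<sigma>] s1 by (simp add: y_def)
    also have "\<dots> \<le> K * (2 * \<sigma>) * y" using K s1 y1 by (intro mult_right_mono mult_left_mono) auto
    finally have "(G \<sigma>)^6 \<le> (K * (2 * \<sigma>) * y)^6" using Gp by (intro power_mono) auto
    also have "\<dots> = (2 * K)^6 * \<sigma>^6 * y^6" by (simp add: power_mult_distrib)
    also have "\<dots> \<le> (2 * K)^6 * \<sigma>^6 * (6^6 * (exp 1 * (1 + r \<sigma>)))"
      using y6 K s1 by (intro mult_left_mono) auto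
    also have "\<dots> = C * \<sigma>^6 * (1 + r \<sigma>)" by (simp add: C_def power_mult_distrib)
    finally have up: "(G \<sigma>)^6 \<le> C * \<sigma>^6 * (1 + r \<sigma>)" .
    have "(k * (\<sigma> * sqrt \<sigma>))^4 \<le> (G \<sigma>)^4"
      using G2(1)[OF s] k s1 by (intro power_mono) auto
    moreover have "(sqrt \<sigma>)^4 = \<sigma>\<^sup>2" using s1 by (simp add: power4_eq_xxxx power2_eq_square)
    ultimately have "k^4 * \<sigma>^6 \<le> (G \<sigma>)^4"
      by (simp add: power_mult_distrib mult.assoc flip: power_add)
    then have "(k^4 * \<sigma>^6) * (G \<sigma>)\<^sup>2 \<le> (G \<sigma>)^4 * (G \<sigma>)\<^sup>2" by (intro mult_right_mono) auto
    also have "\<dots> = (G \<sigma>)^6" by (simp flip: power_add)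
    finally have "\<sigma>^6 * (k^4 * (G \<sigma>)\<^sup>2) \<le> \<sigma>^6 * (C * (1 + r \<sigma>))" using up by (simp add: mult_ac)
    then have "k^4 * (G \<sigma>)\<^sup>2 \<le> C * (1 + r \<sigma>)" using s1 by (subst (asm) mult_le_cancel_left_pos) auto
    then show ?thesis using C by (simp add: c1_def field_simps)
  qed
  \<comment> \<open>Beyond this point c1 G^2 >= 2, so the summand 1 in \<open>key\<close> is at most
    half of the left side.\<close>
  define \<sigma>1 where "\<sigma>1 = max \<sigma>0 (2 / (c1 * k\<^sup>2))"
  have s11: "\<sigma>1 \<ge> 1" "\<sigma>1 \<ge> \<sigma>0" by (auto simp: \<sigma>1_def \<sigma>0_def)
  have blow: "c1 / 2 * (G \<sigma>)\<^sup>2 \<le> r \<sigma>" "G \<sigma> > 0" if s: "\<sigma> \<ge> \<sigma>1" for \<sigma>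
  proof -
    have "\<sigma> \<ge> 1" "\<sigma> \<ge> \<sigma>0" using s s11 by auto
    show "G \<sigma> > 0" using G2(2)[OF \<open>\<sigma> \<ge> \<sigma>0\<close>] k \<open>\<sigma> \<ge> 1\<close> by (smt (verit) mult_pos_pos)
    have "2 / (c1 * k\<^sup>2) \<le> \<sigma>" using s by (simp add: \<sigma>1_def)
    then have "2 \<le> c1 * k\<^sup>2 * \<sigma>" using c1 k by (simp add: field_simps)
    also have "\<dots> \<le> c1 * k\<^sup>2 * \<sigma>\<^sup>2" using \<open>\<sigma> \<ge> 1\<close> c1 by (intro mult_left_mono) (auto simp: power2_eq_square)
    also have "\<dots> = c1 * (k * \<sigma>)\<^sup>2" by (simp add: power_mult_distrib)
    also have "\<dots> \<le> c1 * (G \<sigma>)\<^sup>2"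
      using G2(2)[OF \<open>\<sigma> \<ge> \<sigma>0\<close>] c1 k \<open>\<sigma> \<ge> 1\<close> by (intro mult_left_mono power_mono) auto
    finally show "c1 / 2 * (G \<sigma>)\<^sup>2 \<le> r \<sigma>" using key[OF \<open>\<sigma> \<ge> \<sigma>0\<close>] by simp
  qed
  \<comment> \<open>1 / G decreases at least at rate c1 / 2. At \<open>\<sigma>2\<close> it would
    have to be nonpositive.\<close>
  define h where "h = (\<lambda>\<sigma>. 1 / G \<sigma> + c1 / 2 * \<sigma>)"
  define \<sigma>2 where "\<sigma>2 = \<sigma>1 + 2 / c1 * (h \<sigma>1)"
  have h1: "h \<sigma>1 > 0" using blow(2)[of \<sigma>1] c1 s11 by (simp add: h_def add_pos_pos)
  have "\<sigma>1 \<le> \<sigma>2" using h1 c1 by (simp add: \<sigma>2_def)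
  then have "h \<sigma>2 \<le> h \<sigma>1"
  proof (rule DERIV_nonpos_imp_nonincreasing)
    fix \<sigma> assume s: "\<sigma>1 \<le> \<sigma>" "\<sigma> \<le> \<sigma>2"
    have "(h has_real_derivative - (r \<sigma> / (G \<sigma>)\<^sup>2) + c1 / 2) (at \<sigma>)"
      unfolding h_def using blow(2)[OF s(1)] s s11
      by (auto intro!: derivative_eq_intros dG simp: power2_eq_square field_simps)
    moreover have "- (r \<sigma> / (G \<sigma>)\<^sup>2) + c1 / 2 \<le> 0"
      using blow[OF s(1)] by (simp add: field_simps)
    ultimately show "\<exists>y. (h has_real_derivative y) (at \<sigma>) \<and> y \<le> 0" by blast
  qed
  moreover have "h \<sigma>2 > c1 / 2 * \<sigma>2" using blow(2)[OF \<open>\<sigma>1 \<le> \<sigma>2\<close>] by (simp add: h_def)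
  moreover have "c1 / 2 * \<sigma>2 \<ge> h \<sigma>1" using c1 s11 by (simp add: \<sigma>2_def algebra_simps)
  ultimately show False by simp
qed

section \<open>Bounds near a pole in terms of its curvature\<close>

context line_flow
begin

lemma continuous_on_w: "t < 0 \<Longrightarrow> continuous_on S (\<lambda>x. w x t)"
  by (rule DERIV_continuous_on[OF has_field_derivative_at_within[OF dw0]])

lemma tau_lim:
  assumes t: "t < 0"
  shows "((\<lambda>x. tau x t) \<longlongrightarrow> 0) at_top"
proof -
  obtain C where C: "\<And>x. tau x t \<le> C * exp (- \<bar>x\<bar>)"
    using tau_decay[of t t] t by (metis atLeastAtMost_singleton order_refl singletonI)
  have "((\<lambda>x::real. exp (- x)) \<longlongrightarrow> 0) at_top"
    by (rule filterlim_compose[OF exp_at_bot filterlim_uminus_at_bot_at_top])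
  then show ?thesis
  proof (rule tendsto_0_le[of _ _ _ C], intro eventually_at_top_linorderI[of 0])
    fix x :: real assume "0 \<le> x"
    then show "norm (tau x t) \<le> norm (exp (- x)) * C"
      using C[of x] tau_nonneg[OF t, of x] by (simp add: mult.commute)
  qed
qed

text \<open>Where p >= 0, to the right of a minimum of w, N_x = p tau is nonnegative. So N = tau + 2
  R increases towards its value at the pole, where tau vanishes.\<close>

lemma N_le_pole:
  assumes t: "t < 0" and \<rho>: "((\<lambda>x. R x t) \<longlongrightarrow> \<rho>) at_top" and p0: "p x t \<ge> 0"
  shows "N x t \<le> 2 * \<rho>"
proof (rule tendsto_lowerbound)
  show "((\<lambda>y. tau y t + 2 * R y t) \<longlongrightarrow> 2 * \<rho>) at_top"
    using tendsto_add[OF tau_lim[OF t] tendsto_mult[OF tendsto_const[of 2] \<rho>]] by simp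
  show "\<forall>\<^sub>F y in at_top. N x t \<le> tau y t + 2 * R y t"
  proof (rule eventually_at_top_linorderI)
    fix y assume y: "x \<le> y"
    then have "N x t \<le> N y t"
    proof (rule DERIV_nonneg_imp_nondecreasing)
      fix z assume z: "x \<le> z"
      show "\<exists>d. ((\<lambda>x. N x t) has_real_derivative d) (at z) \<and> 0 \<le> d"
        using dN[OF t, of z] p_mono[OF t z] p0 tau_nonneg[OF t, of z]
        by (intro exI[of _ "p z t * tau z t"]) auto
    qed
    then show "N x t \<le> tau y t + 2 * R y t" by (simp add: tau_eq)
  qed
qed simp

text \<open>For p >= 0 the factor 2 + p in N is at least 2, hence 2 w - w_x = w (2 - p) <= N / 2 <=
  \<rho>. This says that (w - \<rho> / 2) exp (-2 x) is nondecreasing, so it stays below its limit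
  \<alpha>.\<close>

lemma w_le_near_pole:
  assumes t: "t < 0" and \<rho>: "((\<lambda>x. R x t) \<longlongrightarrow> \<rho>) at_top" and p0: "p x t \<ge> 0"
    and \<alpha>: "((\<lambda>x. w x t * exp (- 2 * x)) \<longlongrightarrow> \<alpha>) at_top"
  shows "w x t \<le> \<rho> / 2 + \<alpha> * exp (2 * x)"
proof -
  have "(w x t - \<rho> / 2) * exp (- 2 * x) \<le> \<alpha>"
  proof (rule tendsto_lowerbound)
    have "((\<lambda>x::real. exp (- 2 * x)) \<longlongrightarrow> 0) at_top"
      by (rule filterlim_compose[OF exp_at_bot])
         (auto simp: filterlim_uminus_at_bot intro!: filterlim_tendsto_pos_mult_at_top[OF tendsto_const] filterlim_ident)
    then have "((\<lambda>y. w y t * exp (- 2 * y) - \<rho> / 2 * exp (- 2 * y)) \<longlongrightarrow> \<alpha> - \<rho> / 2 * 0) at_top"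
      by (intro tendsto_intros \<alpha>)
    then show "((\<lambda>y. (w y t - \<rho> / 2) * exp (- 2 * y)) \<longlongrightarrow> \<alpha>) at_top"
      by (simp add: algebra_simps)
    show "\<forall>\<^sub>F y in at_top. (w x t - \<rho> / 2) * exp (- 2 * x) \<le> (w y t - \<rho> / 2) * exp (- 2 * y)"
    proof (rule eventually_at_top_linorderI)
      fix y assume y: "x \<le> y"
      then show "(w x t - \<rho> / 2) * exp (- 2 * x) \<le> (w y t - \<rho> / 2) * exp (- 2 * y)"
      proof (rule DERIV_nonneg_imp_nondecreasing)
        fix z assume z: "x \<le> z"
        have pz: "p z t \<ge> 0" using p_mono[OF t z] p0 by simp
        have "w z t * (2 - p z t) * 2 \<le> w z t * (2 - p z t) * (2 + p z t)"
          using p_bounds[OF t, of z] pos[OF t, of z] pz by (intro mult_left_mono) auto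
        then have "w z t * (2 - p z t) * 2 \<le> N z t" by (simp add: N_eq[OF t])
        also have "\<dots> \<le> 2 * \<rho>" by (rule N_le_pole[OF t \<rho> pz])
        finally have "2 * w z t - w1 z t \<le> \<rho>"
          using pos[OF t, of z] by (simp add: p_def algebra_simps)
        moreover have "((\<lambda>y. (w y t - \<rho> / 2) * exp (- 2 * y)) has_real_derivative
            (w1 z t - 2 * w z t + \<rho>) * exp (- 2 * z)) (at z)"
          by (auto intro!: derivative_eq_intros dw0 t simp: algebra_simps)
        ultimately show "\<exists>d. ((\<lambda>y. (w y t - \<rho> / 2) * exp (- 2 * y)) has_real_derivative d) (at z) \<and> 0 \<le> d"
          by (intro exI[of _ "(w1 z t - 2 * w z t + \<rho>) * exp (- 2 * z)"]) auto
      qed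
    qed
  qed simp
  then have "(w x t - \<rho> / 2) * exp (- 2 * x) * exp (2 * x) \<le> \<alpha> * exp (2 * x)"
    by (intro mult_right_mono) auto
  then show ?thesis by (simp add: mult.assoc flip: exp_add)
qed

section \<open>Area and the conformal factor at a pole\<close>

lemma w_mono_time:
  assumes "s \<le> t" "t < 0"
  shows "w x s \<le> w x t"
proof (rule DERIV_nonneg_imp_nondecreasing[OF assms(1)])
  fix r assume "s \<le> r" "r \<le> t"
  then have r: "r < 0" using assms by simp
  show "\<exists>d. ((\<lambda>r. w x r) has_real_derivative d) (at r) \<and> 0 \<le> d"
    using evol[OF r, of x] incr[OF r, of x] by (intro exI[of _ "w x r * w2 x r - (w1 x r)\<^sup>2"]) auto
qed

text \<open>Gauss-Bonnet on a strip: (1 / w)_t = - R / w = - p_x, so the area changes at rate p 0 -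
  p b. The bound |p| <= 2 makes this rate uniform in b.\<close>

lemma area_growth:
  assumes st: "s \<le> t" "t < 0" and b: "b \<ge> 0"
  shows "integral {0..b} (\<lambda>y. 1 / w y s) \<le> integral {0..b} (\<lambda>y. 1 / w y t) + 4 * (t - s)"
proof (cases "s = t")
  case False
  then have st': "s < t" using st by simp
  have cont: "continuous_on ({..<0} \<times> {0..b}) (\<lambda>z. f (snd z) (fst z))"
    if "continuous_on (UNIV \<times> {..<0}) (\<lambda>(x,t). f x t)" for f :: "real \<Rightarrow> real \<Rightarrow> real"
  proof -
    have "continuous_on ({..<0} \<times> {0..b}) (\<lambda>z. case (snd z, fst z) of (x, t) \<Rightarrow> f x t)"
      by (rule continuous_on_compose2[OF that]) (auto intro!: continuous_intros)
    then show ?thesis by simp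
  qed
  have d: "((\<lambda>r. integral {0..b} (\<lambda>y. 1 / w y r)) has_real_derivative - (p b r - p 0 r)) (at r)" if r: "r < 0" for r
  proof -
    have "((\<lambda>r. integral (cbox 0 b) (\<lambda>y. 1 / w y r)) has_field_derivative
        integral (cbox 0 b) (\<lambda>y. - (R y r / w y r))) (at r within {..<0})"
    proof (rule leibniz_rule_field_derivative)
      fix t' y :: real assume "t' \<in> {..<0}"
      then have t': "t' < 0" by simp
      show "((\<lambda>r. 1 / w y r) has_real_derivative - (R y t' / w y t')) (at t' within {..<0})"
      proof (rule has_field_derivative_at_within)
        have "- (inverse (w y t') * (w y t' * w2 y t' - (w1 y t')\<^sup>2) * inverse (w y t')) = - (R y t' / w y t')"
          using ne[OF t', of y] by (simp add: R_def divide_simps power2_eq_square)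
        with DERIV_inverse'[OF evol[OF t', of y] ne[OF t']]
        show "((\<lambda>r. 1 / w y r) has_real_derivative - (R y t' / w y t')) (at t')"
          by (simp add: inverse_eq_divide)
      qed
    next
      fix t' :: real assume "t' \<in> {..<0}"
      then have t': "t' < 0" by simp
      have "continuous_on {0..b} (\<lambda>y. w y t')"
        by (rule continuous_on_w[OF t'])
      then show "(\<lambda>y. 1 / w y t') integrable_on cbox 0 b"
        by (intro integrable_continuous) (auto intro!: continuous_intros simp: ne t')
    next
      show "continuous_on ({..<0} \<times> cbox 0 b) (\<lambda>(r, y). - (R y r / w y r))"
        unfolding split_beta R_def cbox_interval
        by (intro continuous_intros cont c0 c1 c2) (auto simp: ne)
    qed (use r in auto)
    moreover have "integral {0..b} (\<lambda>y. - (R y r / w y r)) = - (p b r - p 0 r)"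
    proof (rule integral_unique, rule has_integral_neg, rule fundamental_theorem_of_calculus[OF b])
      fix y
      show "((\<lambda>x. p x r) has_vector_derivative R y r / w y r) (at y within {0..b})"
        using dp[OF r, of y] has_real_derivative_iff_has_vector_derivative has_vector_derivative_at_within by blast
    qed
    ultimately show ?thesis using r by (simp add: at_within_open[of r "{..<0}"])
  qed
  obtain z where z: "s < z" "z < t"
    "integral {0..b} (\<lambda>y. 1 / w y t) - integral {0..b} (\<lambda>y. 1 / w y s) = (t - s) * (- (p b z - p 0 z))"
    using MVT2[OF st', of "\<lambda>r. integral {0..b} (\<lambda>y. 1 / w y r)" "\<lambda>r. - (p b r - p 0 r)"] d st(2) by fastforce
  have "z < 0" using z st by simp
  have "(t - s) * (p b z - p 0 z) \<le> (t - s) * 4"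
    using p_bounds[OF \<open>z < 0\<close>, of b] p_bounds[OF \<open>z < 0\<close>, of 0] st' by (intro mult_left_mono) auto
  then show ?thesis using z(3) by (simp add: algebra_simps)
qed simp

text \<open>
  A small value \<open>exp (- \<Lambda>)\<close> of \<open>v\<close> at the pole forces \<open>w\<close> to stay below \<open>\<rho> / 2 + A\<close> on a
  stretch of length \<open>\<Lambda> / 2\<close>; by convexity of \<open>ln w\<close>, \<open>w\<close> is then bounded on a
  shorter stretch, whose area is at most linear in time.
\<close>

lemma pole_value_bound:
  assumes st: "s \<le> t" "t < 0" and \<rho>: "((\<lambda>x. R x s) \<longlongrightarrow> \<rho>) at_top"
    and \<Lambda>: "((\<lambda>x. w x s * exp (- 2 * x)) \<longlongrightarrow> exp (- \<Lambda>) / 4) at_top"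
    and A: "w 0 t \<le> A" "1 \<le> A"
    and B: "\<And>b. b \<ge> 0 \<Longrightarrow> integral {0..b} (\<lambda>y. 1 / w y t) \<le> B"
  shows "\<Lambda> \<le> 2 * exp 1 * A * (B + 4 * (t - s)) * (1 + ln (1 + \<rho>))"
proof -
  have s0: "s < 0" using st by simp
  have \<rho>0: "\<rho> \<ge> 0"
    by (rule tendsto_lowerbound[OF \<rho>]) (auto intro: always_eventually R_nonneg s0)
  have B0: "B \<ge> 0" using B[of 0] by simp
  have l0: "ln (1 + \<rho>) \<ge> 0" using \<rho>0 by simp
  show ?thesis
  proof (cases "\<Lambda> \<le> 0")
    case True
    moreover have "0 \<le> 2 * exp 1 * A * (B + 4 * (t - s)) * (1 + ln (1 + \<rho>))"
      using A B0 st l0 by (intro mult_nonneg_nonneg) auto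
    ultimately show ?thesis by (rule order_trans)
  next
    case False
    \<comment> \<open>At this point the second term of \<open>w_le_near_pole\<close> is exactly
      1/4.\<close>
    define b where "b = \<Lambda> / 2"
    have b: "b > 0" using False by (simp add: b_def)
    have w0: "w 0 s \<le> A" using w_mono_time[OF st, of 0] A by simp
    have wb: "w b s \<le> A + \<rho> / 2"
    \<comment> \<open>If p is negative at b, it is negative on all of \<open>{0..b}\<close>, so w
      decreases there and its value at 0 is enough.\<close>
    proof (cases "p b s \<ge> 0")
      case True
      have "w b s \<le> \<rho> / 2 + exp (- \<Lambda>) / 4 * exp (2 * b)"
        by (rule w_le_near_pole[OF s0 \<rho> True \<Lambda>])
      also have "\<dots> = \<rho> / 2 + 1 / 4" by (simp add: b_def flip: exp_add)
      finally show ?thesis using A by simp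
    next
      case False
      have "w b s \<le> w 0 s"
      proof (rule DERIV_nonpos_imp_nonincreasing[where f="\<lambda>x. w x s"])
        fix z assume z: "0 \<le> z" "z \<le> b"
        have "p z s \<le> 0" using p_mono[OF s0 z(2)] False by simp
        then have "w1 z s \<le> 0" using pos[OF s0, of z] by (simp add: p_def divide_le_0_iff)
        then show "\<exists>y. ((\<lambda>x. w x s) has_real_derivative y) (at z) \<and> y \<le> 0"
          using dw0[OF s0] by blast
      qed (use b in simp)
      then show ?thesis using w0 \<rho>0 by simp
    qed
    have cvx: "convex_on UNIV (\<lambda>x. ln (w x s))"
    proof (rule convex_on_realI[where f'="\<lambda>x. p x s"])
      show "((\<lambda>x. ln (w x s)) has_real_derivative p x s) (at x)" for x
        unfolding p_def using pos[OF s0, of x] by (auto intro!: derivative_eq_intros dw0 s0 simp: field_simps)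
    qed (auto intro: p_mono s0)
    \<comment> \<open>On \<open>{0..b / D}\<close> the interpolation weight \<theta> is at most 1 /
      D, so convexity lets ln w exceed ln A by at most \<theta> ln (1 + \<rho>) <= 1.\<close>
    define D where "D = 1 + ln (1 + \<rho>)"
    have D1: "D \<ge> 1" using l0 by (simp add: D_def)
    have wle: "w y s \<le> exp 1 * A" if y: "y \<in> {0..b / D}" for y
    proof -
      define \<theta> where "\<theta> = y / b"
      have \<theta>: "0 \<le> \<theta>" "\<theta> * D \<le> 1" using y b D1 by (auto simp: \<theta>_def field_simps)
      have "\<theta> * 1 \<le> \<theta> * D" using \<theta> D1 by (intro mult_left_mono) auto
      then have \<theta>1: "\<theta> \<le> 1" using \<theta> by simp
      have ye: "y = (1 - \<theta>) *\<^sub>R 0 + \<theta> *\<^sub>R b" using b by (simp add: \<theta>_def)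
      have "ln (w y s) \<le> (1 - \<theta>) * ln (w 0 s) + \<theta> * ln (w b s)"
        unfolding ye using \<theta> \<theta>1 by (intro convex_onD[OF cvx]) auto
      also have "\<dots> \<le> (1 - \<theta>) * ln A + \<theta> * (ln A + ln (1 + \<rho>))"
      proof (intro add_mono mult_left_mono)
        show "ln (w 0 s) \<le> ln A" using w0 pos[OF s0, of 0] by (simp add: ln_mono)
        have "\<rho> / 2 \<le> A * \<rho>" using A(2) \<rho>0 mult_right_mono[of "1/2" A \<rho>] by simp
        then have "w b s \<le> A * (1 + \<rho>)" using wb by (simp add: algebra_simps)
        then have "ln (w b s) \<le> ln (A * (1 + \<rho>))" using pos[OF s0, of b] by (intro ln_mono) auto
        also have "\<dots> = ln A + ln (1 + \<rho>)" using A(2) \<rho>0 by (intro ln_mult_pos) auto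
        finally show "ln (w b s) \<le> ln A + ln (1 + \<rho>)" .
      qed (use \<theta> \<theta>1 in auto)
      also have "\<dots> = ln A + (\<theta> * D - \<theta>)" by (simp add: D_def algebra_simps)
      also have "\<dots> \<le> ln A + 1" using \<theta> by simp
      finally have "exp (ln (w y s)) \<le> exp (ln A + 1)" by simp
      then show ?thesis using pos[OF s0, of y] A(2) by (simp add: exp_add mult.commute)
    qed
    have bD: "b / D \<ge> 0" using b D1 by simp
    have ci: "(\<lambda>y. 1 / w y s) integrable_on {0..b / D}"
    proof (rule integrable_continuous_real)
      have "continuous_on {0..b / D} (\<lambda>y. w y s)"
        by (rule continuous_on_w[OF s0])
      then show "continuous_on {0..b / D} (\<lambda>y. 1 / w y s)"
        by (auto intro!: continuous_intros simp: ne s0)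
    qed
    have "b / D * (1 / (exp 1 * A)) = integral {0..b / D} (\<lambda>y. 1 / (exp 1 * A))"
      using bD by simp
    also have "\<dots> \<le> integral {0..b / D} (\<lambda>y. 1 / w y s)"
      using wle pos[OF s0] A(2) by (intro integral_le ci) (auto intro!: divide_left_mono simp: less_imp_le)
    also have "\<dots> \<le> integral {0..b / D} (\<lambda>y. 1 / w y t) + 4 * (t - s)"
      by (rule area_growth[OF st bD])
    also have "\<dots> \<le> B + 4 * (t - s)" using B[OF bD] by simp
    finally have "b \<le> exp 1 * A * (B + 4 * (t - s)) * D"
      using D1 A(2) by (simp add: field_simps)
    then show ?thesis by (simp add: b_def D_def)
  qed
qed

lemma area_bounded:
  assumes t: "t < 0"
  obtains B where "B > 0" "\<And>b. b \<ge> 0 \<Longrightarrow> integral {0..b} (\<lambda>y. 1 / w y t) \<le> B"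
proof -
  obtain K where K: "K > 0" "\<And>x. (cosh x)\<^sup>2 \<le> K * w x t"
    using bounds'[of t t] t by (metis atLeastAtMost_singleton order_refl singletonI)
  have "integral {0..b} (\<lambda>y. 1 / w y t) \<le> K" if b: "b \<ge> 0" for b
  proof -
    have I: "((\<lambda>y. K * (1 / (cosh y)\<^sup>2)) has_integral (K * tanh b - K * tanh 0)) {0..b}"
    proof (rule fundamental_theorem_of_calculus[OF b])
      fix y :: real
      have "((\<lambda>y. K * tanh y) has_real_derivative K * (1 / (cosh y)\<^sup>2)) (at y)"
        by (auto intro!: derivative_eq_intros simp: one_minus_tanh_square)
      then show "((\<lambda>y. K * tanh y) has_vector_derivative K * (1 / (cosh y)\<^sup>2)) (at y within {0..b})"
        using has_real_derivative_iff_has_vector_derivative has_vector_derivative_at_within by blast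
    qed
    have "continuous_on {0..b} (\<lambda>y. w y t)"
      by (rule continuous_on_w[OF t])
    then have "(\<lambda>y. 1 / w y t) integrable_on {0..b}"
      by (intro integrable_continuous_real) (auto intro!: continuous_intros simp: ne t)
    then have "integral {0..b} (\<lambda>y. 1 / w y t) \<le> integral {0..b} (\<lambda>y. K * (1 / (cosh y)\<^sup>2))"
      using I K pos[OF t] by (intro integral_le) (auto simp: integrable_on_def field_simps)
    also have "\<dots> = K * tanh b" using I by (simp add: integral_unique)
    also have "\<dots> \<le> K" using K(1) tanh_real_lt_1[of b] by simp
    finally show ?thesis .
  qed
  then show thesis using K(1) that by blast
qed

text \<open>\<open>lp\<close>, \<open>lm\<close> stand for ln u at the two poles and
  \<open>rp\<close>, \<open>rm\<close> for the curvature there; 1/4 is the limit of (cosh x)^2 exp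
  (-2 |x|). If q is nonzero at one point, lp + lm as a function of the backward time \<sigma> meets
  all hypotheses of \<open>no_slow_superlinear_growth\<close>.\<close>

lemma q_zero:
  fixes lp lm rp rm :: "real \<Rightarrow> real"
  assumes wp: "\<And>t. t < 0 \<Longrightarrow> ((\<lambda>x. w x t * exp (- 2 * x)) \<longlongrightarrow> exp (- lp t) / 4) at_top"
    and wm: "\<And>t. t < 0 \<Longrightarrow> ((\<lambda>x. w x t * exp (2 * x)) \<longlongrightarrow> exp (- lm t) / 4) at_bot"
    and Rp: "\<And>t. t < 0 \<Longrightarrow> ((\<lambda>x. R x t) \<longlongrightarrow> rp t) at_top"
    and Rm: "\<And>t. t < 0 \<Longrightarrow> ((\<lambda>x. R x t) \<longlongrightarrow> rm t) at_bot"
    and lp: "\<And>t. t < 0 \<Longrightarrow> (lp has_real_derivative - rp t) (at t)"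
    and lm: "\<And>t. t < 0 \<Longrightarrow> (lm has_real_derivative - rm t) (at t)"
    and t: "t < 0"
  shows "w3 x t = 4 * w1 x t"
proof (rule ccontr)
  assume neq: "w3 x t \<noteq> 4 * w1 x t"
  interpret m: line_flow "\<lambda>x t. w (- x) t" "\<lambda>x t. - w1 (- x) t" "\<lambda>x t. w2 (- x) t"
     "\<lambda>x t. - w3 (- x) t" "\<lambda>x t. w4 (- x) t" "\<lambda>x t. - w5 (- x) t"
    by (rule mirror)
  have mR: "m.R y s = R (- y) s" and mp: "m.p y s = - p (- y) s" and mN: "m.N y s = N (- y) s" for y s
    by (simp_all add: m.R_def R_def m.p_def p_def m.N_def N_def)
  have mRm: "((\<lambda>y. m.R y s) \<longlongrightarrow> rm s) at_top" if "s < 0" for s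
    using Rm[OF that] unfolding mR filterlim_at_bot_mirror .
  have mwm: "((\<lambda>y. w (- y) s * exp (- 2 * y)) \<longlongrightarrow> exp (- lm s) / 4) at_top" if "s < 0" for s
    using wm[OF that] unfolding filterlim_at_bot_mirror by simp
  have rp0: "rp s \<ge> 0" and rm0: "rm s \<ge> 0" if "s < 0" for s
    by (rule tendsto_lowerbound[OF Rp[OF that]] tendsto_lowerbound[OF Rm[OF that]];
        auto intro: always_eventually R_nonneg that)+
  define \<rho> where "\<rho> s = rp s + rm s" for s
  \<comment> \<open>On either side of the minimum of w the bound comes from the pole towards which w
    increases. The sum of both curvatures covers the two cases.\<close>
  have tau_le: "tau y s \<le> 2 * \<rho> s" if s: "s < 0" for y s
  proof -
    have "N y s \<le> 2 * rp s \<or> N y s \<le> 2 * rm s"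
      using N_le_pole[OF s Rp[OF s], of y] m.N_le_pole[OF s mRm[OF s], of "- y"]
      by (cases "p y s \<ge> 0") (auto simp: mp mN)
    then show ?thesis using tau_le_N[OF s, of y] rp0[OF s] rm0[OF s] by (auto simp: \<rho>_def)
  qed
  define c where "c = w x t * (q x t)\<^sup>2"
  have c: "c > 0" using pos[OF t, of x] neq by (simp add: c_def q_def)
  have \<rho>c: "c * \<sigma> \<le> (\<rho> (t - \<sigma>))\<^sup>2" if "\<sigma> > 0" for \<sigma>
  proof -
    have "4 * (t - (t - \<sigma>)) * (w x t * (q x t)\<^sup>2) \<le> (2 * \<rho> (t - \<sigma>))\<^sup>2"
      by (rule S_decay) (use that t tau_le in auto)
    then show ?thesis by (simp add: c_def power_mult_distrib mult.commute)
  qed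
  define A where "A = max 1 (w 0 t)"
  obtain B1 where B1: "B1 > 0" "\<And>b. b \<ge> 0 \<Longrightarrow> integral {0..b} (\<lambda>y. 1 / w y t) \<le> B1"
    using area_bounded[OF t] by blast
  obtain B2 where B2: "B2 > 0" "\<And>b. b \<ge> 0 \<Longrightarrow> integral {0..b} (\<lambda>y. 1 / w (- y) t) \<le> B2"
    using m.area_bounded[OF t] by blast
  \<comment> \<open>The added 4 absorbs the area growth 4 \<sigma> into B (1 + \<sigma>). The
    constant K below is twice the single bound because two poles are summed.\<close>
  define B where "B = max B1 B2 + 4"
  define K where "K = 4 * exp 1 * A * B"
  have A1: "A \<ge> 1" by (simp add: A_def)
  have B4: "B \<ge> 4" using B1 by (simp add: B_def)
  show False
  proof (rule no_slow_superlinear_growth[where c=c and K=K])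
    fix \<sigma> :: real assume \<sigma>: "\<sigma> \<ge> 0"
    have s: "t - \<sigma> < 0" "t - \<sigma> \<le> t" using t \<sigma> by auto
    have r: "((\<lambda>\<sigma>. t - \<sigma>) has_real_derivative - 1) (at \<sigma>)"
      by (auto intro!: derivative_eq_intros)
    show "((\<lambda>\<sigma>. lp (t - \<sigma>) + lm (t - \<sigma>)) has_real_derivative \<rho> (t - \<sigma>)) (at \<sigma>)"
      using DERIV_add[OF DERIV_chain2[where f=lp, OF lp[OF s(1)] r] DERIV_chain2[where f=lm, OF lm[OF s(1)] r]]
      by (simp add: \<rho>_def)
    show \<rho>0: "0 \<le> \<rho> (t - \<sigma>)" using rp0[OF s(1)] rm0[OF s(1)] by (simp add: \<rho>_def)
    have lin: "2 * exp 1 * A * (b + 4 * (t - (t - \<sigma>))) * (1 + ln (1 + r))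
        \<le> 2 * exp 1 * A * (B * (1 + \<sigma>)) * (1 + ln (1 + \<rho> (t - \<sigma>)))"
      if "0 \<le> r" "r \<le> \<rho> (t - \<sigma>)" "b \<le> B - 4" "0 < b" for r b
    proof (intro mult_mono mult_left_mono)
      have "4 * \<sigma> \<le> B * \<sigma>" using B4 \<sigma> by (intro mult_right_mono)
      then show "b + 4 * (t - (t - \<sigma>)) \<le> B * (1 + \<sigma>)" using that by (simp add: algebra_simps)
    qed (use that A1 B4 \<sigma> \<rho>0 in auto)
    have "lp (t - \<sigma>) \<le> 2 * exp 1 * A * (B1 + 4 * (t - (t - \<sigma>))) * (1 + ln (1 + rp (t - \<sigma>)))"
      by (rule pole_value_bound[OF s(2) t Rp[OF s(1)] wp[OF s(1)] _ _ B1(2)]) (auto simp: A_def)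
    also have "\<dots> \<le> 2 * exp 1 * A * (B * (1 + \<sigma>)) * (1 + ln (1 + \<rho> (t - \<sigma>)))"
      by (rule lin) (use rp0[OF s(1)] rm0[OF s(1)] B1 in \<open>auto simp: \<rho>_def B_def\<close>)
    finally have 1: "lp (t - \<sigma>) \<le> 2 * exp 1 * A * (B * (1 + \<sigma>)) * (1 + ln (1 + \<rho> (t - \<sigma>)))" .
    have "lm (t - \<sigma>) \<le> 2 * exp 1 * A * (B2 + 4 * (t - (t - \<sigma>))) * (1 + ln (1 + rm (t - \<sigma>)))"
      by (rule m.pole_value_bound[OF s(2) t mRm[OF s(1)] mwm[OF s(1)] _ _ B2(2)]) (auto simp: A_def)
    also have "\<dots> \<le> 2 * exp 1 * A * (B * (1 + \<sigma>)) * (1 + ln (1 + \<rho> (t - \<sigma>)))"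
      by (rule lin) (use rp0[OF s(1)] rm0[OF s(1)] B2 in \<open>auto simp: \<rho>_def B_def\<close>)
    finally have 2: "lm (t - \<sigma>) \<le> 2 * exp 1 * A * (B * (1 + \<sigma>)) * (1 + ln (1 + \<rho> (t - \<sigma>)))" .
    show "lp (t - \<sigma>) + lm (t - \<sigma>) \<le> K * (1 + \<sigma>) * (1 + ln (1 + \<rho> (t - \<sigma>)))"
      using 1 2 by (simp add: K_def algebra_simps)
  next
    show "K > 0" using A1 B4 by (simp add: K_def)
  qed (use c \<rho>c in auto)
qed

end

section \<open>Contraction in \<open>L\<^sup>1\<close>\<close>

text \<open>
  \<open>(1 + tanh (n y)) / 2\<close> is a smooth version of the indicator of \<open>y > 0\<close>, with antiderivative
  \<open>pos_approx n\<close>. It takes the same value 1/2 at 0 for all \<open>n\<close>, so that two functions of equal sign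
  give the same limit.
\<close>

definition pos_approx :: "nat \<Rightarrow> real \<Rightarrow> real" where
  "pos_approx n y = (y + ln (2 * cosh (real n * y)) / real n) / 2"

lemma pos_approx_deriv:
  assumes "n > 0"
  shows "(pos_approx n has_real_derivative (1 + tanh (real n * y)) / 2) (at y)"
  unfolding pos_approx_def using assms
  by (auto intro!: derivative_eq_intros simp: tanh_def field_simps)

lemma pos_approx_bounds:
  assumes n: "n > 0"
  shows "max 0 y \<le> pos_approx n y" "pos_approx n y \<le> max 0 y + 1 / real n"
proof -
  have lower: "\<bar>z\<bar> \<le> ln (2 * cosh z)" for z :: real
    using ln_cosh_ge[of z] by (simp add: ln_mult_pos)
  have upper: "ln (2 * cosh z) \<le> \<bar>z\<bar> + 1" for z :: real
  proof -
    have "cosh z \<le> exp \<bar>z\<bar>" by (auto simp: cosh_def abs_if)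
    moreover have "2 \<le> exp (1::real)" using exp_ge_add_one_self[of 1] by simp
    ultimately have "2 * cosh z \<le> exp 1 * exp \<bar>z\<bar>" by (intro mult_mono) auto
    then have "ln (2 * cosh z) \<le> ln (exp (\<bar>z\<bar> + 1))" by (intro ln_mono) (auto simp: exp_add mult.commute)
    then show ?thesis by simp
  qed
  have "real n * \<bar>y\<bar> \<le> ln (2 * cosh (real n * y))" "ln (2 * cosh (real n * y)) \<le> real n * \<bar>y\<bar> + 1"
    using lower[of "real n * y"] upper[of "real n * y"] by (simp_all add: abs_mult)
  then have "\<bar>y\<bar> \<le> ln (2 * cosh (real n * y)) / real n" "ln (2 * cosh (real n * y)) / real n \<le> \<bar>y\<bar> + 1 / real n"
    using n by (simp_all add: field_simps)
  moreover have "0 < 1 / real n" using n by simp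
  ultimately show "max 0 y \<le> pos_approx n y" "pos_approx n y \<le> max 0 y + 1 / real n"
    unfolding pos_approx_def by (auto simp: max_def abs_if split: if_splits)
qed

lemma tanh_scaled_tendsto: "(\<lambda>n. tanh (real n * y)) \<longlonglongrightarrow> sgn y"
proof -
  have pos: "(\<lambda>n. tanh (real n * y)) \<longlonglongrightarrow> 1" if "y > 0" for y
  proof -
    have "filterlim (\<lambda>n. y * real n) at_top sequentially"
      using that by (intro filterlim_tendsto_pos_mult_at_top[OF tendsto_const _ filterlim_real_sequentially])
    then show ?thesis using filterlim_compose[OF tanh_real_at_top] by (simp add: mult.commute)
  qed
  show ?thesis
    using pos[of y] tendsto_minus[OF pos[of "- y"]] by (cases y "0::real" rule: linorder_cases) auto
qed

text \<open>Integration by parts: the discarded term P'(m) (m')^2 has a sign since P is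
  nondecreasing.\<close>

lemma integral_nondecreasing_test_le:
  fixes P P' m m1 m2 :: "real \<Rightarrow> real"
  assumes ab: "a \<le> b"
    and dP: "\<And>y. (P has_real_derivative P' y) (at y)" and P': "\<And>y. P' y \<ge> 0"
    and dm: "\<And>x. (m has_real_derivative m1 x) (at x)"
    and dm1: "\<And>x. (m1 has_real_derivative m2 x) (at x)"
    and int: "(\<lambda>x. P (m x) * m2 x) integrable_on {a..b}"
  shows "integral {a..b} (\<lambda>x. P (m x) * m2 x) \<le> P (m b) * m1 b - P (m a) * m1 a"
proof -
  define g' where "g' x = P' (m x) * (m1 x * m1 x) + P (m x) * m2 x" for x
  have "((\<lambda>x. P (m x) * m1 x) has_real_derivative g' x) (at x)" for x
    unfolding g'_def using DERIV_mult[OF DERIV_chain2[OF dP dm] dm1] by (simp add: algebra_simps)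
  then have I: "(g' has_integral P (m b) * m1 b - P (m a) * m1 a) {a..b}"
    using ab by (intro fundamental_theorem_of_calculus)
      (auto simp: has_real_derivative_iff_has_vector_derivative[symmetric] intro: has_field_derivative_at_within)
  have "integral {a..b} (\<lambda>x. P (m x) * m2 x) \<le> integral {a..b} g'"
    by (rule integral_le[OF int]) (use I P' in \<open>auto simp: integrable_on_def g'_def\<close>)
  then show ?thesis using I by (simp add: integral_unique)
qed

text \<open>\<open>d\<close> is the difference of two solutions and \<open>m\<close> the difference
  of their logarithms, so that d_t is the Laplacian of m. The derivative of the positive part of d
  involves the Heaviside function of d. Because d and m have the same sign it may be replaced by
  that of m, for which integration by parts leaves only boundary terms.\<close>

lemma L1_contraction:
  fixes d m mx my mxx myy :: "real \<Rightarrow> real \<times> real \<Rightarrow> real"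
  assumes st: "s < t1" and X: "X \<ge> 0"
    and cd: "continuous_on ({s..t1} \<times> UNIV) (\<lambda>(t,z). d t z)"
    and cm: "continuous_on ({s..t1} \<times> UNIV) (\<lambda>(t,z). m t z)"
    and cmxx: "continuous_on ({s..t1} \<times> UNIV) (\<lambda>(t,z). mxx t z)"
    and cmyy: "continuous_on ({s..t1} \<times> UNIV) (\<lambda>(t,z). myy t z)"
    and dt: "\<And>t z. t \<in> {s..t1} \<Longrightarrow> ((\<lambda>t. d t z) has_real_derivative mxx t z + myy t z) (at t)"
    and dmx: "\<And>t x y. t \<in> {s..t1} \<Longrightarrow> ((\<lambda>x. m t (x, y)) has_real_derivative mx t (x, y)) (at x)"
    and dmxx: "\<And>t x y. t \<in> {s..t1} \<Longrightarrow> ((\<lambda>x. mx t (x, y)) has_real_derivative mxx t (x, y)) (at x)"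
    and dmy: "\<And>t x y. t \<in> {s..t1} \<Longrightarrow> ((\<lambda>y. m t (x, y)) has_real_derivative my t (x, y)) (at y)"
    and dmyy: "\<And>t x y. t \<in> {s..t1} \<Longrightarrow> ((\<lambda>y. my t (x, y)) has_real_derivative myy t (x, y)) (at y)"
    and per: "\<And>t x. t \<in> {s..t1} \<Longrightarrow> m t (x, 2 * pi) = m t (x, 0)" "\<And>t x. t \<in> {s..t1} \<Longrightarrow> my t (x, 2 * pi) = my t (x, 0)"
    and sgn: "\<And>t z. t \<in> {s..t1} \<Longrightarrow> sgn (d t z) = sgn (m t z)"
    and K: "\<And>t x y. t \<in> {s..t1} \<Longrightarrow> \<bar>mx t (x, y)\<bar> \<le> K / cosh x"
  shows "integral (cbox (-X, 0) (X, 2 * pi)) (\<lambda>z. max 0 (d t1 z)) \<le>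
     integral (cbox (-X, 0) (X, 2 * pi)) (\<lambda>z. max 0 (d s z)) + (t1 - s) * (4 * pi * K / cosh X)"
proof -
  let ?B = "cbox (-X, 0) (X, 2 * pi)"
  define P where "P n y = (1 + tanh (real n * y)) / 2" for n :: nat and y :: real
  have P01: "0 \<le> P n y" "P n y \<le> 1" for n y
    using tanh_real_bounds[of "real n * y"] by (auto simp: P_def)
  have cP: "continuous_on S (P n)" for S n
    unfolding P_def by (auto intro!: continuous_intros)
  have dP: "(P n has_real_derivative real n * (1 - (tanh (real n * y))\<^sup>2) / 2) (at y)" for n y
    unfolding P_def by (auto intro!: derivative_eq_intros)
  have dP0: "real n * (1 - (tanh (real n * y))\<^sup>2) / 2 \<ge> 0" for n y
    unfolding one_minus_tanh_square by simp
  have ct: "continuous_on S (\<lambda>z. f (g z) (h z))"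
    if "continuous_on ({s..t1} \<times> UNIV) (\<lambda>(t,z). f t z)" "continuous_on S g" "continuous_on S h" "g ` S \<subseteq> {s..t1}"
    for f :: "real \<Rightarrow> real \<times> real \<Rightarrow> real" and g h and S :: "'c::topological_space set"
  proof -
    have "continuous_on S (\<lambda>z. case (g z, h z) of (t, z) \<Rightarrow> f t z)"
      by (rule continuous_on_compose2[OF that(1)]) (use that in \<open>auto intro!: continuous_intros\<close>)
    then show ?thesis by simp
  qed
  note cts = ct[OF cd] ct[OF cm] ct[OF cmxx] ct[OF cmyy]
  define D where "D t z = mxx t z + myy t z" for t z
  \<comment> \<open>The error of replacing P n d by P n m. It tends to 0 as both have the same
    pointwise limit, and on the compact box it is dominated by a constant.\<close>
  define \<kappa> where "\<kappa> n t = integral ?B (\<lambda>z. (P n (d t z) - P n (m t z)) * D t z)" for n t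
  define J where "J n t = integral ?B (\<lambda>z. pos_approx n (d t z))" for n t
  have cJ: "continuous_on S (pos_approx n)" if "n > 0" for n S
    by (rule DERIV_continuous_on[OF has_field_derivative_at_within[OF pos_approx_deriv[OF that]]])
  have Jint: "(\<lambda>z. pos_approx n (d t z)) integrable_on ?B" if "n > 0" "t \<in> {s..t1}" for n t
    by (intro integrable_continuous continuous_on_compose2[OF cJ[OF that(1), of UNIV]] cts continuous_intros)
       (use that in auto)
  have dJ: "(J n has_real_derivative integral ?B (\<lambda>z. P n (d t z) * D t z)) (at t within {s..t1})"
    if n: "n > 0" and t: "t \<in> {s..t1}" for n t
    unfolding J_def
  proof (rule leibniz_rule_field_derivative)
    fix r z assume r: "r \<in> {s..t1}"
    show "((\<lambda>t. pos_approx n (d t z)) has_real_derivative P n (d r z) * D r z) (at r within {s..t1})"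
      unfolding P_def D_def
      by (rule has_field_derivative_at_within[OF DERIV_chain2[OF pos_approx_deriv[OF n] dt[OF r]]])
  next
    show "continuous_on ({s..t1} \<times> ?B) (\<lambda>(t, z). P n (d t z) * D t z)"
      unfolding D_def split_beta
      by (intro continuous_intros continuous_on_compose2[OF cP[of UNIV]] cts) auto
  qed (use t Jint[OF n] in auto)
  have PD: "integral ?B (\<lambda>z. P n (m t z) * D t z) \<le> 4 * pi * K / cosh X"
    if t: "t \<in> {s..t1}" for n t
  proof -
    have c1: "continuous_on ?B (\<lambda>z. P n (m t z) * mxx t z)" "continuous_on ?B (\<lambda>z. P n (m t z) * myy t z)"
      by (intro continuous_intros continuous_on_compose2[OF cP[of UNIV]] cts; use t in auto)+
    have K0: "K \<ge> 0" using K[OF t, of 0 0] by simp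
    \<comment> \<open>Each end contributes at most K / cosh X; integration over an angle of 2 pi
      then gives the flux constant of the statement. In the angular direction the boundary terms
      cancel by periodicity.\<close>
    have A: "integral {-X..X} (\<lambda>x. P n (m t (x, y)) * mxx t (x, y)) \<le> 2 * K / cosh X" for y
    proof -
      have "continuous_on {-X..X} (\<lambda>x. P n (m t (x, y)) * mxx t (x, y))"
        by (intro continuous_intros continuous_on_compose2[OF cP[of UNIV]] cts) (use t in auto)
      then have "integral {-X..X} (\<lambda>x. P n (m t (x, y)) * mxx t (x, y))
          \<le> P n (m t (X, y)) * mx t (X, y) - P n (m t (-X, y)) * mx t (-X, y)"
        using X by (intro integral_nondecreasing_test_le[OF _ dP dP0] dmx dmxx t integrable_continuous_real) auto
      also have "\<bar>P n (m t (x, y)) * mx t (x, y)\<bar> \<le> 1 * (K / cosh x)" for x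
        unfolding abs_mult using P01 K[OF t, of x y] by (intro mult_mono) auto
      from this[of X] this[of "-X"]
      have "P n (m t (X, y)) * mx t (X, y) - P n (m t (-X, y)) * mx t (-X, y) \<le> K / cosh X + K / cosh X"
        by (simp add: abs_le_iff)
      finally show ?thesis by simp
    qed
    have B: "integral {0..2 * pi} (\<lambda>y. P n (m t (x, y)) * myy t (x, y)) \<le> 0" for x
    proof -
      have "continuous_on {0..2 * pi} (\<lambda>y. P n (m t (x, y)) * myy t (x, y))"
        by (intro continuous_intros continuous_on_compose2[OF cP[of UNIV]] cts) (use t in auto)
      then have "integral {0..2 * pi} (\<lambda>y. P n (m t (x, y)) * myy t (x, y))
          \<le> P n (m t (x, 2 * pi)) * my t (x, 2 * pi) - P n (m t (x, 0)) * my t (x, 0)"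
        by (intro integral_nondecreasing_test_le[OF _ dP dP0] dmy dmyy t integrable_continuous_real) auto
      then show ?thesis by (simp add: per[OF t])
    qed
    have "integral ?B (\<lambda>z. P n (m t z) * mxx t z)
        = integral (cbox (-X) X) (\<lambda>x. integral (cbox 0 (2 * pi)) (\<lambda>y. P n (m t (x, y)) * mxx t (x, y)))"
      by (rule integral_prod_continuous[OF c1(1)])
    also have "\<dots> = integral (cbox 0 (2 * pi)) (\<lambda>y. integral (cbox (-X) X) (\<lambda>x. P n (m t (x, y)) * mxx t (x, y)))"
      by (rule integral_swap_continuous) (use c1(1) in \<open>simp add: split_beta\<close>)
    also have "\<dots> \<le> integral (cbox 0 (2 * pi)) (\<lambda>y. 2 * K / cosh X)"
    proof (rule integral_le)
      have "continuous_on (cbox (0, -X) (2 * pi, X)) (\<lambda>z. P n (m t (snd z, fst z)) * mxx t (snd z, fst z))"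
        by (intro continuous_intros continuous_on_compose2[OF cP[of UNIV]] cts) (use t in auto)
      from integral_integrable_2dim[OF this]
      show "(\<lambda>y. integral (cbox (-X) X) (\<lambda>x. P n (m t (x, y)) * mxx t (x, y))) integrable_on cbox 0 (2 * pi)"
        by simp
    qed (use A in auto)
    also have "\<dots> = 4 * pi * K / cosh X" by simp
    finally have 1: "integral ?B (\<lambda>z. P n (m t z) * mxx t z) \<le> 4 * pi * K / cosh X" .
    have "integral ?B (\<lambda>z. P n (m t z) * myy t z)
        = integral (cbox (-X) X) (\<lambda>x. integral (cbox 0 (2 * pi)) (\<lambda>y. P n (m t (x, y)) * myy t (x, y)))"
      by (rule integral_prod_continuous[OF c1(2)])
    also have "\<dots> \<le> integral (cbox (-X) X) (\<lambda>x. 0)"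
      by (rule integral_le[OF integral_integrable_2dim[OF c1(2)]]) (use B in auto)
    finally have 2: "integral ?B (\<lambda>z. P n (m t z) * myy t z) \<le> 0" by simp
    have "integral ?B (\<lambda>z. P n (m t z) * D t z) =
       integral ?B (\<lambda>z. P n (m t z) * mxx t z) + integral ?B (\<lambda>z. P n (m t z) * myy t z)"
      unfolding D_def ring_distribs using c1 by (intro integral_add integrable_continuous)
    with 1 2 show ?thesis by simp
  qed
  have ck: "continuous_on ({s..t1} \<times> ?B) (\<lambda>(t, z). (P n (d t z) - P n (m t z)) * D t z)" for n
    unfolding D_def split_beta
    by (intro continuous_intros continuous_on_compose2[OF cP[of UNIV]] cts) auto
  have c\<kappa>: "continuous_on {s..t1} (\<kappa> n)" for n
    unfolding \<kappa>_def by (rule integral_continuous_on_param[OF ck])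
  have PDint: "(\<lambda>z. P n (d t z) * D t z) integrable_on ?B" "(\<lambda>z. P n (m t z) * D t z) integrable_on ?B"
    if "t \<in> {s..t1}" for n t
    unfolding D_def
    by (intro integrable_continuous continuous_intros continuous_on_compose2[OF cP[of UNIV]] cts; use that in auto)+
  have Jle: "J n t1 - J n s \<le> (t1 - s) * (4 * pi * K / cosh X) + integral {s..t1} (\<kappa> n)" if n: "n > 0" for n
  proof -
    have I: "((\<lambda>t. integral ?B (\<lambda>z. P n (d t z) * D t z)) has_integral (J n t1 - J n s)) {s..t1}"
      using st dJ[OF n] by (intro fundamental_theorem_of_calculus)
        (auto simp: has_real_derivative_iff_has_vector_derivative[symmetric])
    have "J n t1 - J n s = integral {s..t1} (\<lambda>t. integral ?B (\<lambda>z. P n (d t z) * D t z))"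
      using I by (simp add: integral_unique)
    also have "\<dots> \<le> integral {s..t1} (\<lambda>t. 4 * pi * K / cosh X + \<kappa> n t)"
    proof (rule integral_le)
      show "(\<lambda>t. 4 * pi * K / cosh X + \<kappa> n t) integrable_on {s..t1}"
        by (intro integrable_continuous_real continuous_intros c\<kappa>)
      fix t assume t: "t \<in> {s..t1}"
      have "\<kappa> n t = integral ?B (\<lambda>z. P n (d t z) * D t z) - integral ?B (\<lambda>z. P n (m t z) * D t z)"
        unfolding \<kappa>_def left_diff_distrib by (intro integral_diff PDint t)
      then show "integral ?B (\<lambda>z. P n (d t z) * D t z) \<le> 4 * pi * K / cosh X + \<kappa> n t"
        using PD[OF t, of n] by simp
    qed (use I in \<open>auto simp: integrable_on_def\<close>)
    also have "\<dots> = integral {s..t1} (\<lambda>t. 4 * pi * K / cosh X) + integral {s..t1} (\<kappa> n)"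
      by (intro integral_add integrable_continuous_real continuous_intros c\<kappa>)
    finally show ?thesis using st by (simp add: algebra_simps)
  qed
  have cD: "continuous_on ({s..t1} \<times> ?B) (\<lambda>z. D (fst z) (snd z))"
    unfolding D_def by (intro continuous_intros cts) auto
  have "compact ({s..t1} \<times> ?B)" by (intro compact_Times compact_Icc compact_cbox)
  then have "bounded ((\<lambda>z. D (fst z) (snd z)) ` ({s..t1} \<times> ?B))"
    using cD compact_continuous_image compact_imp_bounded by blast
  then obtain M where M: "\<And>t z. t \<in> {s..t1} \<Longrightarrow> z \<in> ?B \<Longrightarrow> \<bar>D t z\<bar> \<le> M"
    unfolding bounded_iff by force
  have kM: "\<bar>(P n (d t z) - P n (m t z)) * D t z\<bar> \<le> M" if "t \<in> {s..t1}" "z \<in> ?B" for n t z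
  proof -
    have "\<bar>P n (d t z) - P n (m t z)\<bar> \<le> 1"
      using P01[of n "d t z"] P01[of n "m t z"] by (simp add: abs_le_iff)
    then have "\<bar>P n (d t z) - P n (m t z)\<bar> * \<bar>D t z\<bar> \<le> 1 * \<bar>D t z\<bar>" by (intro mult_right_mono) auto
    then show ?thesis using M[OF that] by (simp add: abs_mult)
  qed
  have k0: "(\<lambda>n. (P n (d t z) - P n (m t z)) * D t z) \<longlonglongrightarrow> 0" if "t \<in> {s..t1}" for t z
  proof -
    have "(\<lambda>n. (P n (d t z) - P n (m t z)) * D t z) \<longlonglongrightarrow> ((1 + sgn (d t z)) / 2 - (1 + sgn (m t z)) / 2) * D t z"
      unfolding P_def by (intro tendsto_intros tanh_scaled_tendsto) auto
    then show ?thesis using sgn[OF that] by simp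
  qed
  have \<kappa>0: "(\<lambda>n. \<kappa> n t) \<longlonglongrightarrow> 0" if t: "t \<in> {s..t1}" for t
  proof -
    have "(\<lambda>n. \<kappa> n t) \<longlonglongrightarrow> integral ?B (\<lambda>z. 0)"
      unfolding \<kappa>_def
    proof (rule dominated_convergence(2)[where h="\<lambda>z. M"])
      show "(\<lambda>z. (P n (d t z) - P n (m t z)) * D t z) integrable_on ?B" for n
        unfolding left_diff_distrib by (intro integrable_diff PDint t)
    qed (use kM k0 t in auto)
    then show ?thesis by simp
  qed
  have \<kappa>M: "\<bar>\<kappa> n t\<bar> \<le> M * measure lborel ?B" if t: "t \<in> {s..t1}" for n t
  proof -
    have "norm (\<kappa> n t) \<le> integral ?B (\<lambda>z. M)"
      unfolding \<kappa>_def
      by (rule integral_norm_bound_integral)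
         (use kM t in \<open>auto simp: left_diff_distrib intro!: integrable_diff PDint\<close>)
    then show ?thesis by (simp add: mult.commute)
  qed
  have lim\<kappa>: "(\<lambda>n. integral {s..t1} (\<kappa> n)) \<longlonglongrightarrow> 0"
  proof -
    have "(\<lambda>n. integral {s..t1} (\<kappa> n)) \<longlonglongrightarrow> integral {s..t1} (\<lambda>t. 0)"
      by (rule dominated_convergence(2)[where h="\<lambda>t. M * measure lborel ?B"])
         (use \<kappa>M \<kappa>0 c\<kappa> in \<open>auto intro: integrable_continuous_real\<close>)
    then show ?thesis by simp
  qed
  have limJ: "(\<lambda>n. J n t) \<longlonglongrightarrow> integral ?B (\<lambda>z. max 0 (d t z))" if t: "t \<in> {s..t1}" for t
  proof -
    have mint: "(\<lambda>z. max 0 (d t z)) integrable_on ?B"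
      by (intro integrable_continuous continuous_intros cts) (use t in auto)
    have lo: "integral ?B (\<lambda>z. max 0 (d t z)) \<le> J n t" if "n > 0" for n
      unfolding J_def by (intro integral_le mint Jint t that pos_approx_bounds)
    have hi: "J n t \<le> integral ?B (\<lambda>z. max 0 (d t z)) + 1 / real n * measure lborel ?B" if n: "n > 0" for n
    proof -
      have "J n t \<le> integral ?B (\<lambda>z. max 0 (d t z) + 1 / real n)"
        unfolding J_def by (intro integral_le integrable_add mint integrable_const Jint t n pos_approx_bounds)
      also have "\<dots> = integral ?B (\<lambda>z. max 0 (d t z)) + integral ?B (\<lambda>z. 1 / real n)"
        by (intro integral_add mint integrable_const)
      finally show ?thesis by (simp add: mult.commute)
    qed
    have "(\<lambda>n. integral ?B (\<lambda>z. max 0 (d t z)) + 1 / real n * measure lborel ?B) \<longlonglongrightarrow> integral ?B (\<lambda>z. max 0 (d t z)) + 0 * measure lborel ?B"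
      by (intro tendsto_intros lim_1_over_n)
    then have L: "(\<lambda>n. integral ?B (\<lambda>z. max 0 (d t z)) + 1 / real n * measure lborel ?B) \<longlonglongrightarrow> integral ?B (\<lambda>z. max 0 (d t z))"
      by (simp only: mult_zero_left add_0_right)
    show ?thesis
    proof (rule tendsto_sandwich[OF _ _ tendsto_const L])
      show "\<forall>\<^sub>F n in sequentially. integral ?B (\<lambda>z. max 0 (d t z)) \<le> J n t"
        by (rule eventually_sequentiallyI[of 1], rule lo) linarith
      show "\<forall>\<^sub>F n in sequentially. J n t \<le> integral ?B (\<lambda>z. max 0 (d t z)) + 1 / real n * measure lborel ?B"
        by (rule eventually_sequentiallyI[of 1], rule hi) linarith
    qed
  qed
  have "integral ?B (\<lambda>z. max 0 (d t1 z)) - integral ?B (\<lambda>z. max 0 (d s z)) \<le> (t1 - s) * (4 * pi * K / cosh X) + 0"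
  proof (rule LIMSEQ_le)
    show "(\<lambda>n. J n t1 - J n s) \<longlonglongrightarrow> integral ?B (\<lambda>z. max 0 (d t1 z)) - integral ?B (\<lambda>z. max 0 (d s z))"
      by (intro tendsto_diff limJ) (use st in auto)
    show "(\<lambda>n. (t1 - s) * (4 * pi * K / cosh X) + integral {s..t1} (\<kappa> n)) \<longlonglongrightarrow> (t1 - s) * (4 * pi * K / cosh X) + 0"
      by (intro tendsto_add tendsto_const lim\<kappa>)
    show "\<exists>N. \<forall>n\<ge>N. J n t1 - J n s \<le> (t1 - s) * (4 * pi * K / cosh X) + integral {s..t1} (\<kappa> n)"
      by (rule exI[of _ 1], intro allI impI Jle) linarith
  qed
  then show ?thesis by simp
qed

section \<open>Smoothness in Mercator coordinates\<close>

lemma Ck_on_SucD: "Ck_on (Suc k) W f \<Longrightarrow> Ck_on k W f"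
proof (induction k arbitrary: f)
  case 0
  then show ?case
    by (auto intro!: differentiable_imp_continuous_on differentiable_at_imp_differentiable_on)
next
  case (Suc k)
  then show ?case by (metis Ck_on.simps(2))
qed

lemma Ck_on_continuous_on: "Ck_on k W f \<Longrightarrow> continuous_on W f"
proof (induction k)
  case (Suc k)
  then show ?case by (blast dest: Ck_on_SucD)
qed simp

text \<open>Differentiability k times in one real variable, with all derivatives jointly continuous
  in that variable and a parameter p. Only derivatives in the real variable are tracked: this
  suffices for \<open>mixed_partial\<close> and for differentiation under the integral, and it is
  stable under products, inverses and logarithms.\<close>

primrec cx :: "nat \<Rightarrow> 'p::topological_space set \<Rightarrow> (real \<Rightarrow> 'p \<Rightarrow> real) \<Rightarrow> bool" where
  "cx 0 P g \<longleftrightarrow> continuous_on (UNIV \<times> P) (\<lambda>(x,p). g x p)"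
| "cx (Suc k) P g \<longleftrightarrow> continuous_on (UNIV \<times> P) (\<lambda>(x,p). g x p) \<and>
     (\<exists>g'. (\<forall>x. \<forall>p\<in>P. ((\<lambda>x. g x p) has_real_derivative g' x p) (at x)) \<and> cx k P g')"

lemma cx_continuous_on: "cx k P g \<Longrightarrow> continuous_on (UNIV \<times> P) (\<lambda>(x,p). g x p)"
  by (cases k) auto

lemma cx_SucI:
  assumes "\<And>x p. p \<in> P \<Longrightarrow> ((\<lambda>x. g x p) has_real_derivative g' x p) (at x)"
    and "cx k P g'" and "continuous_on (UNIV \<times> P) (\<lambda>(x,p). g x p)"
  shows "cx (Suc k) P g"
  using assms by auto

lemma cx_SucE:
  assumes "cx (Suc k) P g"
  obtains g' where "\<And>x p. p \<in> P \<Longrightarrow> ((\<lambda>x. g x p) has_real_derivative g' x p) (at x)" "cx k P g'"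
  using assms by auto

lemma cx_SucD: "cx (Suc k) P g \<Longrightarrow> cx k P g"
proof (induction k arbitrary: g)
  case (Suc k)
  then obtain g' where "\<And>x p. p \<in> P \<Longrightarrow> ((\<lambda>x. g x p) has_real_derivative g' x p) (at x)" "cx (Suc k) P g'"
    by (auto elim: cx_SucE)
  then show ?case using Suc.IH[of g'] cx_continuous_on[OF Suc.prems] by (intro cx_SucI[of P g g']) auto
qed auto

lemma cx_const:
  assumes "continuous_on P c"
  shows "cx k P (\<lambda>x p. c p)"
proof -
  have c: "continuous_on (UNIV \<times> P) (\<lambda>(x::real,p). c p)"
    unfolding split_beta by (rule continuous_on_compose2[OF assms]) (auto intro!: continuous_intros)
  have z: "cx k P (\<lambda>x p. 0)" for k
    by (induction k) (auto intro!: exI[of _ "\<lambda>x p. 0"])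
  show ?thesis using c z by (cases k) (auto intro!: exI[of _ "\<lambda>x p. 0"])
qed

lemma cx_add: "cx k P f \<Longrightarrow> cx k P g \<Longrightarrow> cx k P (\<lambda>x p. f x p + g x p)"
proof (induction k arbitrary: f g)
  case 0
  then show ?case by (auto simp: split_beta intro!: continuous_intros)
next
  case (Suc k)
  obtain f' where f': "\<And>x p. p \<in> P \<Longrightarrow> ((\<lambda>x. f x p) has_real_derivative f' x p) (at x)" "cx k P f'"
    using Suc.prems(1) by (elim cx_SucE) blast
  obtain g' where g': "\<And>x p. p \<in> P \<Longrightarrow> ((\<lambda>x. g x p) has_real_derivative g' x p) (at x)" "cx k P g'"
    using Suc.prems(2) by (elim cx_SucE) blast
  show ?case
    using cx_continuous_on[OF Suc.prems(1)] cx_continuous_on[OF Suc.prems(2)]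
    by (intro cx_SucI[of P _ "\<lambda>x p. f' x p + g' x p"] Suc.IH f' g')
       (auto simp: split_beta intro!: continuous_intros DERIV_add f' g')
qed

lemma cx_mult: "cx k P f \<Longrightarrow> cx k P g \<Longrightarrow> cx k P (\<lambda>x p. f x p * g x p)"
proof (induction k arbitrary: f g)
  case 0
  then show ?case by (auto simp: split_beta intro!: continuous_intros)
next
  case (Suc k)
  obtain f' where f': "\<And>x p. p \<in> P \<Longrightarrow> ((\<lambda>x. f x p) has_real_derivative f' x p) (at x)" "cx k P f'"
    using Suc.prems(1) by (elim cx_SucE) blast
  obtain g' where g': "\<And>x p. p \<in> P \<Longrightarrow> ((\<lambda>x. g x p) has_real_derivative g' x p) (at x)" "cx k P g'"
    using Suc.prems(2) by (elim cx_SucE) blast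
  show ?case
  proof (rule cx_SucI[of P _ "\<lambda>x p. f' x p * g x p + g' x p * f x p"])
    show "cx k P (\<lambda>x p. f' x p * g x p + g' x p * f x p)"
      by (intro cx_add Suc.IH f' g' cx_SucD[OF Suc.prems(1)] cx_SucD[OF Suc.prems(2)])
    show "continuous_on (UNIV \<times> P) (\<lambda>(x, p). f x p * g x p)"
      using cx_continuous_on[OF Suc.prems(1)] cx_continuous_on[OF Suc.prems(2)]
      by (auto simp: split_beta intro!: continuous_intros)
  qed (intro DERIV_mult f' g')
qed

lemma cx_sum: "finite I \<Longrightarrow> (\<And>i. i \<in> I \<Longrightarrow> cx k P (f i)) \<Longrightarrow> cx k P (\<lambda>x p. \<Sum>i\<in>I. f i x p)"
  by (induction I rule: finite_induct) (auto intro: cx_add cx_const)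

lemma cx_inverse:
  assumes ne: "\<And>x p. p \<in> P \<Longrightarrow> g x p \<noteq> 0"
  shows "cx k P g \<Longrightarrow> cx k P (\<lambda>x p. inverse (g x p))"
proof (induction k)
  case 0
  then show ?case using ne by (auto simp: split_beta intro!: continuous_intros)
next
  case (Suc k)
  obtain g' where g': "\<And>x p. p \<in> P \<Longrightarrow> ((\<lambda>x. g x p) has_real_derivative g' x p) (at x)" "cx k P g'"
    using Suc.prems by (elim cx_SucE) blast
  note inv = Suc.IH[OF cx_SucD[OF Suc.prems]]
  show ?case
  proof (rule cx_SucI[of P _ "\<lambda>x p. (-1) * (inverse (g x p) * g' x p * inverse (g x p))"])
    show "cx k P (\<lambda>x p. (-1) * (inverse (g x p) * g' x p * inverse (g x p)))"
      by (intro cx_mult inv g' cx_const continuous_intros)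
    show "continuous_on (UNIV \<times> P) (\<lambda>(x, p). inverse (g x p))"
      using cx_continuous_on[OF Suc.prems] ne by (auto simp: split_beta intro!: continuous_intros)
  qed (use DERIV_inverse'[OF g'(1) ne] in simp)
qed

lemma cx_ln:
  assumes pos: "\<And>x p. p \<in> P \<Longrightarrow> g x p > 0" and g: "cx k P g"
  shows "cx k P (\<lambda>x p. ln (g x p))"
proof -
  have ne: "g x p \<noteq> 0" if "p \<in> P" for x p using pos[OF that, of x] by simp
  have cont: "continuous_on (UNIV \<times> P) (\<lambda>(x, p). ln (g x p))"
    using cx_continuous_on[OF g] ne by (auto simp: split_beta intro!: continuous_intros)
  show ?thesis
  proof (cases k)
    case (Suc j)
    have g1: "cx (Suc j) P g" using g unfolding Suc .
    obtain g' where g': "\<And>x p. p \<in> P \<Longrightarrow> ((\<lambda>x. g x p) has_real_derivative g' x p) (at x)" "cx j P g'"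
      using g1 by (elim cx_SucE) blast
    have "cx (Suc j) P (\<lambda>x p. ln (g x p))"
    proof (rule cx_SucI[of P _ "\<lambda>x p. inverse (g x p) * g' x p"])
      show "cx j P (\<lambda>x p. inverse (g x p) * g' x p)"
        by (rule cx_mult[OF cx_inverse[OF ne cx_SucD[OF g1]] g'(2)])
      show "((\<lambda>x. ln (g x p)) has_real_derivative inverse (g x p) * g' x p) (at x)" if "p \<in> P" for x p
        using DERIV_ln[OF pos[OF that]] g'(1)[OF that] by (rule DERIV_chain2)
    qed (rule cont)
    then show ?thesis unfolding Suc .
  qed (use cont in simp)
qed

lemma cx_compose_continuous:
  fixes \<Gamma> :: "real \<Rightarrow> 'p::t2_space \<Rightarrow> 'a::euclidean_space"
  assumes W: "\<And>x p. p \<in> P \<Longrightarrow> \<Gamma> x p \<in> W"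
    and F: "Ck_on k W F" and \<Gamma>: "\<And>b. b \<in> Basis \<Longrightarrow> cx k P (\<lambda>x p. \<Gamma> x p \<bullet> b)"
  shows "continuous_on (UNIV \<times> P) (\<lambda>(x, p). F (\<Gamma> x p))"
proof -
  have "continuous_on (UNIV \<times> P) (\<lambda>z. \<Gamma> (fst z) (snd z))"
    unfolding continuous_on_componentwise[of _ "\<lambda>z. \<Gamma> (fst z) (snd z)"]
    using cx_continuous_on[OF \<Gamma>] by (auto simp: split_beta)
  then show ?thesis
    unfolding split_beta by (rule continuous_on_compose2[OF Ck_on_continuous_on[OF F]]) (use W in auto)
qed

text \<open>The derivative is a sum of directional derivatives of F, one class lower, composed with
  the same map \<Gamma>. So the induction varies F and keeps \<Gamma>.\<close>

lemma cx_compose: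
  fixes \<Gamma> :: "real \<Rightarrow> 'p::t2_space \<Rightarrow> 'a::euclidean_space"
  assumes W: "\<And>x p. p \<in> P \<Longrightarrow> \<Gamma> x p \<in> W"
  shows "Ck_on k W F \<Longrightarrow> (\<And>b. b \<in> Basis \<Longrightarrow> cx k P (\<lambda>x p. \<Gamma> x p \<bullet> b)) \<Longrightarrow> cx k P (\<lambda>x p. F (\<Gamma> x p))"
proof (induction k arbitrary: F)
  case 0
  then show ?case using cx_compose_continuous[of P \<Gamma> W 0 F] W by simp
next
  case (Suc k)
  have "\<forall>b\<in>Basis. \<exists>g'. (\<forall>x. \<forall>p\<in>P. ((\<lambda>x. \<Gamma> x p \<bullet> b) has_real_derivative g' x p) (at x)) \<and> cx k P g'"
    using Suc.prems(2) by auto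
  from bchoice[OF this] obtain \<Gamma>' where "\<forall>b\<in>Basis. (\<forall>x. \<forall>p\<in>P.
      ((\<lambda>x. \<Gamma> x p \<bullet> b) has_real_derivative \<Gamma>' b x p) (at x)) \<and> cx k P (\<Gamma>' b)" ..
  then have \<Gamma>': "\<And>b x p. b \<in> Basis \<Longrightarrow> p \<in> P \<Longrightarrow> ((\<lambda>x. \<Gamma> x p \<bullet> b) has_real_derivative \<Gamma>' b x p) (at x)"
     "\<And>b. b \<in> Basis \<Longrightarrow> cx k P (\<Gamma>' b)"
    by blast+
  show ?case
  proof (rule cx_SucI[of P _ "\<lambda>x p. \<Sum>b\<in>Basis. \<Gamma>' b x p * frechet_derivative F (at (\<Gamma> x p)) b"])
    show "cx k P (\<lambda>x p. \<Sum>b\<in>Basis. \<Gamma>' b x p * frechet_derivative F (at (\<Gamma> x p)) b)"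
    proof (intro cx_sum cx_mult \<Gamma>')
      fix b :: 'a
      show "cx k P (\<lambda>x p. frechet_derivative F (at (\<Gamma> x p)) b)"
        by (rule Suc.IH) (use Suc.prems in \<open>auto intro: cx_SucD simp del: cx.simps\<close>)
    qed auto
    show "continuous_on (UNIV \<times> P) (\<lambda>(x, p). F (\<Gamma> x p))" by (rule cx_compose_continuous[OF W Suc.prems])
    fix x p assume p: "p \<in> P"
    define v where "v = (\<Sum>b\<in>Basis. \<Gamma>' b x p *\<^sub>R b)"
    have vb: "v \<bullet> b = \<Gamma>' b x p" if "b \<in> Basis" for b
      unfolding v_def using that by (rule inner_sum_left_Basis)
    have "((\<lambda>x. \<Gamma> x p) has_derivative (\<lambda>h. h *\<^sub>R v)) (at x)"
    proof (rule has_derivative_componentwise_within[THEN iffD2], rule ballI)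
      fix b :: 'a assume b: "b \<in> Basis"
      show "((\<lambda>x. \<Gamma> x p \<bullet> b) has_derivative (\<lambda>h. h *\<^sub>R v \<bullet> b)) (at x)"
        using \<Gamma>'(1)[OF b p, of x] by (simp add: has_field_derivative_def vb[OF b] mult_commute_abs)
    qed
    moreover have "(F has_derivative frechet_derivative F (at (\<Gamma> x p))) (at (\<Gamma> x p))"
      using Suc.prems(1) W[OF p] by (auto simp: frechet_derivative_works)
    ultimately have "((\<lambda>x. F (\<Gamma> x p)) has_derivative (\<lambda>h. frechet_derivative F (at (\<Gamma> x p)) (h *\<^sub>R v))) (at x)"
      using has_derivative_compose by blast
    moreover have lin: "linear (frechet_derivative F (at (\<Gamma> x p)))"
      using Suc.prems(1) W[OF p] by (auto intro: linear_frechet_derivative)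
    moreover have "frechet_derivative F (at (\<Gamma> x p)) v = (\<Sum>b\<in>Basis. \<Gamma>' b x p * frechet_derivative F (at (\<Gamma> x p)) b)"
      unfolding v_def by (simp add: linear_sum[OF lin] linear_cmul[OF lin])
    ultimately show "((\<lambda>x. F (\<Gamma> x p)) has_real_derivative
        (\<Sum>b\<in>Basis. \<Gamma>' b x p * frechet_derivative F (at (\<Gamma> x p)) b)) (at x)"
      by (simp add: has_field_derivative_def linear_cmul[OF lin] mult_commute_abs)
  qed
qed

text \<open>Both claims are proved together because each derivative is a polynomial in the
  pair.\<close>

lemma cx_sech_tanh:
  fixes P :: "'p::topological_space set"
  shows "cx k P (\<lambda>x p. 1 / cosh x) \<and> cx k P (\<lambda>x p. tanh x)"
proof (induction k)
  case 0
  show ?case by (auto simp: split_beta intro!: continuous_intros)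
next
  case (Suc k)
  have "cx (Suc k) P (\<lambda>x p. 1 / cosh x)"
  proof (rule cx_SucI[of P _ "\<lambda>x p. (-1) * ((1 / cosh x) * tanh x)"])
    show "cx k P (\<lambda>x p. (-1) * ((1 / cosh x) * tanh x))"
      using Suc by (intro cx_mult cx_const continuous_intros) auto
  qed (auto simp: split_beta tanh_def power2_eq_square intro!: continuous_intros derivative_eq_intros)
  moreover have "cx (Suc k) P (\<lambda>x p. tanh x)"
  proof (rule cx_SucI[of P _ "\<lambda>x p. (1 / cosh x) * (1 / cosh x)"])
    show "cx k P (\<lambda>x p. (1 / cosh x) * (1 / cosh x))"
      using Suc by (intro cx_mult) auto
  qed (auto simp: split_beta one_minus_tanh_square power_one_over[symmetric] power2_eq_square[symmetric] intro!: continuous_intros derivative_eq_intros)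
  ultimately show ?case by blast
qed

lemma cx_cos_sin:
  fixes P :: "'p::t2_space set"
  shows "cx k P (\<lambda>x p. cos x) \<and> cx k P (\<lambda>x p. sin x)"
proof (induction k)
  case 0
  show ?case by (auto simp: split_beta intro!: continuous_intros)
next
  case (Suc k)
  have "cx (Suc k) P (\<lambda>x p. cos x)"
  proof (rule cx_SucI[of P _ "\<lambda>x p. (-1) * sin x"])
    show "cx k P (\<lambda>x p. (-1) * sin x)"
      using Suc by (intro cx_mult cx_const continuous_intros) auto
  qed (auto simp: split_beta intro!: continuous_intros derivative_eq_intros)
  moreover have "cx (Suc k) P (\<lambda>x p. sin x)"
    by (rule cx_SucI[of P _ "\<lambda>x p. cos x"])
       (use Suc in \<open>auto simp: split_beta intro!: continuous_intros derivative_eq_intros\<close>)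
  ultimately show ?case by blast
qed

section \<open>The Mercator parametrization of the sphere\<close>

definition Phi :: "real \<Rightarrow> real \<Rightarrow> real^3" where
  "Phi x \<theta> = vector [cos \<theta> / cosh x, sin \<theta> / cosh x, tanh x]"

lemma sqrt_one_plus_sinh_square: "sqrt (1 + (sinh x)\<^sup>2) = cosh x" for x :: real
  by (rule real_sqrt_unique) (auto simp: cosh_square_eq)

lemma cos_inv_mercator: "cos (inv_mercator x) = 1 / cosh x"
  by (simp add: inv_mercator_def cos_arctan sqrt_one_plus_sinh_square)

lemma sin_inv_mercator: "sin (inv_mercator x) = tanh x"
  by (simp add: inv_mercator_def sin_arctan sqrt_one_plus_sinh_square tanh_def)

lemma sph_inv_mercator: "sph (inv_mercator x) \<theta> = Phi x \<theta>"
  by (simp add: sph_def Phi_def cos_inv_mercator sin_inv_mercator)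

lemma Phi_component: "Phi x \<theta> $ 1 = cos \<theta> / cosh x" "Phi x \<theta> $ 2 = sin \<theta> / cosh x" "Phi x \<theta> $ 3 = tanh x"
  by (simp_all add: Phi_def)

lemma Phi_in_S2: "Phi x \<theta> \<in> S2"
proof -
  have "(cos \<theta> / cosh x)\<^sup>2 + (sin \<theta> / cosh x)\<^sup>2 + (tanh x)\<^sup>2 = ((cos \<theta>)\<^sup>2 + (sin \<theta>)\<^sup>2) / (cosh x)\<^sup>2 + (tanh x)\<^sup>2"
    by (simp add: power_divide add_divide_distrib[symmetric])
  also have "\<dots> = 1" using one_minus_tanh_square[of x] by simp
  finally show ?thesis
    by (simp add: norm_eq_sqrt_inner inner_vec_def sum_3 Phi_component power2_eq_square)
qed

lemma Phi_periodic: "Phi x (\<theta> + 2 * pi) = Phi x \<theta>"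
  by (simp add: Phi_def)

lemma Phi_at_top: "((\<lambda>x. Phi x \<theta>) \<longlongrightarrow> axis 3 1) at_top"
  and Phi_at_bot: "((\<lambda>x. Phi x \<theta>) \<longlongrightarrow> axis 3 (- 1)) at_bot"
proof -
  have c: "((\<lambda>x. cos \<theta> / cosh x) \<longlongrightarrow> 0) at_top" "((\<lambda>x. sin \<theta> / cosh x) \<longlongrightarrow> 0) at_top"
    "((\<lambda>x. cos \<theta> / cosh x) \<longlongrightarrow> 0) at_bot" "((\<lambda>x. sin \<theta> / cosh x) \<longlongrightarrow> 0) at_bot"
    using cosh_real_at_top cosh_real_at_bot
    by (auto intro!: tendsto_divide_0[OF tendsto_const] filterlim_at_top_imp_at_infinity)
  show "((\<lambda>x. Phi x \<theta>) \<longlongrightarrow> axis 3 1) at_top"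
  proof (rule vec_tendstoI)
    fix i :: 3
    show "((\<lambda>x. Phi x \<theta> $ i) \<longlongrightarrow> axis 3 1 $ i) at_top"
      using exhaust_3[of i] c tanh_real_at_top by (auto simp: Phi_component axis_def)
  qed
  show "((\<lambda>x. Phi x \<theta>) \<longlongrightarrow> axis 3 (- 1)) at_bot"
  proof (rule vec_tendstoI)
    fix i :: 3
    show "((\<lambda>x. Phi x \<theta> $ i) \<longlongrightarrow> axis 3 (- 1) $ i) at_bot"
      using exhaust_3[of i] c tanh_real_at_bot by (auto simp: Phi_component axis_def)
  qed
qed

text \<open>Smoothness of u on the sphere is witnessed by an extension \<open>F\<close> to an open
  neighbourhood \<open>W\<close>. Derivatives and limits at the poles are taken with
  \<open>F\<close>, and the equation is carried over from u on the sphere.\<close>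

locale sphere_flow =
  fixes u F :: "real^3 \<Rightarrow> real \<Rightarrow> real" and W :: "((real^3) \<times> real) set"
  assumes open_W: "open W" and sub_W: "S2 \<times> {..<0} \<subseteq> W"
    and smooth: "\<And>k. Ck_on k W (\<lambda>(p, t). F p t)"
    and F_eq: "\<And>p t. p \<in> S2 \<Longrightarrow> t < 0 \<Longrightarrow> F p t = u p t"
    and u_pos: "\<And>p t. p \<in> S2 \<Longrightarrow> t < 0 \<Longrightarrow> u p t > 0"
    and u_eq: "log_diffusion_S2 u"
begin

definition U :: "real \<Rightarrow> real \<Rightarrow> real \<Rightarrow> real" where "U x \<theta> t = F (Phi x \<theta>) t"

lemma U_eq: "t < 0 \<Longrightarrow> U x \<theta> t = u (Phi x \<theta>) t"
  by (simp add: U_def F_eq[OF Phi_in_S2])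

lemma U_pos: "t < 0 \<Longrightarrow> U x \<theta> t > 0"
  by (simp add: U_eq u_pos[OF Phi_in_S2])

lemma Phi_W: "t < 0 \<Longrightarrow> (Phi x \<theta>, t) \<in> W"
  using sub_W Phi_in_S2 by auto

lemma Basis_R3_R:
  fixes b :: "(real^3) \<times> real"
  assumes "b \<in> Basis"
  shows "b = (axis 1 1, 0) \<or> b = (axis 2 1, 0) \<or> b = (axis 3 1, 0) \<or> b = (0, 1)"
proof -
  have "axis i 1 \<in> {axis 1 1, axis 2 1, axis 3 (1::real)}" for i :: 3
    using exhaust_3[of i] by auto
  then show ?thesis using assms by (fastforce simp: Basis_prod_def Basis_vec_def)
qed

lemma cx_Phi:
  fixes f :: "(real^3) \<times> real \<Rightarrow> real"
  assumes "Ck_on k W f"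
  shows "cx k (UNIV \<times> {..<0}) (\<lambda>x p. f (Phi x (fst p), snd p))"
    and "cx k (UNIV \<times> {..<0}) (\<lambda>\<theta> p. f (Phi (fst p) \<theta>, snd p))"
proof -
  note st = cx_sech_tanh[THEN conjunct1] cx_sech_tanh[THEN conjunct2]
    cx_cos_sin[THEN conjunct1] cx_cos_sin[THEN conjunct2]
  show "cx k (UNIV \<times> {..<0}) (\<lambda>x p. f (Phi x (fst p), snd p))"
  proof (rule cx_compose[OF _ assms])
    show "(Phi x (fst p), snd p) \<in> W" if "p \<in> UNIV \<times> {..<0}" for x p
      using that Phi_W by auto
    fix b :: "(real^3) \<times> real" assume "b \<in> Basis"
    then consider "b = (axis 1 1, 0)" | "b = (axis 2 1, 0)" | "b = (axis 3 1, 0)" | "b = (0, 1)"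
      using Basis_R3_R by blast
    then show "cx k (UNIV \<times> {..<0}) (\<lambda>x p. (Phi x (fst p :: real), snd p) \<bullet> b)"
    proof cases
      case 1
      have "cx k (UNIV \<times> {..<0}) (\<lambda>x p :: real \<times> real. cos (fst p) * (1 / cosh x))"
        by (intro cx_mult cx_const continuous_intros st)
      then show ?thesis using 1 by (simp add: inner_axis Phi_component)
    next
      case 2
      have "cx k (UNIV \<times> {..<0}) (\<lambda>x p :: real \<times> real. sin (fst p) * (1 / cosh x))"
        by (intro cx_mult cx_const continuous_intros st)
      then show ?thesis using 2 by (simp add: inner_axis Phi_component)
    next
      case 3
      then show ?thesis using st by (simp add: inner_axis Phi_component)
    next
      case 4
      then show ?thesis by (simp add: cx_const continuous_intros)
    qed
  qed
  show "cx k (UNIV \<times> {..<0}) (\<lambda>\<theta> p. f (Phi (fst p) \<theta>, snd p))"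
  proof (rule cx_compose[OF _ assms])
    show "(Phi (fst p) \<theta>, snd p) \<in> W" if "p \<in> UNIV \<times> {..<0}" for \<theta> p
      using that Phi_W by auto
    fix b :: "(real^3) \<times> real" assume "b \<in> Basis"
    then consider "b = (axis 1 1, 0)" | "b = (axis 2 1, 0)" | "b = (axis 3 1, 0)" | "b = (0, 1)"
      using Basis_R3_R by blast
    then show "cx k (UNIV \<times> {..<0}) (\<lambda>\<theta> p. (Phi (fst p :: real) \<theta>, snd p) \<bullet> b)"
    proof cases
      case 1
      have "cx k (UNIV \<times> {..<0}) (\<lambda>\<theta> p :: real \<times> real. cos \<theta> * (1 / cosh (fst p)))"
        by (intro cx_mult cx_const continuous_intros st) auto
      then show ?thesis using 1 by (simp add: inner_axis Phi_component)
    next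
      case 2
      have "cx k (UNIV \<times> {..<0}) (\<lambda>\<theta> p :: real \<times> real. sin \<theta> * (1 / cosh (fst p)))"
        by (intro cx_mult cx_const continuous_intros st) auto
      then show ?thesis using 2 by (simp add: inner_axis Phi_component)
    next
      case 3
      have "cx k (UNIV \<times> {..<0}) (\<lambda>\<theta> p :: real \<times> real. tanh (fst p))"
        by (intro cx_const continuous_intros) auto
      then show ?thesis using 3 by (simp add: inner_axis Phi_component)
    next
      case 4
      then show ?thesis by (simp add: cx_const continuous_intros)
    qed
  qed
qed

text \<open>
  Derivatives along the sphere are bounded, and the tangent vector \<open>d/dx\<close> of the Mercator
  parametrization has length \<open>1 / cosh x\<close>.
\<close>

lemma x_derivative_bound:
  fixes f :: "(real^3) \<times> real \<Rightarrow> real"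
  assumes f: "Ck_on 1 W f" and t1: "t1 < 0"
  obtains K where "K > 0" "\<And>x \<theta> t. t \<in> {s..t1} \<Longrightarrow> \<bar>f (Phi x \<theta>, t)\<bar> \<le> K"
    "\<And>x \<theta> t D. t \<in> {s..t1} \<Longrightarrow> ((\<lambda>x. f (Phi x \<theta>, t)) has_real_derivative D) (at x) \<Longrightarrow> \<bar>D\<bar> \<le> K / cosh x"
proof -
  define C where "C = S2 \<times> {s..t1}"
  have C: "compact C" "C \<subseteq> W" using sub_W t1 by (auto simp: C_def intro!: compact_Times)
  have bd: "\<exists>M>0. \<forall>z\<in>C. \<bar>g z\<bar> \<le> M" if "continuous_on W g" for g :: "(real^3) \<times> real \<Rightarrow> real"
  proof -
    have "bounded (g ` C)"
      using C that by (intro compact_imp_bounded compact_continuous_image) (auto intro: continuous_on_subset)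
    then show ?thesis unfolding bounded_pos by auto
  qed
  have diff: "(f has_derivative frechet_derivative f (at z)) (at z)" if "z \<in> W" for z
    using f that by (auto simp: frechet_derivative_works)
  have fc: "continuous_on W f" by (rule Ck_on_continuous_on[OF f])
  have f1: "continuous_on W (\<lambda>z. frechet_derivative f (at z) e)" for e
    using f unfolding One_nat_def Ck_on.simps by blast
  obtain M0 where M0: "M0 > 0" "\<forall>z\<in>C. \<bar>f z\<bar> \<le> M0" using bd[OF fc] by blast
  obtain M1 where M1: "M1 > 0" "\<forall>z\<in>C. \<bar>frechet_derivative f (at z) (axis 1 1, 0)\<bar> \<le> M1" using bd[OF f1] by blast
  obtain M2 where M2: "M2 > 0" "\<forall>z\<in>C. \<bar>frechet_derivative f (at z) (axis 2 1, 0)\<bar> \<le> M2" using bd[OF f1] by blast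
  obtain M3 where M3: "M3 > 0" "\<forall>z\<in>C. \<bar>frechet_derivative f (at z) (axis 3 1, 0)\<bar> \<le> M3" using bd[OF f1] by blast
  show thesis
  proof (rule that[of "M0 + M1 + M2 + M3"])
    show "M0 + M1 + M2 + M3 > 0" using M0 M1 M2 M3 by simp
    fix x \<theta> t assume t: "t \<in> {s..t1}"
    then have zC: "(Phi x \<theta>, t) \<in> C" using Phi_in_S2 by (auto simp: C_def)
    then show "\<bar>f (Phi x \<theta>, t)\<bar> \<le> M0 + M1 + M2 + M3" using M0 M1 M2 M3 by force
    fix D assume D: "((\<lambda>x. f (Phi x \<theta>, t)) has_real_derivative D) (at x)"
    define L where "L = frechet_derivative f (at (Phi x \<theta>, t))"
    have lin: "linear L"
      unfolding L_def using f zC C by (auto intro: linear_frechet_derivative)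
    define a1 a2 a3 where "a1 = - cos \<theta> * tanh x / cosh x" and "a2 = - sin \<theta> * tanh x / cosh x"
      and "a3 = 1 / (cosh x)\<^sup>2"
    define v where "v = a1 *\<^sub>R axis 1 1 + a2 *\<^sub>R axis 2 1 + a3 *\<^sub>R (axis 3 1 :: real^3)"
    have Phi_sum: "(\<lambda>x. Phi x \<theta>) = (\<lambda>x. (cos \<theta> / cosh x) *\<^sub>R axis 1 1 + (sin \<theta> / cosh x) *\<^sub>R axis 2 1 + tanh x *\<^sub>R axis 3 1)"
      by (auto simp: vec_eq_iff forall_3 Phi_component axis_def)
    have "((\<lambda>x. Phi x \<theta>) has_vector_derivative v) (at x)"
      unfolding Phi_sum v_def a1_def a2_def a3_def one_minus_tanh_square[symmetric]
      by (rule derivative_eq_intros refl | simp)+ (simp add: tanh_def power2_eq_square)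
    then have "((\<lambda>x. (Phi x \<theta>, t)) has_derivative (\<lambda>h. (h *\<^sub>R v, 0))) (at x)"
      unfolding has_vector_derivative_def by (intro has_derivative_Pair) auto
    then have "((\<lambda>x. f (Phi x \<theta>, t)) has_derivative (\<lambda>h. L (h *\<^sub>R v, 0))) (at x)"
      using has_derivative_compose[OF _ diff] zC C unfolding L_def by blast
    moreover have "L (h *\<^sub>R v, 0) = L (v, 0) * h" for h
    proof -
      have "(h *\<^sub>R v, 0) = h *\<^sub>R (v, 0 :: real)" by simp
      then show ?thesis using linear_cmul[OF lin, of h "(v, 0)"] by simp
    qed
    ultimately have "((\<lambda>x. f (Phi x \<theta>, t)) has_real_derivative L (v, 0)) (at x)"
      by (simp add: has_field_derivative_def)
    then have "D = L (v, 0)" using D DERIV_unique by blast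
    also have "(v, 0 :: real) = a1 *\<^sub>R (axis 1 1, 0) + a2 *\<^sub>R (axis 2 1, 0) + a3 *\<^sub>R (axis 3 1, 0)"
      by (simp add: v_def)
    also have "L \<dots> = a1 * L (axis 1 1, 0) + a2 * L (axis 2 1, 0) + a3 * L (axis 3 1, 0)"
      by (simp only: linear_add[OF lin] linear_cmul[OF lin] real_scaleR_def)
    finally have De: "D = a1 * L (axis 1 1, 0) + a2 * L (axis 2 1, 0) + a3 * L (axis 3 1, 0)" .
    have th: "\<bar>tanh x\<bar> \<le> 1" using tanh_real_bounds[of x] by (auto simp: abs_le_iff)
    have a: "\<bar>a1\<bar> \<le> 1 / cosh x" "\<bar>a2\<bar> \<le> 1 / cosh x" "\<bar>a3\<bar> \<le> 1 / cosh x"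
    proof -
      have "\<bar>cos \<theta> * tanh x\<bar> \<le> 1 * 1" "\<bar>sin \<theta> * tanh x\<bar> \<le> 1 * 1"
        unfolding abs_mult using th by (intro mult_mono; simp)+
      then show "\<bar>a1\<bar> \<le> 1 / cosh x" "\<bar>a2\<bar> \<le> 1 / cosh x"
        by (simp_all add: a1_def a2_def divide_right_mono)
      have "cosh x \<le> (cosh x)\<^sup>2" using cosh_real_ge_1[of x] by (simp add: power2_eq_square)
      then show "\<bar>a3\<bar> \<le> 1 / cosh x" by (simp add: a3_def frac_le)
    qed
    have "\<bar>a1 * L (axis 1 1, 0)\<bar> \<le> 1 / cosh x * M1" "\<bar>a2 * L (axis 2 1, 0)\<bar> \<le> 1 / cosh x * M2"
      "\<bar>a3 * L (axis 3 1, 0)\<bar> \<le> 1 / cosh x * M3"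
      unfolding abs_mult L_def using a M1 M2 M3 zC by (intro mult_mono; force)+
    moreover have "0 \<le> 1 / cosh x * M0" using M0 by simp
    ultimately have "\<bar>D\<bar> \<le> 1 / cosh x * M0 + 1 / cosh x * M1 + 1 / cosh x * M2 + 1 / cosh x * M3"
      unfolding De by linarith
    then show "\<bar>D\<bar> \<le> (M0 + M1 + M2 + M3) / cosh x" by (simp add: add_divide_distrib)
  qed
qed

lemma U_bounds:
  assumes t1: "t1 < 0"
  obtains K where "K > 0" "\<And>x \<theta> t. t \<in> {s..t1} \<Longrightarrow> U x \<theta> t \<le> K" "\<And>x \<theta> t. t \<in> {s..t1} \<Longrightarrow> 1 \<le> K * U x \<theta> t"
    "\<And>x \<theta> t D. t \<in> {s..t1} \<Longrightarrow> ((\<lambda>x. U x \<theta> t) has_real_derivative D) (at x) \<Longrightarrow> \<bar>D\<bar> \<le> K / cosh x"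
proof -
  obtain K where K: "K > 0" "\<And>x \<theta> t. t \<in> {s..t1} \<Longrightarrow> \<bar>U x \<theta> t\<bar> \<le> K"
    "\<And>x \<theta> t D. t \<in> {s..t1} \<Longrightarrow> ((\<lambda>x. U x \<theta> t) has_real_derivative D) (at x) \<Longrightarrow> \<bar>D\<bar> \<le> K / cosh x"
    using x_derivative_bound[OF smooth t1, of s] unfolding U_def by (auto simp: One_nat_def)
  obtain M where M: "M > 0" "\<And>x \<theta> t. t \<in> {s..t1} \<Longrightarrow> 1 \<le> M * U x \<theta> t"
  proof (cases "s \<le> t1")
    case True
    have cont: "continuous_on (S2 \<times> {s..t1}) (\<lambda>(p, t). F p t)"
      by (rule continuous_on_subset[OF Ck_on_continuous_on[OF smooth[of 0]]]) (use sub_W t1 in auto)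
    have "compact (S2 \<times> {s..t1})" by (intro compact_Times) auto
    moreover have "(Phi 0 0, s) \<in> S2 \<times> {s..t1}" using Phi_in_S2 True by auto
    ultimately obtain z where z: "z \<in> S2 \<times> {s..t1}"
       "\<And>y. y \<in> S2 \<times> {s..t1} \<Longrightarrow> (case z of (p, t) \<Rightarrow> F p t) \<le> (case y of (p, t) \<Rightarrow> F p t)"
      using continuous_attains_inf[OF _ _ cont] by (metis (no_types, lifting) emptyE)
    define c where "c = (case z of (p, t) \<Rightarrow> F p t)"
    have c: "c > 0" using z(1) u_pos F_eq t1 by (auto simp: c_def)
    show thesis
    proof (rule that[of "1 / c"])
      fix x \<theta> t assume "t \<in> {s..t1}"
      then have "c \<le> U x \<theta> t" using z(2)[of "(Phi x \<theta>, t)"] Phi_in_S2 by (auto simp: c_def U_def)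
      then show "1 \<le> 1 / c * U x \<theta> t" using c by (simp add: field_simps)
    qed (use c in simp)
  next
    case False
    then show thesis using that[of 1] by auto
  qed
  show thesis
  proof (rule that[of "max K M"])
    show "max K M > 0" using K by simp
    fix x \<theta> t assume t: "t \<in> {s..t1}"
    show "U x \<theta> t \<le> max K M" using K(2)[OF t, of x \<theta>] by simp
    have "U x \<theta> t > 0" using U_pos t t1 by simp
    then have "M * U x \<theta> t \<le> max K M * U x \<theta> t" by (intro mult_right_mono) auto
    then show "1 \<le> max K M * U x \<theta> t" using M(2)[OF t, of x \<theta>] by linarith
    fix D assume "((\<lambda>x. U x \<theta> t) has_real_derivative D) (at x)"
    then have "\<bar>D\<bar> \<le> K / cosh x" by (rule K(3)[OF t])
    also have "\<dots> \<le> max K M / cosh x" by (intro divide_right_mono) auto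
    finally show "\<bar>D\<bar> \<le> max K M / cosh x" .
  qed
qed

end

section \<open>The flow as logarithmic diffusion on the cylinder\<close>

lemma mercator_deriv:
  assumes "\<bar>p\<bar> < pi/2"
  shows "(mercator has_real_derivative 1 / cos p) (at p)"
proof -
  have c: "cos p > 0" using assms by (intro cos_gt_zero_pi) auto
  have s: "sqrt ((tan p)\<^sup>2 + 1) = 1 / cos p"
    using tan_sec[of p] c by (intro real_sqrt_unique) (auto simp: add.commute inverse_eq_divide power_one_over)
  have "((\<lambda>p. arsinh (tan p)) has_real_derivative (1 / sqrt ((tan p)\<^sup>2 + 1)) * inverse ((cos p)\<^sup>2)) (at p)"
    using c by (intro DERIV_chain2[OF arsinh_real_has_field_derivative DERIV_tan]) auto
  moreover have "(1 / sqrt ((tan p)\<^sup>2 + 1)) * inverse ((cos p)\<^sup>2) = 1 / cos p"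
    unfolding s using c by (simp add: field_simps power2_eq_square)
  ultimately show ?thesis unfolding mercator_def[abs_def] by simp
qed

lemma sph_mercator: "\<bar>p\<bar> < pi/2 \<Longrightarrow> sph p \<theta> = Phi (mercator p) \<theta>"
  using sph_inv_mercator[of "mercator p" \<theta>] inv_mercator_mercator[of p] by simp

context sphere_flow
begin

text \<open>Here ln U is used, not the logarithm of the conformal factor on the cylinder: it is
  bounded on compact time intervals and its x-derivative decays at the poles. The two differ by 2 ln
  (cosh x), which cancels in differences of logarithms.\<close>

definition "lx t z = deriv (\<lambda>x. ln (U x (snd z) t)) (fst z)"
definition "lxx t z = deriv (\<lambda>x. lx t (x, snd z)) (fst z)"
definition "ly t z = deriv (\<lambda>y. ln (U (fst z) y t)) (snd z)"
definition "lyy t z = deriv (\<lambda>y. ly t (fst z, y)) (snd z)"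

lemma cx_ln_U:
  "cx k (UNIV \<times> {..<0}) (\<lambda>x p. ln (U x (fst p) (snd p)))"
  "cx k (UNIV \<times> {..<0}) (\<lambda>\<theta> p. ln (U (fst p) \<theta> (snd p)))"
proof -
  have c: "cx k (UNIV \<times> {..<0}) (\<lambda>x p. U x (fst p) (snd p))" "cx k (UNIV \<times> {..<0}) (\<lambda>\<theta> p. U (fst p) \<theta> (snd p))"
    using cx_Phi[OF smooth[of k]] unfolding U_def split_conv .
  show "cx k (UNIV \<times> {..<0}) (\<lambda>x p. ln (U x (fst p) (snd p)))"
    by (rule cx_ln[OF _ c(1)]) (simp add: U_pos mem_Times_iff)
  show "cx k (UNIV \<times> {..<0}) (\<lambda>\<theta> p. ln (U (fst p) \<theta> (snd p)))"
    by (rule cx_ln[OF _ c(2)]) (simp add: U_pos mem_Times_iff)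
qed

lemma log_derivs_x:
  assumes t: "t < 0"
  shows "((\<lambda>x. ln (U x y t)) has_real_derivative lx t (x, y)) (at x)"
    and "((\<lambda>x. lx t (x, y)) has_real_derivative lxx t (x, y)) (at x)"
    and "continuous_on ({..<0} \<times> UNIV) (\<lambda>(t,z). lxx t z)"
    and "continuous_on ({..<0} \<times> UNIV) (\<lambda>(t,z). ln (U (fst z) (snd z) t))"
proof -
  obtain g1 where g1: "\<And>x p. p \<in> UNIV \<times> {..<0} \<Longrightarrow> ((\<lambda>x. ln (U x (fst p) (snd p))) has_real_derivative g1 x p) (at x)"
      "cx (Suc 0) (UNIV \<times> {..<0}) g1"
    by (rule cx_SucE[OF cx_ln_U(1)[of "Suc (Suc 0)"]]) blast
  obtain g2 where g2: "\<And>x p. p \<in> UNIV \<times> {..<0} \<Longrightarrow> ((\<lambda>x. g1 x p) has_real_derivative g2 x p) (at x)"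
      "cx 0 (UNIV \<times> {..<0}) g2"
    by (rule cx_SucE[OF g1(2)]) blast
  have l1: "lx t (x, y) = g1 x (y, t)" if "t < 0" for x y t
    unfolding lx_def using g1(1)[of "(y, t)" x] that by (auto intro!: DERIV_imp_deriv)
  have l2: "lxx t (x, y) = g2 x (y, t)" if "t < 0" for x y t
    unfolding lxx_def using g2(1)[of "(y, t)" x] l1[OF that] that by (auto intro!: DERIV_imp_deriv)
  show "((\<lambda>x. ln (U x y t)) has_real_derivative lx t (x, y)) (at x)"
    using g1(1)[of "(y, t)" x] t l1 by simp
  show "((\<lambda>x. lx t (x, y)) has_real_derivative lxx t (x, y)) (at x)"
    using g2(1)[of "(y, t)" x] t l1 l2 by simp
  have "continuous_on ({..<0} \<times> UNIV) (\<lambda>z. case (fst (snd z), (snd (snd z), fst z)) of (x, p) \<Rightarrow> g2 x p)"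
    by (rule continuous_on_compose2[OF cx_continuous_on[OF g2(2)]]) (auto intro!: continuous_intros)
  then show "continuous_on ({..<0} \<times> UNIV) (\<lambda>(t,z). lxx t z)"
    by (rule continuous_on_eq) (auto simp: l2)
  have "continuous_on ({..<0} \<times> UNIV) (\<lambda>z. case (fst (snd z), (snd (snd z), fst z)) of (x, p) \<Rightarrow> ln (U x (fst p) (snd p)))"
    by (rule continuous_on_compose2[OF cx_continuous_on[OF cx_ln_U(1)[of 0]]]) (auto intro!: continuous_intros)
  then show "continuous_on ({..<0} \<times> UNIV) (\<lambda>(t,z). ln (U (fst z) (snd z) t))"
    by (simp add: split_beta)
qed

lemma log_derivs_y:
  assumes t: "t < 0"
  shows "((\<lambda>y. ln (U x y t)) has_real_derivative ly t (x, y)) (at y)"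
    and "((\<lambda>y. ly t (x, y)) has_real_derivative lyy t (x, y)) (at y)"
    and "continuous_on ({..<0} \<times> UNIV) (\<lambda>(t,z). lyy t z)"
proof -
  obtain g1 where g1: "\<And>y p. p \<in> UNIV \<times> {..<0} \<Longrightarrow> ((\<lambda>y. ln (U (fst p) y (snd p))) has_real_derivative g1 y p) (at y)"
      "cx (Suc 0) (UNIV \<times> {..<0}) g1"
    by (rule cx_SucE[OF cx_ln_U(2)[of "Suc (Suc 0)"]]) blast
  obtain g2 where g2: "\<And>y p. p \<in> UNIV \<times> {..<0} \<Longrightarrow> ((\<lambda>y. g1 y p) has_real_derivative g2 y p) (at y)"
      "cx 0 (UNIV \<times> {..<0}) g2"
    by (rule cx_SucE[OF g1(2)]) blast
  have l1: "ly t (x, y) = g1 y (x, t)" if "t < 0" for x y t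
    unfolding ly_def using g1(1)[of "(x, t)" y] that by (auto intro!: DERIV_imp_deriv)
  have l2: "lyy t (x, y) = g2 y (x, t)" if "t < 0" for x y t
    unfolding lyy_def using g2(1)[of "(x, t)" y] l1[OF that] that by (auto intro!: DERIV_imp_deriv)
  show "((\<lambda>y. ln (U x y t)) has_real_derivative ly t (x, y)) (at y)"
    using g1(1)[of "(x, t)" y] t l1 by simp
  show "((\<lambda>y. ly t (x, y)) has_real_derivative lyy t (x, y)) (at y)"
    using g2(1)[of "(x, t)" y] t l1 l2 by simp
  have "continuous_on ({..<0} \<times> UNIV) (\<lambda>z. case (snd (snd z), (fst (snd z), fst z)) of (y, p) \<Rightarrow> g2 y p)"
    by (rule continuous_on_compose2[OF cx_continuous_on[OF g2(2)]]) (auto intro!: continuous_intros)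
  then show "continuous_on ({..<0} \<times> UNIV) (\<lambda>(t,z). lyy t z)"
    by (rule continuous_on_eq) (auto simp: l2)
qed

text \<open>Mercator's projection is conformal, so the spherical Laplacian becomes (cosh x)^2 times
  the flat one. The first order term with tan \<psi> cancels against the derivative of 1 / cos
  \<psi> from the chain rule.\<close>

lemma U_evolution:
  assumes t: "t < 0"
  shows "((\<lambda>t. U x y t) has_real_derivative (cosh x)\<^sup>2 * (lxx t (x, y) + lyy t (x, y)) - 2) (at t)"
proof -
  define \<psi> where "\<psi> = inv_mercator x"
  have \<psi>: "\<bar>\<psi>\<bar> < pi/2" unfolding \<psi>_def by (rule inv_mercator_bounds)
  have mx: "mercator \<psi> = x" by (simp add: \<psi>_def mercator_inv_mercator)
  have cpos: "cos p > 0" if "\<bar>p\<bar> < pi/2" for p using that by (intro cos_gt_zero_pi) auto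
  define f where "f p = ln (u (sph p y) t)" for p
  have feq: "ln (U (mercator p) y t) = f p" if "\<bar>p\<bar> < pi/2" for p
    using that by (simp add: f_def U_eq[OF t] sph_mercator)
  have op: "open {- (pi/2)<..<pi/2 :: real}" by simp
  have df: "(f has_real_derivative lx t (mercator p, y) * (1 / cos p)) (at p)" if p: "\<bar>p\<bar> < pi/2" for p
    by (rule has_field_derivative_transform_within_open[OF DERIV_chain2[OF log_derivs_x(1)[OF t] mercator_deriv[OF p]] op])
       (use p feq in \<open>auto simp: abs_less_iff\<close>)
  have dfe: "lx t (mercator p, y) * (1 / cos p) = deriv f p" if "\<bar>p\<bar> < pi/2" for p
    using DERIV_imp_deriv[OF df[OF that]] by simp
  have c: "cos \<psi> > 0" by (rule cpos[OF \<psi>])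
  have "((\<lambda>p. 1 / cos p) has_real_derivative sin \<psi> / (cos \<psi>)\<^sup>2) (at \<psi>)"
    using c by (auto intro!: derivative_eq_intros simp: power2_eq_square)
  then have "((\<lambda>p. lx t (mercator p, y) * (1 / cos p)) has_real_derivative
      lxx t (mercator \<psi>, y) * (1 / cos \<psi>) * (1 / cos \<psi>) + sin \<psi> / (cos \<psi>)\<^sup>2 * lx t (mercator \<psi>, y)) (at \<psi>)"
    by (intro DERIV_mult DERIV_chain2[OF log_derivs_x(2)[OF t] mercator_deriv[OF \<psi>]])
  then have "(deriv f has_real_derivative
      lxx t (mercator \<psi>, y) * (1 / cos \<psi>) * (1 / cos \<psi>) + sin \<psi> / (cos \<psi>)\<^sup>2 * lx t (mercator \<psi>, y)) (at \<psi>)"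
    by (rule has_field_derivative_transform_within_open[OF _ op]) (use \<psi> dfe in \<open>auto simp: abs_less_iff\<close>)
  then have d2: "deriv (deriv f) \<psi> = lxx t (x, y) / (cos \<psi>)\<^sup>2 + sin \<psi> / (cos \<psi>)\<^sup>2 * lx t (x, y)"
    using DERIV_imp_deriv by (force simp: mx power2_eq_square)
  have d1: "deriv f \<psi> = lx t (x, y) / cos \<psi>" using dfe[OF \<psi>] by (simp add: mx)
  have "(\<lambda>q. ln (u (sph \<psi> q) t)) = (\<lambda>q. ln (U x q t))"
    by (simp add: \<psi>_def sph_inv_mercator U_eq[OF t])
  then have dy: "deriv (deriv (\<lambda>q. ln (u (sph \<psi> q) t))) y = lyy t (x, y)"
    by (simp add: lyy_def ly_def)
  have "laplacian_S2 (\<lambda>p. ln (u p t)) \<psi> y = deriv (deriv f) \<psi> - tan \<psi> * deriv f \<psi> + (1 / cos \<psi>)\<^sup>2 * lyy t (x, y)"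
    unfolding laplacian_S2_def dy f_def[abs_def] ..
  also have "\<dots> = (lxx t (x, y) + lyy t (x, y)) / (cos \<psi>)\<^sup>2"
    unfolding d1 d2 using c by (simp add: tan_def field_simps power2_eq_square)
  also have "\<dots> = (cosh x)\<^sup>2 * (lxx t (x, y) + lyy t (x, y))"
    by (simp add: \<psi>_def cos_inv_mercator power_one_over)
  finally have L: "laplacian_S2 (\<lambda>p. ln (u p t)) \<psi> y = (cosh x)\<^sup>2 * (lxx t (x, y) + lyy t (x, y))" .
  have "((\<lambda>s. u (sph \<psi> y) s) has_real_derivative (cosh x)\<^sup>2 * (lxx t (x, y) + lyy t (x, y)) - 2) (at t)"
    using u_eq t \<psi> unfolding log_diffusion_S2_def L[symmetric] by blast
  then show ?thesis
    by (rule has_field_derivative_transform_within_open[where S="{..<0}"])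
       (use t in \<open>auto simp: \<psi>_def sph_inv_mercator U_eq\<close>)
qed

text \<open>The conformal factor with respect to the flat cylinder. The term 2 / (cosh x)^2 in its
  evolution is the second derivative of 2 ln (cosh x), so uh_t is the flat Laplacian of ln
  uh.\<close>

definition uh :: "real \<Rightarrow> real \<times> real \<Rightarrow> real" where
  "uh t z = U (fst z) (snd z) t / (cosh (fst z))\<^sup>2"

lemma uh_pos: "t < 0 \<Longrightarrow> uh t z > 0"
  by (simp add: uh_def U_pos)

lemma uh_evolution:
  "t < 0 \<Longrightarrow> ((\<lambda>t. uh t z) has_real_derivative lxx t z + lyy t z - 2 / (cosh (fst z))\<^sup>2) (at t)"
  using DERIV_cdivide[OF U_evolution[of t "fst z" "snd z"], of "(cosh (fst z))\<^sup>2"]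
  by (simp add: uh_def diff_divide_distrib)

lemma uh_continuous_on: "continuous_on ({..<0} \<times> UNIV) (\<lambda>(t,z). uh t z)"
proof -
  have "continuous_on ({..<0} \<times> UNIV) (\<lambda>z. exp (case z of (t, z) \<Rightarrow> ln (U (fst z) (snd z) t)) / (cosh (fst (snd z)))\<^sup>2)"
    by (intro continuous_intros log_derivs_x(4)[of "-1"]) auto
  then show ?thesis by (rule continuous_on_eq) (auto simp: uh_def U_pos)
qed

lemma lx_bound:
  assumes t1: "t1 < 0"
  obtains K where "K > 0" "\<And>t x y. t \<in> {s..t1} \<Longrightarrow> \<bar>lx t (x, y)\<bar> \<le> K / cosh x"
proof -
  obtain K where K: "K > 0" "\<And>x \<theta> t. t \<in> {s..t1} \<Longrightarrow> 1 \<le> K * U x \<theta> t"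
    "\<And>x \<theta> t D. t \<in> {s..t1} \<Longrightarrow> ((\<lambda>x. U x \<theta> t) has_real_derivative D) (at x) \<Longrightarrow> \<bar>D\<bar> \<le> K / cosh x"
    using U_bounds[OF t1, of s] by metis
  have "\<bar>lx t (x, y)\<bar> \<le> K\<^sup>2 / cosh x" if t: "t \<in> {s..t1}" for t x y
  proof -
    have t0: "t < 0" using t t1 by simp
    have "((\<lambda>x. exp (ln (U x y t))) has_real_derivative exp (ln (U x y t)) * lx t (x, y)) (at x)"
      by (rule DERIV_chain2[OF DERIV_exp log_derivs_x(1)[OF t0]])
    then have "((\<lambda>x. U x y t) has_real_derivative U x y t * lx t (x, y)) (at x)"
      by (simp add: U_pos[OF t0])
    from K(3)[OF t this] have 1: "U x y t * \<bar>lx t (x, y)\<bar> \<le> K / cosh x"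
      using U_pos[OF t0, of x y] by (simp add: abs_mult)
    have "\<bar>lx t (x, y)\<bar> * 1 \<le> \<bar>lx t (x, y)\<bar> * (K * U x y t)"
      using K(2)[OF t] by (intro mult_left_mono) auto
    also have "\<dots> = K * (U x y t * \<bar>lx t (x, y)\<bar>)" by (simp add: mult_ac)
    also have "\<dots> \<le> K * (K / cosh x)" using 1 K(1) by (intro mult_left_mono) auto
    finally show ?thesis by (simp add: power2_eq_square)
  qed
  then show thesis using K(1) that[of "K\<^sup>2"] by simp
qed

lemma U_periodic: "U x (y + 2 * pi) t = U x y t"
  by (simp add: U_def Phi_periodic)

lemma ly_periodic: "ly t (x, y + 2 * pi) = ly t (x, y)" if "t < 0"
proof -
  have "((\<lambda>y. y + 2 * pi) has_real_derivative 1) (at y)" by (auto intro!: derivative_eq_intros)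
  from DERIV_chain2[OF log_derivs_y(1)[OF that, of x] this]
  have "((\<lambda>y. ln (U x y t)) has_real_derivative ly t (x, y + 2 * pi)) (at y)"
    by (simp only: U_periodic mult_1_right)
  from DERIV_unique[OF this log_derivs_y(1)[OF that]] show ?thesis .
qed

text \<open>
  \<open>\<mu> * uh (s + (t - s) / \<mu>)\<close> is again a solution; the parameter \<open>\<beta>\<close> is a rotation.
\<close>

lemma contraction:
  assumes st: "s < t1" "t1 < 0" and \<mu>: "\<mu> \<ge> 1"
  shows "\<exists>K. \<forall>X\<ge>0.
     integral (cbox (-X, 0) (X, 2 * pi)) (\<lambda>z. max 0 (uh t1 z - \<mu> * uh (s + (t1 - s) / \<mu>) (fst z, snd z + \<beta>)))
     \<le> integral (cbox (-X, 0) (X, 2 * pi)) (\<lambda>z. max 0 (uh s z - \<mu> * uh s (fst z, snd z + \<beta>))) + K / cosh X"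
proof -
  obtain K0 where K0: "K0 > 0" "\<And>t x y. t \<in> {s..t1} \<Longrightarrow> \<bar>lx t (x, y)\<bar> \<le> K0 / cosh x"
    using lx_bound[OF st(2), of s] by metis
  define \<sigma> where "\<sigma> t = s + (t - s) / \<mu>" for t
  have \<sigma>: "\<sigma> t \<in> {s..t1}" if "t \<in> {s..t1}" for t
  proof -
    have "(t - s) / \<mu> \<le> (t - s) / 1" "0 \<le> (t - s) / \<mu>"
      using that \<mu> by (intro divide_left_mono divide_nonneg_nonneg; simp)+
    then show ?thesis using that unfolding \<sigma>_def by simp
  qed
  define r where "r z = (fst z, snd z + \<beta>)" for z :: "real \<times> real"
  have neg: "t < 0" if "t \<in> {s..t1}" for t using that st by simp
  have c\<sigma>: "continuous_on S \<sigma>" for S unfolding \<sigma>_def using \<mu> by (intro continuous_intros) auto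
  have comp: "continuous_on ({s..t1} \<times> UNIV) (\<lambda>(t,z). f (\<sigma> t) (r z))"
     "continuous_on ({s..t1} \<times> UNIV) (\<lambda>(t,z). f t z)"
    if "continuous_on ({..<0} \<times> UNIV) (\<lambda>(t,z). f t z)" for f :: "real \<Rightarrow> real \<times> real \<Rightarrow> real"
  proof -
    have "continuous_on ({s..t1} \<times> UNIV) (\<lambda>w. case (\<sigma> (fst w), r (snd w)) of (t, z) \<Rightarrow> f t z)"
      by (rule continuous_on_compose2[OF that])
         (use \<sigma> neg in \<open>auto intro!: continuous_intros continuous_on_compose2[OF c\<sigma>[of UNIV]] simp: r_def\<close>)
    then show "continuous_on ({s..t1} \<times> UNIV) (\<lambda>(t,z). f (\<sigma> t) (r z))" by (simp add: split_beta)
    show "continuous_on ({s..t1} \<times> UNIV) (\<lambda>(t,z). f t z)"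
      by (rule continuous_on_subset[OF that]) (use neg in auto)
  qed
  note cu = comp[OF uh_continuous_on, unfolded split_beta]
  note cl = comp[OF log_derivs_x(4)[of "-1", simplified], unfolded split_beta r_def fst_conv snd_conv]
  note cxx = comp[OF log_derivs_x(3)[of "-1", simplified], unfolded split_beta]
  note cyy = comp[OF log_derivs_y(3)[of "-1", simplified], unfolded split_beta]
  define d where "d t z = uh t z - \<mu> * uh (\<sigma> t) (r z)" for t z
  \<comment> \<open>This is the logarithm of \<open>uh t z\<close> minus that of
    \<open>\<mu> * uh (\<sigma> t) (r z)\<close>, written so that every summand has an x-derivative
    of order 1 / cosh x.\<close>
  define m where "m t z = ln (U (fst z) (snd z) t) - ln (U (fst z) (snd z + \<beta>) (\<sigma> t)) - ln \<mu>" for t z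
  have main: "integral (cbox (-X, 0) (X, 2 * pi)) (\<lambda>z. max 0 (d t1 z)) \<le>
     integral (cbox (-X, 0) (X, 2 * pi)) (\<lambda>z. max 0 (d s z)) + (t1 - s) * (4 * pi * (2 * K0) / cosh X)"
    if X: "X \<ge> 0" for X
  proof (rule L1_contraction[OF st(1) X, where m=m
      and mx="\<lambda>t z. lx t z - lx (\<sigma> t) (r z)" and mxx="\<lambda>t z. lxx t z - lxx (\<sigma> t) (r z)"
      and my="\<lambda>t z. ly t z - ly (\<sigma> t) (r z)" and myy="\<lambda>t z. lyy t z - lyy (\<sigma> t) (r z)"])
    show "continuous_on ({s..t1} \<times> UNIV) (\<lambda>(t, z). d t z)"
      unfolding d_def split_beta by (intro continuous_intros cu)
    show "continuous_on ({s..t1} \<times> UNIV) (\<lambda>(t, z). m t z)"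
      unfolding m_def split_beta by (intro continuous_on_diff continuous_on_const cl)
    show "continuous_on ({s..t1} \<times> UNIV) (\<lambda>(t, z). lxx t z - lxx (\<sigma> t) (r z))"
      unfolding split_beta by (intro continuous_intros cxx)
    show "continuous_on ({s..t1} \<times> UNIV) (\<lambda>(t, z). lyy t z - lyy (\<sigma> t) (r z))"
      unfolding split_beta by (intro continuous_intros cyy)
  next
    fix t z assume t: "t \<in> {s..t1}"
    note t0 = neg[OF t] and st0 = neg[OF \<sigma>[OF t]]
    have "(\<sigma> has_real_derivative 1 / \<mu>) (at t)"
      unfolding \<sigma>_def using \<mu> by (auto intro!: derivative_eq_intros)
    from DERIV_cmult[OF DERIV_chain2[OF uh_evolution[OF st0, of "r z"] this], of \<mu>]
    have "((\<lambda>t. \<mu> * uh (\<sigma> t) (r z)) has_real_derivative lxx (\<sigma> t) (r z) + lyy (\<sigma> t) (r z) - 2 / (cosh (fst z))\<^sup>2) (at t)"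
      using \<mu> by (simp add: r_def)
    from DERIV_diff[OF uh_evolution[OF t0, of z] this]
    show "((\<lambda>t. d t z) has_real_derivative (lxx t z - lxx (\<sigma> t) (r z)) + (lyy t z - lyy (\<sigma> t) (r z))) (at t)"
      by (simp add: d_def algebra_simps)
    have p: "uh t z > 0" "\<mu> * uh (\<sigma> t) (r z) > 0" using uh_pos[OF t0] uh_pos[OF st0] \<mu> by auto
    have "m t z = ln (uh t z) - ln (\<mu> * uh (\<sigma> t) (r z))"
      using \<mu> U_pos[OF t0, of "fst z" "snd z"] U_pos[OF st0, of "fst z" "snd z + \<beta>"]
      by (simp add: m_def uh_def r_def ln_mult_pos ln_div)
    then show "sgn (d t z) = sgn (m t z)"
      using p unfolding d_def sgn_if by (auto simp: ln_less_cancel_iff)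
  next
    fix t x y assume t: "t \<in> {s..t1}"
    note t0 = neg[OF t] and st0 = neg[OF \<sigma>[OF t]]
    have y\<beta>: "((\<lambda>y. y + \<beta>) has_real_derivative 1) (at y)" by (auto intro!: derivative_eq_intros)
    show "((\<lambda>x. m t (x, y)) has_real_derivative lx t (x, y) - lx (\<sigma> t) (r (x, y))) (at x)"
      unfolding m_def r_def fst_conv snd_conv
      using DERIV_diff[OF DERIV_diff[OF log_derivs_x(1)[OF t0, of y x] log_derivs_x(1)[OF st0, of "y + \<beta>" x]] DERIV_const] by simp
    show "((\<lambda>x. lx t (x, y) - lx (\<sigma> t) (r (x, y))) has_real_derivative lxx t (x, y) - lxx (\<sigma> t) (r (x, y))) (at x)"
      unfolding r_def fst_conv snd_conv by (intro DERIV_diff log_derivs_x t0 st0)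
    show "((\<lambda>y. m t (x, y)) has_real_derivative ly t (x, y) - ly (\<sigma> t) (r (x, y))) (at y)"
      unfolding m_def r_def fst_conv snd_conv
      using DERIV_diff[OF DERIV_diff[OF log_derivs_y(1)[OF t0, of x y] DERIV_chain2[OF log_derivs_y(1)[OF st0, of x] y\<beta>]] DERIV_const] by simp
    show "((\<lambda>y. ly t (x, y) - ly (\<sigma> t) (r (x, y))) has_real_derivative lyy t (x, y) - lyy (\<sigma> t) (r (x, y))) (at y)"
      unfolding r_def fst_conv snd_conv
      using DERIV_diff[OF log_derivs_y(2)[OF t0, of x y] DERIV_chain2[OF log_derivs_y(2)[OF st0, of x] y\<beta>]] by simp
    show "\<bar>lx t (x, y) - lx (\<sigma> t) (r (x, y))\<bar> \<le> 2 * K0 / cosh x"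
      using K0(2)[OF t, of x y] K0(2)[OF \<sigma>[OF t], of x "y + \<beta>"] by (simp add: r_def abs_le_iff)
  next
    fix t x assume t: "t \<in> {s..t1}"
    note t0 = neg[OF t] and st0 = neg[OF \<sigma>[OF t]]
    have e: "2 * pi + \<beta> = (0 + \<beta>) + 2 * pi" by simp
    show "m t (x, 2 * pi) = m t (x, 0)"
      unfolding m_def fst_conv snd_conv e U_periodic using U_periodic[of x 0 t] by simp
    show "ly t (x, 2 * pi) - ly (\<sigma> t) (r (x, 2 * pi)) = ly t (x, 0) - ly (\<sigma> t) (r (x, 0))"
      unfolding r_def fst_conv snd_conv e ly_periodic[OF st0] using ly_periodic[OF t0, of x 0] by simp
  qed
  have s\<sigma>: "\<sigma> s = s" by (simp add: \<sigma>_def)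
  have "\<forall>X\<ge>0. integral (cbox (-X, 0) (X, 2 * pi)) (\<lambda>z. max 0 (d t1 z))
     \<le> integral (cbox (-X, 0) (X, 2 * pi)) (\<lambda>z. max 0 (d s z)) + (t1 - s) * (4 * pi * (2 * K0)) / cosh X"
    using main by simp
  then show ?thesis unfolding d_def r_def s\<sigma> unfolding \<sigma>_def by blast
qed

end

section \<open>Rotational symmetry\<close>

lemma le_of_cosh_tail:
  fixes a b K X0 :: real
  assumes "\<And>X. X \<ge> X0 \<Longrightarrow> a \<le> b + K / cosh X"
  shows "a \<le> b"
proof (rule tendsto_lowerbound)
  have "((\<lambda>X::real. K / cosh X) \<longlongrightarrow> 0) at_top"
    using cosh_real_at_top by (auto intro!: tendsto_divide_0[OF tendsto_const] filterlim_at_top_imp_at_infinity)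
  from tendsto_add[OF tendsto_const this] show "((\<lambda>X. b + K / cosh X) \<longlongrightarrow> b) at_top" by simp
  show "\<forall>\<^sub>F X in at_top. a \<le> b + K / cosh X" by (rule eventually_at_top_linorderI[OF assms])
qed simp

lemma integral_strip_mono:
  fixes f :: "real \<times> real \<Rightarrow> real"
  assumes "continuous_on UNIV f" "\<And>z. 0 \<le> f z" "X \<le> Y"
  shows "integral (cbox (-X, 0) (X, 2 * pi)) f \<le> integral (cbox (-Y, 0) (Y, 2 * pi)) f"
  by (rule integral_subset_le)
     (use assms in \<open>auto intro!: integrable_continuous intro: continuous_on_subset\<close>)

lemma zero_of_strip_integrals:
  fixes f :: "real \<times> real \<Rightarrow> real"
  assumes f: "continuous_on UNIV f" "\<And>z. 0 \<le> f z"
    and le: "\<And>X. X > 0 \<Longrightarrow> integral (cbox (-X, 0) (X, 2 * pi)) f \<le> 0" and y: "y \<in> {0..2 * pi}"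
  shows "f (x, y) = 0"
proof -
  define X where "X = \<bar>x\<bar> + 1"
  have X: "X > 0" "-X \<le> x" "x \<le> X" by (auto simp: X_def)
  let ?B = "cbox (-X, 0) (X, 2 * pi)"
  have c: "continuous_on ?B f" using f(1) by (rule continuous_on_subset) simp
  have "integral ?B f \<ge> 0" using f(2) by (intro integral_nonneg integrable_continuous c) auto
  then have "integral ?B f = 0" using le[OF X(1)] by simp
  moreover have "(0, pi) \<in> box (-X, 0) (X, 2 * pi)"
    using X by (auto simp: mem_box Basis_prod_def)
  then have "box (-X, 0) (X, 2 * pi) \<noteq> {}" by blast
  ultimately have "\<forall>z\<in>?B. f z = 0" using integral_cbox_eq_0_iff[OF c] f(2) by blast
  then show ?thesis using X y by auto
qed

text \<open>Each of the two ends contributes 2 pi C / a exp (- a X1). The remainder is independent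
  of X, so X may tend to infinity while X1 stays fixed.\<close>

lemma integral_strip_tail:
  fixes f :: "real \<times> real \<Rightarrow> real"
  assumes f: "continuous_on UNIV f" "\<And>z. 0 \<le> f z" and a: "a > 0" and C: "C \<ge> 0"
    and le: "\<And>x y. y \<in> {0..2 * pi} \<Longrightarrow> f (x, y) \<le> C * exp (- a * \<bar>x\<bar>)" and X: "0 < X1" "X1 \<le> X"
  shows "integral (cbox (-X, 0) (X, 2 * pi)) f \<le> integral (cbox (-X1, 0) (X1, 2 * pi)) f + 4 * pi * C / a * exp (- a * X1)"
proof -
  define \<phi> where "\<phi> x = integral (cbox 0 (2 * pi)) (\<lambda>y. f (x, y))" for x
  have c: "continuous_on S f" for S using f(1) by (rule continuous_on_subset) simp
  have eq: "integral (cbox (-Y, 0) (Y, 2 * pi)) f = integral {-Y..Y} \<phi>" for Y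
    unfolding \<phi>_def using integral_prod_continuous[where a="-Y" and b=Y and c=0 and d="2 * pi", OF c] by simp
  have int: "\<phi> integrable_on {b..d}" for b d
    unfolding \<phi>_def using integral_integrable_2dim[where a=b and b=d and c=0 and d="2 * pi", OF c] by simp
  have \<phi>le: "\<phi> x \<le> 2 * pi * C * exp (- a * \<bar>x\<bar>)" for x
  proof -
    have "continuous_on (cbox 0 (2 * pi)) (\<lambda>y. f (x, y))"
      by (rule continuous_on_compose2[OF c[of UNIV]]) (auto intro!: continuous_intros)
    then have "\<phi> x \<le> integral (cbox 0 (2 * pi)) (\<lambda>y. C * exp (- a * \<bar>x\<bar>))"
      unfolding \<phi>_def
    proof (rule integral_le[OF integrable_continuous integrable_const])
      fix y assume "y \<in> cbox 0 (2 * pi)"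
      then show "f (x, y) \<le> C * exp (- a * \<bar>x\<bar>)" by (intro le) simp
    qed
    then show ?thesis by (simp add: mult_ac)
  qed
  have right: "integral {X1..X} \<phi> \<le> 2 * pi * C / a * exp (- a * X1)"
  proof -
    have I: "((\<lambda>x. 2 * pi * C * exp (- a * x)) has_integral
        (- 2 * pi * C / a * exp (- a * X)) - (- 2 * pi * C / a * exp (- a * X1))) {X1..X}"
      using X a by (intro fundamental_theorem_of_calculus)
        (auto intro!: derivative_eq_intros simp: has_real_derivative_iff_has_vector_derivative[symmetric])
    have "integral {X1..X} \<phi> \<le> integral {X1..X} (\<lambda>x. 2 * pi * C * exp (- a * x))"
    proof (rule integral_le[OF int])
      fix x assume "x \<in> {X1..X}"
      then have "\<bar>x\<bar> = x" using X by auto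
      then show "\<phi> x \<le> 2 * pi * C * exp (- a * x)" using \<phi>le[of x] by simp
    qed (use I in \<open>auto simp: integrable_on_def\<close>)
    also have "\<dots> = (- 2 * pi * C / a * exp (- a * X)) - (- 2 * pi * C / a * exp (- a * X1))"
      using I by (rule integral_unique)
    also have "\<dots> \<le> 2 * pi * C / a * exp (- a * X1)" using a C by simp
    finally show ?thesis .
  qed
  have left: "integral {-X..-X1} \<phi> \<le> 2 * pi * C / a * exp (- a * X1)"
  proof -
    have I: "((\<lambda>x. 2 * pi * C * exp (a * x)) has_integral
        (2 * pi * C / a * exp (a * (-X1))) - (2 * pi * C / a * exp (a * (-X)))) {-X..-X1}"
      using X a by (intro fundamental_theorem_of_calculus)
        (auto intro!: derivative_eq_intros simp: has_real_derivative_iff_has_vector_derivative[symmetric])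
    have "integral {-X..-X1} \<phi> \<le> integral {-X..-X1} (\<lambda>x. 2 * pi * C * exp (a * x))"
    proof (rule integral_le[OF int])
      fix x assume "x \<in> {-X..-X1}"
      then have "\<bar>x\<bar> = - x" using X by auto
      then show "\<phi> x \<le> 2 * pi * C * exp (a * x)" using \<phi>le[of x] by simp
    qed (use I in \<open>auto simp: integrable_on_def\<close>)
    also have "\<dots> = 2 * pi * C / a * exp (a * (-X1)) - 2 * pi * C / a * exp (a * (-X))"
      using I by (rule integral_unique)
    also have "\<dots> \<le> 2 * pi * C / a * exp (- a * X1)" using a C by simp
    finally show ?thesis .
  qed
  have "integral {-X..X} \<phi> = integral {-X..-X1} \<phi> + integral {-X1..X} \<phi>"
    using X by (intro Henstock_Kurzweil_Integration.integral_combine[symmetric] int) auto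
  also have "integral {-X1..X} \<phi> = integral {-X1..X1} \<phi> + integral {X1..X} \<phi>"
    using X by (intro Henstock_Kurzweil_Integration.integral_combine[symmetric] int) auto
  finally have eq': "integral {-X..X} \<phi> = integral {-X..-X1} \<phi> + (integral {-X1..X1} \<phi> + integral {X1..X} \<phi>)" .
  define E where "E = 2 * pi * C / a * exp (- a * X1)"
  have "integral {-X..X} \<phi> \<le> integral {-X1..X1} \<phi> + 2 * E"
    using left right eq' unfolding E_def[symmetric] by linarith
  then show ?thesis unfolding eq by (simp add: E_def)
qed

context sphere_flow
begin

lemma uh_cont: "t < 0 \<Longrightarrow> continuous_on S (\<lambda>z. uh t (fst z, snd z + \<beta>))"
proof -
  assume t: "t < 0"
  have "continuous_on S (\<lambda>z. case (t, (fst z, snd z + \<beta>)) of (t, z) \<Rightarrow> uh t z)"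
    by (rule continuous_on_compose2[OF uh_continuous_on]) (use t in \<open>auto intro!: continuous_intros\<close>)
  then show ?thesis by simp
qed

lemma uh_cont0: "t < 0 \<Longrightarrow> continuous_on S (\<lambda>z. uh t z)"
  using uh_cont[of t S 0] by simp

text \<open>The rescaled solution \<mu> uh (s + (t - s) / \<mu>) lies above uh at time s, hence also
  later. This is the scaling argument behind the Aronson-Benilan inequality u_t <= u / (t - s),
  whose right side vanishes as s tends to minus infinity.\<close>

lemma uh_antimono:
  assumes t: "t' < t1" "t1 < 0" and y: "y \<in> {0..2 * pi}"
  shows "uh t1 (x, y) \<le> uh t' (x, y)"
proof (rule ccontr)
  assume "\<not> ?thesis"
  then have gt: "uh t1 (x, y) > uh t' (x, y)" by simp
  have t'0: "t' < 0" using t by simp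
  have p: "uh t' (x, y) > 0" by (rule uh_pos[OF t'0])
  define \<rho> where "\<rho> = uh t1 (x, y) / uh t' (x, y)"
  have \<rho>: "\<rho> > 1" using gt p by (simp add: \<rho>_def)
  \<comment> \<open>The midpoint of 1 and the assumed quotient, in place of a limit \<mu> to
    1.\<close>
  define \<mu> where "\<mu> = (\<rho> + 1) / 2"
  \<comment> \<open>The solution of s + (t1 - s) / \<mu> = t': the rescaled time that corresponds to
    t1 is exactly t'.\<close>
  define s where "s = t' - (t1 - t') / (\<mu> - 1)"
  have \<mu>: "\<mu> > 1" "\<mu> < \<rho>" using \<rho> by (auto simp: \<mu>_def)
  have s: "s < t'" using \<mu> t by (simp add: s_def)
  have "t1 - s = \<mu> * (t' - s)" using \<mu> by (simp add: s_def field_simps)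
  then have st: "s + (t1 - s) / \<mu> = t'" using \<mu> by simp
  obtain K where K: "\<forall>X\<ge>0.
     integral (cbox (-X, 0) (X, 2 * pi)) (\<lambda>z. max 0 (uh t1 z - \<mu> * uh (s + (t1 - s) / \<mu>) (fst z, snd z + 0)))
     \<le> integral (cbox (-X, 0) (X, 2 * pi)) (\<lambda>z. max 0 (uh s z - \<mu> * uh s (fst z, snd z + 0))) + K / cosh X"
    using contraction[of s t1 \<mu> 0] s t \<mu> by auto
  have init: "max 0 (uh s z - \<mu> * uh s z) = 0" for z
    using \<mu> uh_pos[of s z] s t by simp
  define f where "f z = max 0 (uh t1 z - \<mu> * uh t' z)" for z
  have fc: "continuous_on UNIV f" unfolding f_def by (intro continuous_intros uh_cont0 t t'0)
  have f0: "0 \<le> f z" for z by (simp add: f_def)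
  have fK: "integral (cbox (-X, 0) (X, 2 * pi)) f \<le> 0 + K / cosh X" if "X \<ge> 0" for X
    using K that unfolding st f_def by (simp add: init)
  have "integral (cbox (-X, 0) (X, 2 * pi)) f \<le> 0" if "X > 0" for X
    by (rule le_of_cosh_tail[of X _ _ K], rule order_trans[OF integral_strip_mono[OF fc f0] fK]) (use that in auto)
  from zero_of_strip_integrals[OF fc f0 this y, of x]
  have "uh t1 (x, y) \<le> \<mu> * uh t' (x, y)" by (simp add: f_def)
  also have "\<dots> < \<rho> * uh t' (x, y)" using \<mu> p by simp
  also have "\<dots> = uh t1 (x, y)" using p by (simp add: \<rho>_def)
  finally show False by simp
qed

lemma uh_periodic: "uh t (x, y + 2 * pi) = uh t (x, y)"
  by (simp add: uh_def U_periodic)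

text \<open>Three limits are taken in this order: the strip is enlarged with both times fixed, which
  removes the boundary flux; then s tends to minus infinity on a fixed strip
  \<open>{-X1..X1}\<close> by dominated convergence; finally X1 tends to infinity, which removes the
  tail.\<close>

lemma uh_rotation_invariant:
  assumes T: "T < 0" and a: "a > 0" and C: "C \<ge> 0"
    and dom: "\<And>s x y y'. s \<le> T \<Longrightarrow> y \<in> {0..2 * pi} \<Longrightarrow> y' \<in> {0..2 * pi} \<Longrightarrow>
                \<bar>uh s (x, y) - uh s (x, y')\<bar> \<le> C * exp (- a * \<bar>x\<bar>)"
    and lim: "\<And>x y. y \<in> {0..2 * pi} \<Longrightarrow> ((\<lambda>s. uh s (x, y)) \<longlongrightarrow> c) at_bot"
    and t1: "t1 < 0" and y: "y \<in> {0..2 * pi}" "y' \<in> {0..2 * pi}"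
  shows "uh t1 (x, y) = uh t1 (x, y')"
proof -
  have rot: "uh t1 (x, y) \<le> uh t1 (x, y + \<beta>)" if \<beta>: "\<beta> \<in> {0..2 * pi}" and y: "y \<in> {0..2 * pi}" for \<beta> x y
  proof -
    define d where "d s z = max 0 (uh s z - uh s (fst z, snd z + \<beta>))" for s z
    have dc: "continuous_on S (d s)" if "s < 0" for s S
      unfolding d_def by (intro continuous_intros uh_cont uh_cont0 that)
    have d0: "0 \<le> d s z" for s z by (simp add: d_def)
    \<comment> \<open>The hypotheses speak only of angles in \<open>{0..2 * pi}\<close>, so the
      rotated angle is brought back there by periodicity.\<close>
    have shift: "\<exists>y'\<in>{0..2 * pi}. \<forall>s x. uh s (x, y + \<beta>) = uh s (x, y')" if "y \<in> {0..2 * pi}" for y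
    proof (cases "y + \<beta> \<le> 2 * pi")
      case True
      then show ?thesis using that \<beta> by (intro bexI[of _ "y + \<beta>"]) auto
    next
      case False
      have "uh s (x, y + \<beta>) = uh s (x, y + \<beta> - 2 * pi)" for s x
        using uh_periodic[of s x "y + \<beta> - 2 * pi"] by simp
      then show ?thesis using that \<beta> False by (intro bexI[of _ "y + \<beta> - 2 * pi"]) auto
    qed
    have dle: "d s (x, y) \<le> C * exp (- a * \<bar>x\<bar>)" if s: "s \<le> T" and y: "y \<in> {0..2 * pi}" for s x y
    proof -
      obtain y' where y': "y' \<in> {0..2 * pi}" "uh s (x, y + \<beta>) = uh s (x, y')" using shift[OF y] by blast
      have "0 \<le> C * exp (- a * \<bar>x\<bar>)" using C by simp
      then show ?thesis using dom[OF s y y'(1), of x] y'(2) by (simp add: d_def abs_le_iff)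
    qed
    have dlim: "((\<lambda>s. d s z) \<longlongrightarrow> 0) at_bot" if z: "snd z \<in> {0..2 * pi}" for z
    proof -
      obtain y' where y': "y' \<in> {0..2 * pi}" "\<And>s x. uh s (x, snd z + \<beta>) = uh s (x, y')" using shift[OF z] by blast
      have "((\<lambda>s. max 0 (uh s (fst z, snd z) - uh s (fst z, y'))) \<longlongrightarrow> max 0 (c - c)) at_bot"
        by (intro tendsto_intros lim z y')
      then show ?thesis by (simp add: d_def y'(2))
    qed
    define T' where "T' = min T (t1 - 1)"
    have T': "T' \<le> T" "T' < t1" "T' < 0" using T by (auto simp: T'_def)
    have bound: "integral (cbox (-X0, 0) (X0, 2 * pi)) (d t1) \<le> 4 * pi * C / a * exp (- a * X1)"
      if X: "0 < X0" "X0 \<le> X1" for X0 X1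
    proof -
      have step: "integral (cbox (-X0, 0) (X0, 2 * pi)) (d t1) \<le>
          integral (cbox (-X1, 0) (X1, 2 * pi)) (d s) + 4 * pi * C / a * exp (- a * X1)" if s: "s \<le> T'" for s
      proof -
        have s0: "s < t1" "s < 0" "s \<le> T" using s T' by auto
        obtain K where K: "\<forall>X\<ge>0.
           integral (cbox (-X, 0) (X, 2 * pi)) (\<lambda>z. max 0 (uh t1 z - 1 * uh (s + (t1 - s) / 1) (fst z, snd z + \<beta>)))
           \<le> integral (cbox (-X, 0) (X, 2 * pi)) (\<lambda>z. max 0 (uh s z - 1 * uh s (fst z, snd z + \<beta>))) + K / cosh X"
          using contraction[OF s0(1) t1 order_refl, of \<beta>] by blast
        have K': "integral (cbox (-X, 0) (X, 2 * pi)) (d t1) \<le> integral (cbox (-X, 0) (X, 2 * pi)) (d s) + K / cosh X"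
          if "X \<ge> 0" for X using K that by (simp add: d_def[abs_def])
        show ?thesis
        proof (rule le_of_cosh_tail[of X1 _ _ K])
          fix Y assume Y: "Y \<ge> X1"
          have "integral (cbox (-X0, 0) (X0, 2 * pi)) (d t1) \<le> integral (cbox (-Y, 0) (Y, 2 * pi)) (d t1)"
            using X Y by (intro integral_strip_mono dc d0 t1) auto
          also have "\<dots> \<le> integral (cbox (-Y, 0) (Y, 2 * pi)) (d s) + K / cosh Y" using X Y by (intro K') auto
          also have "integral (cbox (-Y, 0) (Y, 2 * pi)) (d s) \<le>
              integral (cbox (-X1, 0) (X1, 2 * pi)) (d s) + 4 * pi * C / a * exp (- a * X1)"
            using X Y by (intro integral_strip_tail dc d0 s0 a C dle) auto
          finally show "integral (cbox (-X0, 0) (X0, 2 * pi)) (d t1) \<le>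
              integral (cbox (-X1, 0) (X1, 2 * pi)) (d s) + 4 * pi * C / a * exp (- a * X1) + K / cosh Y" by simp
        qed
      qed
      have sT: "T' - real n \<le> T'" for n by simp
      have sbot: "filterlim (\<lambda>n. T' - real n) at_bot sequentially"
        using filterlim_tendsto_add_at_top[OF tendsto_const[of "- T'"] filterlim_real_sequentially]
        by (simp add: filterlim_uminus_at_bot)
      have "(\<lambda>n. integral (cbox (-X1, 0) (X1, 2 * pi)) (d (T' - real n))) \<longlonglongrightarrow> integral (cbox (-X1, 0) (X1, 2 * pi)) (\<lambda>z. 0)"
      proof (rule dominated_convergence(2)[where h="\<lambda>z. C"])
        show "d (T' - real n) integrable_on cbox (-X1, 0) (X1, 2 * pi)" for n
          using T' by (intro integrable_continuous dc) simp
        fix n and z :: "real \<times> real" assume z: "z \<in> cbox (-X1, 0) (X1, 2 * pi)"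
        then have z2: "snd z \<in> {0..2 * pi}" by (cases z) auto
        have "d (T' - real n) (fst z, snd z) \<le> C * exp (- a * \<bar>fst z\<bar>)" using T' by (intro dle z2) simp
        also have "\<dots> \<le> C * 1" using a C by (intro mult_left_mono) auto
        finally show "norm (d (T' - real n) z) \<le> C" using d0[of "T' - real n" z] by simp
        show "(\<lambda>n. d (T' - real n) z) \<longlonglongrightarrow> 0" by (rule filterlim_compose[OF dlim[OF z2] sbot])
      qed auto
      then have "(\<lambda>n. integral (cbox (-X1, 0) (X1, 2 * pi)) (d (T' - real n)) + 4 * pi * C / a * exp (- a * X1)) \<longlonglongrightarrow>
          0 + 4 * pi * C / a * exp (- a * X1)"
        by (intro tendsto_add tendsto_const) simp
      then have "integral (cbox (-X0, 0) (X0, 2 * pi)) (d t1) \<le> 0 + 4 * pi * C / a * exp (- a * X1)"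
        by (rule tendsto_lowerbound) (use step[OF sT] in \<open>auto intro: always_eventually\<close>)
      then show ?thesis by simp
    qed
    have "integral (cbox (-X0, 0) (X0, 2 * pi)) (d t1) \<le> 0" if X0: "0 < X0" for X0
    proof (rule tendsto_lowerbound)
      have "filterlim (\<lambda>X::real. - a * X) at_bot at_top"
        using a by (intro filterlim_tendsto_neg_mult_at_bot[OF tendsto_const _ filterlim_ident]) simp
      then have "((\<lambda>X. exp (- a * X)) \<longlongrightarrow> 0) at_top" by (rule filterlim_compose[OF exp_at_bot])
      from tendsto_mult[OF tendsto_const this, of "4 * pi * C / a"]
      show "((\<lambda>X. 4 * pi * C / a * exp (- a * X)) \<longlongrightarrow> 0) at_top" by simp
      show "\<forall>\<^sub>F X in at_top. integral (cbox (-X0, 0) (X0, 2 * pi)) (d t1) \<le> 4 * pi * C / a * exp (- a * X)"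
        by (rule eventually_at_top_linorderI[of X0]) (rule bound[OF X0])
    qed simp
    from zero_of_strip_integrals[OF dc[OF t1] d0 this y, of x] show ?thesis by (simp add: d_def)
  qed
  have le: "uh t1 (x, y) = uh t1 (x, y')" if "y \<in> {0..2 * pi}" "y' \<in> {0..2 * pi}" "y \<le> y'" for y y'
  proof (rule antisym)
    show "uh t1 (x, y) \<le> uh t1 (x, y')" using rot[of "y' - y" y x] that by simp
    \<comment> \<open>The reverse inequality comes from completing the rotation to a full
      turn.\<close>
    have "uh t1 (x, y') \<le> uh t1 (x, y' + (2 * pi - (y' - y)))" by (rule rot) (use that in auto)
    also have "y' + (2 * pi - (y' - y)) = y + 2 * pi" by simp
    finally show "uh t1 (x, y') \<le> uh t1 (x, y)" by (simp only: uh_periodic)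
  qed
  show ?thesis
  proof (cases "y \<le> y'")
    case True
    then show ?thesis by (rule le[OF y])
  next
    case False
    then have "y' \<le> y" by simp
    then show ?thesis by (rule le[OF y(2,1), symmetric])
  qed
qed

end

section \<open>From the symmetric flow on the sphere to the flow on the line\<close>

locale symmetric_sphere_flow = sphere_flow +
  assumes rot: "t < 0 \<Longrightarrow> y \<in> {0..2 * pi} \<Longrightarrow> uh t (x, y) = uh t (x, pi)"
begin

definition w :: "real \<Rightarrow> real \<Rightarrow> real" where "w x t = inverse (uh t (x, pi))"

lemma w_eq: "w x t = (cosh x)\<^sup>2 / U x pi t"
  by (simp add: w_def uh_def)

text \<open>The reference angle pi is interior to \<open>{0..2 * pi}\<close>, so \<open>rot\<close>
  makes U constant in a neighbourhood of it and angular derivatives can be computed there.\<close>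

lemma lyy_zero:
  assumes t: "t < 0"
  shows "lyy t (x, pi) = 0"
proof -
  have op: "open {0<..<2 * pi}" by simp
  have U: "U x y t = U x pi t" if "y \<in> {0<..<2 * pi}" for y
    using rot[OF t, of y x] that by (simp add: uh_def)
  have ly0: "ly t (x, y) = 0" if y: "y \<in> {0<..<2 * pi}" for y
  proof -
    have "((\<lambda>y. ln (U x y t)) has_real_derivative 0) (at y)"
      by (rule has_field_derivative_transform_within_open[OF DERIV_const[of "ln (U x pi t)"] op y]) (metis U)
    from DERIV_unique[OF log_derivs_y(1)[OF t] this] show ?thesis .
  qed
  have "((\<lambda>y. ly t (x, y)) has_real_derivative 0) (at pi)"
    by (rule has_field_derivative_transform_within_open[OF DERIV_const[of 0] op]) (auto simp: ly0)
  from DERIV_unique[OF log_derivs_y(2)[OF t] this] show ?thesis .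
qed

text \<open>The time derivative of u, smooth across the poles. The curvature will turn out to be - G
  / U, so its bounds, its x-derivative and its limits at the poles come from smoothness of G rather
  than from coordinate formulas that degenerate.\<close>

definition G :: "(real^3) \<times> real \<Rightarrow> real" where
  "G z = frechet_derivative (\<lambda>(p, t). F p t) (at z) (0, 1)"

lemma Ck_on_G: "Ck_on k W G"
  using smooth[of "Suc k"] unfolding G_def[abs_def] by simp

lemma F_deriv_t:
  assumes "p \<in> S2" "t < 0"
  shows "((\<lambda>t. F p t) has_real_derivative G (p, t)) (at t)"
proof -
  have W: "(p, t) \<in> W" using sub_W assms by auto
  let ?f = "\<lambda>(p, t). F p t"
  have D: "(?f has_derivative frechet_derivative ?f (at (p, t))) (at (p, t))"
    using smooth[of "Suc 0"] W by (auto simp: frechet_derivative_works)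
  have "((\<lambda>t. (p, t)) has_derivative (\<lambda>h. (0, h))) (at t)"
    by (intro has_derivative_Pair) auto
  from has_derivative_compose[OF this D]
  have "((\<lambda>t. F p t) has_derivative (\<lambda>h. frechet_derivative ?f (at (p, t)) (0, h))) (at t)" by simp
  moreover have "frechet_derivative ?f (at (p, t)) (0, h) = G (p, t) * h" for h
  proof -
    have "linear (frechet_derivative ?f (at (p, t)))"
      using D by (intro linear_frechet_derivative) (auto simp: differentiable_def)
    from linear_cmul[OF this, of h "(0, 1)"] show ?thesis by (simp add: G_def mult.commute)
  qed
  ultimately show ?thesis by (simp add: has_field_derivative_def)
qed

lemma G_eq:
  assumes t: "t < 0"
  shows "G (Phi x pi, t) = (cosh x)\<^sup>2 * lxx t (x, pi) - 2"
proof -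
  have "((\<lambda>t. F (Phi x pi) t) has_real_derivative (cosh x)\<^sup>2 * lxx t (x, pi) - 2) (at t)"
    using U_evolution[OF t, of x pi] by (simp add: U_def lyy_zero[OF t])
  from DERIV_unique[OF F_deriv_t[OF Phi_in_S2 t] this] show ?thesis .
qed

text \<open>The smooth data on the sphere are checked against \<open>line_flow\<close>, then
  \<open>q_zero\<close> is applied with the values at the two poles. The derivatives are exported
  existentially since their defining relations determine them.\<close>

lemma third_derivative:
  obtains w1 w2 w3 :: "real \<Rightarrow> real \<Rightarrow> real" where
    "\<And>x t. t < 0 \<Longrightarrow> ((\<lambda>x. w x t) has_real_derivative w1 x t) (at x)"
    "\<And>x t. t < 0 \<Longrightarrow> ((\<lambda>x. w1 x t) has_real_derivative w2 x t) (at x)"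
    "\<And>x t. t < 0 \<Longrightarrow> ((\<lambda>x. w2 x t) has_real_derivative w3 x t) (at x)"
    "\<And>x t. t < 0 \<Longrightarrow> w3 x t = 4 * w1 x t"
proof -
  let ?P = "UNIV \<times> {..<0} :: (real \<times> real) set"
  have "cx k ?P (\<lambda>x p. inverse (U x (fst p) (snd p) * ((1 / cosh x) * (1 / cosh x))))" for k
  proof (rule cx_inverse)
    have "cx k ?P (\<lambda>x p. U x (fst p) (snd p))"
      using cx_Phi(1)[OF smooth[of k]] unfolding U_def split_conv .
    from cx_mult[OF this cx_mult[OF cx_sech_tanh[THEN conjunct1] cx_sech_tanh[THEN conjunct1]]]
    show "cx k ?P (\<lambda>x p. U x (fst p) (snd p) * ((1 / cosh x) * (1 / cosh x)))" .
    show "U x (fst p) (snd p) * ((1 / cosh x) * (1 / cosh x)) \<noteq> 0" if "p \<in> ?P" for x p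
      using U_pos[of "snd p" x "fst p"] that by auto
  qed
  \<comment> \<open>Five derivatives are needed because the evolution of w3 - 4 w1 involves the
    fifth one.\<close>
  note g0 = this[of "Suc (Suc (Suc (Suc (Suc 0))))"]
  define g where "g x p = inverse (U x (fst p) (snd p) * ((1 / cosh x) * (1 / cosh x)))" for x and p :: "real \<times> real"
  note g0 = g0[folded g_def]
  obtain g1 where g1: "\<And>x p. p \<in> ?P \<Longrightarrow> ((\<lambda>x. g x p) has_real_derivative g1 x p) (at x)" "cx (Suc (Suc (Suc (Suc 0)))) ?P g1"
    by (rule cx_SucE[OF g0]) blast
  obtain g2 where g2: "\<And>x p. p \<in> ?P \<Longrightarrow> ((\<lambda>x. g1 x p) has_real_derivative g2 x p) (at x)" "cx (Suc (Suc (Suc 0))) ?P g2"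
    by (rule cx_SucE[OF g1(2)]) blast
  obtain g3 where g3: "\<And>x p. p \<in> ?P \<Longrightarrow> ((\<lambda>x. g2 x p) has_real_derivative g3 x p) (at x)" "cx (Suc (Suc 0)) ?P g3"
    by (rule cx_SucE[OF g2(2)]) blast
  obtain g4 where g4: "\<And>x p. p \<in> ?P \<Longrightarrow> ((\<lambda>x. g3 x p) has_real_derivative g4 x p) (at x)" "cx (Suc 0) ?P g4"
    by (rule cx_SucE[OF g3(2)]) blast
  obtain g5 where g5: "\<And>x p. p \<in> ?P \<Longrightarrow> ((\<lambda>x. g4 x p) has_real_derivative g5 x p) (at x)" "cx 0 ?P g5"
    by (rule cx_SucE[OF g4(2)]) blast
  have gw: "g x (pi, t) = w x t" for x t
    by (simp add: g_def w_eq power2_eq_square divide_inverse)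
  define w1 w2 w3 w4 w5 where "w1 x t = g1 x (pi, t)" and "w2 x t = g2 x (pi, t)" and "w3 x t = g3 x (pi, t)"
    and "w4 x t = g4 x (pi, t)" and "w5 x t = g5 x (pi, t)" for x t
  have dw0: "((\<lambda>x. w x t) has_real_derivative w1 x t) (at x)" if "t < 0" for x t
    using g1(1)[of "(pi, t)" x] that by (simp add: gw w1_def)
  have dw1: "((\<lambda>x. w1 x t) has_real_derivative w2 x t) (at x)" if "t < 0" for x t
    using g2(1)[of "(pi, t)" x] that by (simp add: w1_def w2_def)
  have dw2: "((\<lambda>x. w2 x t) has_real_derivative w3 x t) (at x)" if "t < 0" for x t
    using g3(1)[of "(pi, t)" x] that by (simp add: w2_def w3_def)
  have dw3: "((\<lambda>x. w3 x t) has_real_derivative w4 x t) (at x)" if "t < 0" for x t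
    using g4(1)[of "(pi, t)" x] that by (simp add: w3_def w4_def)
  have dw4: "((\<lambda>x. w4 x t) has_real_derivative w5 x t) (at x)" if "t < 0" for x t
    using g5(1)[of "(pi, t)" x] that by (simp add: w4_def w5_def)
  have cont: "continuous_on (UNIV \<times> {..<0}) (\<lambda>(x,t). f x (pi, t))" if "cx k ?P f" for k and f :: "real \<Rightarrow> real \<times> real \<Rightarrow> real"
  proof -
    have "continuous_on (UNIV \<times> {..<0}) (\<lambda>z. case (fst z, (pi, snd z)) of (x, p) \<Rightarrow> f x p)"
      by (rule continuous_on_compose2[OF cx_continuous_on[OF that]]) (auto intro!: continuous_intros)
    then show ?thesis by (simp add: split_beta)
  qed
  have wpos: "w x t > 0" if "t < 0" for x t using uh_pos[OF that] by (simp add: w_def)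
  have p_eq: "w1 x t / w x t = 2 * tanh x - lx t (x, pi)" if t: "t < 0" for x t
  proof -
    have e: "(\<lambda>x. ln (w x t)) = (\<lambda>x. 2 * ln (cosh x) - ln (U x pi t))"
    proof
      fix x
      show "ln (w x t) = 2 * ln (cosh x) - ln (U x pi t)"
        using U_pos[OF t, of x pi] by (simp add: w_eq ln_div ln_realpow)
    qed
    have 1: "((\<lambda>x. ln (w x t)) has_real_derivative 2 * tanh x - lx t (x, pi)) (at x)"
    proof -
      have "((\<lambda>x. ln (cosh x)) has_real_derivative tanh x) (at x)"
        by (auto intro!: derivative_eq_intros simp: tanh_def)
      from DERIV_diff[OF DERIV_cmult[OF this, of 2] log_derivs_x(1)[OF t]] show ?thesis unfolding e .
    qed
    have 2: "((\<lambda>x. ln (w x t)) has_real_derivative w1 x t / w x t) (at x)"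
      using wpos[OF t, of x] by (auto intro!: derivative_eq_intros dw0 t simp: field_simps)
    show ?thesis by (rule DERIV_unique[OF 2 1])
  qed
  have pp_eq: "(w2 x t * w x t - w1 x t * w1 x t) / (w x t * w x t) = 2 / (cosh x)\<^sup>2 - lxx t (x, pi)" if t: "t < 0" for x t
  proof -
    have e: "(\<lambda>x. w1 x t / w x t) = (\<lambda>x. 2 * tanh x - lx t (x, pi))" using p_eq[OF t] by auto
    have 1: "((\<lambda>x. w1 x t / w x t) has_real_derivative 2 / (cosh x)\<^sup>2 - lxx t (x, pi)) (at x)"
      unfolding e by (auto intro!: derivative_eq_intros log_derivs_x t simp: one_minus_tanh_square)
    have 2: "((\<lambda>x. w1 x t / w x t) has_real_derivative (w2 x t * w x t - w1 x t * w1 x t) / (w x t * w x t)) (at x)"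
      using wpos[OF t, of x] by (intro DERIV_divide dw0 dw1 t) auto
    show ?thesis by (rule DERIV_unique[OF 2 1])
  qed
  have wt_eq: "w x t * w2 x t - (w1 x t)\<^sup>2 = (2 / (cosh x)\<^sup>2 - lxx t (x, pi)) * (w x t)\<^sup>2" if t: "t < 0" for x t
    unfolding pp_eq[OF t, symmetric] using wpos[OF t, of x] by (simp add: field_simps power2_eq_square)
  \<comment> \<open>The flow equation turns 2 / (cosh x)^2 - (ln U)_xx into a multiple of the time
    derivative of U, which is regular at the poles.\<close>
  have R_eq: "w2 x t - (w1 x t)\<^sup>2 / w x t = - (G (Phi x pi, t) / U x pi t)" if t: "t < 0" for x t
  proof -
    have "w2 x t - (w1 x t)\<^sup>2 / w x t = (w x t * w2 x t - (w1 x t)\<^sup>2) / w x t"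
      using wpos[OF t, of x] by (simp add: field_simps)
    also have "\<dots> = (2 / (cosh x)\<^sup>2 - lxx t (x, pi)) * w x t"
      unfolding wt_eq[OF t] using wpos[OF t, of x] by (simp add: power2_eq_square)
    also have "\<dots> = - (G (Phi x pi, t) / U x pi t)"
      unfolding G_eq[OF t] w_eq using U_pos[OF t, of x pi] by (simp add: field_simps)
    finally show ?thesis .
  qed
  have evol: "((\<lambda>t. w x t) has_real_derivative w x t * w2 x t - (w1 x t)\<^sup>2) (at t)" if t: "t < 0" for x t
  proof -
    have "((\<lambda>t. inverse (uh t (x, pi))) has_real_derivative
        - (inverse (uh t (x, pi)) * (lxx t (x, pi) + lyy t (x, pi) - 2 / (cosh x)\<^sup>2) * inverse (uh t (x, pi)))) (at t)"
      using DERIV_inverse'[OF uh_evolution[OF t, of "(x, pi)"]] uh_pos[OF t, of "(x, pi)"] by simp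
    then show ?thesis
      unfolding wt_eq[OF t] lyy_zero[OF t] unfolding w_def by (simp add: power2_eq_square algebra_simps)
  qed
  show thesis
  proof (rule that[OF dw0 dw1 dw2])
    \<comment> \<open>A negative time derivative would give w a larger value at an earlier time,
      against \<open>uh_antimono\<close>.\<close>
    have incr: "(w1 x t)\<^sup>2 \<le> w x t * w2 x t" if t: "t < 0" for x t
    proof (rule ccontr)
      assume "\<not> ?thesis"
      then have "w x t * w2 x t - (w1 x t)\<^sup>2 < 0" by simp
      from DERIV_neg_dec_left[OF evol[OF t] this] obtain h where h: "h > 0" "w x t < w x (t - h)"
        using dense by blast
      have "uh t (x, pi) \<le> uh (t - h) (x, pi)" by (rule uh_antimono) (use h t in auto)
      then have "w x (t - h) \<le> w x t" using uh_pos[OF t, of "(x, pi)"] by (simp add: w_def le_imp_inverse_le)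
      then show False using h by simp
    qed
    interpret line_flow w w1 w2 w3 w4 w5
    proof unfold_locales
      show "continuous_on (UNIV \<times> {..<0}) (\<lambda>(x, t). w x t)" using cont[OF g0] by (simp add: gw)
      show "continuous_on (UNIV \<times> {..<0}) (\<lambda>(x, t). w1 x t)" using cont[OF g1(2)] by (simp add: w1_def)
      show "continuous_on (UNIV \<times> {..<0}) (\<lambda>(x, t). w2 x t)" using cont[OF g2(2)] by (simp add: w2_def)
      show "continuous_on (UNIV \<times> {..<0}) (\<lambda>(x, t). w3 x t)" using cont[OF g3(2)] by (simp add: w3_def)
      show "continuous_on (UNIV \<times> {..<0}) (\<lambda>(x, t). w4 x t)" using cont[OF g4(2)] by (simp add: w4_def)
      show "continuous_on (UNIV \<times> {..<0}) (\<lambda>(x, t). w5 x t)" using cont[OF g5(2)] by (simp add: w5_def)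
    next
      fix s t1 :: real assume st: "s \<le> t1" "t1 < 0"
      obtain K1 where K1: "K1 > 0" "\<And>x \<theta> t. t \<in> {s..t1} \<Longrightarrow> U x \<theta> t \<le> K1" "\<And>x \<theta> t. t \<in> {s..t1} \<Longrightarrow> 1 \<le> K1 * U x \<theta> t"
        "\<And>x \<theta> t D. t \<in> {s..t1} \<Longrightarrow> ((\<lambda>x. U x \<theta> t) has_real_derivative D) (at x) \<Longrightarrow> \<bar>D\<bar> \<le> K1 / cosh x"
        using U_bounds[OF st(2), of s] by metis
      obtain K2 where K2: "K2 > 0" "\<And>x \<theta> t. t \<in> {s..t1} \<Longrightarrow> \<bar>G (Phi x \<theta>, t)\<bar> \<le> K2"
        "\<And>x \<theta> t D. t \<in> {s..t1} \<Longrightarrow> ((\<lambda>x. G (Phi x \<theta>, t)) has_real_derivative D) (at x) \<Longrightarrow> \<bar>D\<bar> \<le> K2 / cosh x"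
        using x_derivative_bound[OF Ck_on_G st(2), of s] by metis
      obtain K3 where K3: "K3 > 0" "\<And>t x y. t \<in> {s..t1} \<Longrightarrow> \<bar>lx t (x, y)\<bar> \<le> K3 / cosh x"
        using lx_bound[OF st(2), of s] by metis
      \<comment> \<open>The summands control, in this order, U and 1 / U, the curvature G / U, its
        x-derivative by the quotient rule, and the x-derivative of ln U.\<close>
      define K where "K = K1 + K2 * K1 + (K2 * K1 + K2 * K3 * K1) + K3"
      have Ks: "K1 \<le> K" "K2 * K1 \<le> K" "K2 * K1 + K2 * K3 * K1 \<le> K" "K3 \<le> K" "K > 0"
        using K1(1) K2(1) K3(1) by (auto simp: K_def intro!: add_pos_pos)
      show "\<exists>K>0. \<forall>x. \<forall>t\<in>{s..t1}. (cosh x)\<^sup>2 \<le> K * w x t \<and> w x t \<le> K * (cosh x)\<^sup>2 \<and>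
         w2 x t - (w1 x t)\<^sup>2 / w x t \<le> K \<and>
         \<bar>w3 x t - 2 * w1 x t * w2 x t / w x t + (w1 x t)^3 / (w x t)\<^sup>2\<bar> \<le> K / cosh x \<and>
         \<bar>w1 x t / w x t - 2 * tanh x\<bar> \<le> K / cosh x"
      proof (intro exI[of _ K] conjI allI ballI Ks)
        fix x t assume t: "t \<in> {s..t1}"
        then have t0: "t < 0" using st by simp
        have Up: "U x pi t > 0" by (rule U_pos[OF t0])
        have "U x pi t \<le> K" using K1(2)[OF t, of x pi] Ks by simp
        then show "(cosh x)\<^sup>2 \<le> K * w x t" using Up by (simp add: w_eq field_simps)
        have iU: "1 / U x pi t \<le> K1" using K1(3)[OF t, of x pi] Up by (simp add: field_simps)
        then have "(cosh x)\<^sup>2 * (1 / U x pi t) \<le> (cosh x)\<^sup>2 * K" using Ks by (intro mult_left_mono) auto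
        then show "w x t \<le> K * (cosh x)\<^sup>2" by (simp add: w_eq mult.commute)
        have "\<bar>G (Phi x pi, t)\<bar> * (1 / U x pi t) \<le> K2 * K1"
          using K2(2)[OF t] iU Up K2(1) by (intro mult_mono) auto
        moreover have "(- G (Phi x pi, t)) / U x pi t \<le> \<bar>G (Phi x pi, t)\<bar> / U x pi t"
          using Up by (intro divide_right_mono) auto
        ultimately show "w2 x t - (w1 x t)\<^sup>2 / w x t \<le> K"
          unfolding R_eq[OF t0] using Ks(2) by simp
        have "K3 / cosh x \<le> K / cosh x" using Ks by (simp add: divide_right_mono)
        then show "\<bar>w1 x t / w x t - 2 * tanh x\<bar> \<le> K / cosh x"
          unfolding p_eq[OF t0] using K3(2)[OF t, of x pi] by simp
        obtain G' where G': "\<And>x p. p \<in> ?P \<Longrightarrow> ((\<lambda>x. G (Phi x (fst p), snd p)) has_real_derivative G' x p) (at x)"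
          by (rule cx_SucE[OF cx_Phi(1)[OF Ck_on_G[of "Suc 0"]]]) blast
        have dG: "((\<lambda>x. G (Phi x pi, t)) has_real_derivative G' x (pi, t)) (at x)"
          using G'[of "(pi, t)" x] t0 by simp
        have dlnU: "((\<lambda>x. U x pi t) has_real_derivative U x pi t * lx t (x, pi)) (at x)"
        proof -
          have "((\<lambda>x. exp (ln (U x pi t))) has_real_derivative exp (ln (U x pi t)) * lx t (x, pi)) (at x)"
            by (rule DERIV_chain2[OF DERIV_exp log_derivs_x(1)[OF t0]])
          then show ?thesis by (simp add: U_pos[OF t0])
        qed
        have 1: "((\<lambda>x. w2 x t - (w1 x t)\<^sup>2 / w x t) has_real_derivative
            w3 x t - 2 * w1 x t * w2 x t / w x t + (w1 x t)^3 / (w x t)\<^sup>2) (at x)"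
          using wpos[OF t0, of x] t0
          by (auto intro!: derivative_eq_intros dw0 dw1 dw2 simp: field_simps power2_eq_square power3_eq_cube)
        have e: "(\<lambda>x. w2 x t - (w1 x t)\<^sup>2 / w x t) = (\<lambda>x. - (G (Phi x pi, t) / U x pi t))"
          using R_eq[OF t0] by auto
        have 2: "((\<lambda>x. - (G (Phi x pi, t) / U x pi t)) has_real_derivative
            - ((G' x (pi, t) - G (Phi x pi, t) * lx t (x, pi)) * (1 / U x pi t))) (at x)"
        proof -
          have "(G' x (pi, t) * U x pi t - G (Phi x pi, t) * (U x pi t * lx t (x, pi))) / (U x pi t * U x pi t) =
              (G' x (pi, t) - G (Phi x pi, t) * lx t (x, pi)) * (1 / U x pi t)"
            using Up by (simp add: field_simps)
          with DERIV_minus[OF DERIV_divide[OF dG dlnU]] Up show ?thesis by simp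
        qed
        have R': "w3 x t - 2 * w1 x t * w2 x t / w x t + (w1 x t)^3 / (w x t)\<^sup>2 =
            - ((G' x (pi, t) - G (Phi x pi, t) * lx t (x, pi)) * (1 / U x pi t))"
          using DERIV_unique[OF 1] 2 unfolding e by blast
        have "\<bar>G (Phi x pi, t) * lx t (x, pi)\<bar> \<le> K2 * (K3 / cosh x)"
          unfolding abs_mult using K2(1,2) K3(2) t by (intro mult_mono) auto
        then have "\<bar>G' x (pi, t) - G (Phi x pi, t) * lx t (x, pi)\<bar> \<le> K2 / cosh x + K2 * (K3 / cosh x)"
          using K2(3)[OF t dG] by linarith
        then have "\<bar>G' x (pi, t) - G (Phi x pi, t) * lx t (x, pi)\<bar> * (1 / U x pi t) \<le> (K2 / cosh x + K2 * (K3 / cosh x)) * K1"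
          using iU Up by (intro mult_mono) auto
        also have "\<dots> = (K2 * K1 + K2 * K3 * K1) / cosh x" by (simp add: field_simps)
        also have "\<dots> \<le> K / cosh x" using Ks by (simp add: divide_right_mono)
        finally show "\<bar>w3 x t - 2 * w1 x t * w2 x t / w x t + (w1 x t)^3 / (w x t)\<^sup>2\<bar> \<le> K / cosh x"
          unfolding R' abs_minus_cancel abs_mult using Up by simp
      qed
    qed (use dw0 dw1 dw2 dw3 dw4 wpos evol incr in auto)
    define N S :: "real^3" where "N = axis 3 1" and "S = axis 3 (- 1)"
    have NS: "N \<in> S2" "S \<in> S2" by (simp_all add: N_def S_def norm_eq_sqrt_inner inner_axis_axis)
    have limF: "((\<lambda>x. U x pi t) \<longlongrightarrow> F e t) A" "((\<lambda>x. G (Phi x pi, t)) \<longlongrightarrow> G (e, t)) A"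
      if "t < 0" "e \<in> S2" "((\<lambda>x. Phi x pi) \<longlongrightarrow> e) A" for t e A
    proof -
      have "(e, t) \<in> W" using that sub_W by auto
      then have "isCont (\<lambda>(p, t). F p t) (e, t)" "isCont G (e, t)"
        using Ck_on_continuous_on[OF smooth[of 0]] Ck_on_continuous_on[OF Ck_on_G[of 0]] open_W
        by (auto simp: continuous_on_eq_continuous_at)
      moreover have "((\<lambda>x. (Phi x pi, t)) \<longlongrightarrow> (e, t)) A" by (intro tendsto_Pair that tendsto_const)
      ultimately show "((\<lambda>x. U x pi t) \<longlongrightarrow> F e t) A" "((\<lambda>x. G (Phi x pi, t)) \<longlongrightarrow> G (e, t)) A"
        using isCont_tendsto_compose by (force simp: U_def)+
    qed
    have Fp: "F e t > 0" if "e \<in> S2" "t < 0" for e t using u_pos[OF that] F_eq[OF that] by simp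
    have limR: "((\<lambda>x. R x t) \<longlongrightarrow> - (G (e, t) / F e t)) A"
      if "t < 0" "e \<in> S2" "((\<lambda>x. Phi x pi) \<longlongrightarrow> e) A" for t e A
      unfolding R_def R_eq[OF that(1)] using limF[OF that] Fp[OF that(2,1)] by (intro tendsto_intros) auto
    have dln: "((\<lambda>t. ln (F e t)) has_real_derivative - (- (G (e, t) / F e t))) (at t)" if "e \<in> S2" "t < 0" for e t
      using DERIV_chain2[OF DERIV_ln[OF Fp[OF that]] F_deriv_t[OF that]] by (simp add: divide_inverse mult.commute)
    have c1: "((\<lambda>x::real. (cosh x * exp (- x))\<^sup>2) \<longlongrightarrow> 1/4) at_top"
    proof -
      have "((\<lambda>x::real. exp (- x)) \<longlongrightarrow> 0) at_top"
        by (rule filterlim_compose[OF exp_at_bot filterlim_uminus_at_bot_at_top])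
      then have "((\<lambda>x::real. ((1 + exp (- x) * exp (- x)) / 2)\<^sup>2) \<longlongrightarrow> ((1 + 0 * 0) / 2)\<^sup>2) at_top"
        by (intro tendsto_intros) auto
      moreover have "(1 + exp (- x) * exp (- x)) / 2 = cosh x * exp (- x)" for x :: real
        by (simp add: cosh_def algebra_simps flip: exp_add)
      ultimately show ?thesis by (simp add: power2_eq_square)
    qed
    have c2: "((\<lambda>x::real. (cosh x * exp x)\<^sup>2) \<longlongrightarrow> 1/4) at_bot"
      using c1 unfolding filterlim_at_bot_mirror by simp
    have wlim: "((\<lambda>x. w x t * exp (- 2 * x)) \<longlongrightarrow> exp (- ln (F N t)) / 4) at_top"
      "((\<lambda>x. w x t * exp (2 * x)) \<longlongrightarrow> exp (- ln (F S t)) / 4) at_bot" if t: "t < 0" for t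
    proof -
      have "((\<lambda>x. (cosh x * exp (- x))\<^sup>2 / U x pi t) \<longlongrightarrow> (1/4) / F N t) at_top"
        using Fp[OF NS(1) t] Phi_at_top by (intro tendsto_divide c1 limF t NS) (auto simp: N_def)
      moreover have "(\<lambda>x. (cosh x * exp (- x))\<^sup>2 / U x pi t) = (\<lambda>x. w x t * exp (- 2 * x))"
        by (auto simp: w_eq power_mult_distrib exp_double[of "- _", symmetric])
      moreover have "(1/4) / F N t = exp (- ln (F N t)) / 4"
        unfolding exp_minus exp_ln[OF Fp[OF NS(1) t]] by (simp add: inverse_eq_divide)
      ultimately show "((\<lambda>x. w x t * exp (- 2 * x)) \<longlongrightarrow> exp (- ln (F N t)) / 4) at_top" by (simp only:)
      have "((\<lambda>x. (cosh x * exp x)\<^sup>2 / U x pi t) \<longlongrightarrow> (1/4) / F S t) at_bot"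
        using Fp[OF NS(2) t] Phi_at_bot by (intro tendsto_divide c2 limF t NS) (auto simp: S_def)
      moreover have "(\<lambda>x. (cosh x * exp x)\<^sup>2 / U x pi t) = (\<lambda>x. w x t * exp (2 * x))"
        by (auto simp: w_eq power_mult_distrib exp_double[symmetric])
      moreover have "(1/4) / F S t = exp (- ln (F S t)) / 4"
        unfolding exp_minus exp_ln[OF Fp[OF NS(2) t]] by (simp add: inverse_eq_divide)
      ultimately show "((\<lambda>x. w x t * exp (2 * x)) \<longlongrightarrow> exp (- ln (F S t)) / 4) at_bot" by (simp only:)
    qed
    show "w3 x t = 4 * w1 x t" if "t < 0" for x t
      by (rule q_zero[where lp="\<lambda>t. ln (F N t)" and lm="\<lambda>t. ln (F S t)" and rp="\<lambda>t. - (G (N, t) / F N t)" and rm="\<lambda>t. - (G (S, t) / F S t)"])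
         (use that wlim limR dln NS Phi_at_top Phi_at_bot in \<open>auto simp: N_def S_def\<close>)
  qed
qed

end

section \<open>Domination of the angular variation and conclusion\<close>

theorem corollary6:
  fixes u :: "real^3 \<Rightarrow> real \<Rightarrow> real"
    and v :: "real \<Rightarrow> real \<Rightarrow> real \<Rightarrow> real"
    and C0 a T0 C' :: real
  assumes u_pos: "\<And>p t. p \<in> S2 \<Longrightarrow> t < 0 \<Longrightarrow> u p t > 0"
    and u_smooth: "smooth_on (S2 \<times> {..<0}) (\<lambda>(p, t). u p t)"
    and ricci_flow: "ancient_ricci_flow_S2 u"
    and u_eq: "log_diffusion_S2 u"
    and singular: "singular_at_0 u"
    and v_def: "\<And>\<psi> \<theta> t. v \<psi> \<theta> t = inverse (u (sph \<psi> \<theta>) t)"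
    and C0_pos: "C0 > 0"
    and v_lim: "\<And>\<psi> \<theta>. \<bar>\<psi>\<bar> \<le> pi/2 \<Longrightarrow> 0 \<le> \<theta> \<Longrightarrow> \<theta> \<le> 2 * pi \<Longrightarrow>
                  ((\<lambda>t. v \<psi> \<theta> t) \<longlongrightarrow> C0 * (cos \<psi>)\<^sup>2) at_bot"
    and a: "0 < a" "a < 3"
    and T0: "T0 < 0"
    and C': "C' > 0"
    and v_theta: "\<And>\<psi> \<theta> t. \<bar>\<psi>\<bar> \<le> pi/2 \<Longrightarrow> 0 \<le> \<theta> \<Longrightarrow> \<theta> \<le> 2 * pi \<Longrightarrow> t \<le> T0 \<Longrightarrow>
                  (deriv (\<lambda>q. v \<psi> q t) \<theta>)\<^sup>2 \<le> C' * v \<psi> \<theta> t powr (1 + a) * (cos \<psi>)\<^sup>2"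
  shows "\<exists>vb :: real \<Rightarrow> real \<Rightarrow> real.
           (\<forall>\<psi> \<theta> t. \<bar>\<psi>\<bar> \<le> pi/2 \<and> 0 \<le> \<theta> \<and> \<theta> \<le> 2 * pi \<and> t < 0 \<longrightarrow> v \<psi> \<theta> t = vb \<psi> t) \<and>
           (\<forall>t0<0. \<exists>C>0. \<forall>\<psi> t. \<bar>\<psi>\<bar> < pi/2 \<and> t \<le> t0 \<longrightarrow> H_of vb \<psi> t \<le> C)"
proof -
  obtain W G where WG: "open W" "S2 \<times> {..<0} \<subseteq> W" "\<And>k. Ck_on k W G"
     "\<And>z. z \<in> S2 \<times> {..<0} \<Longrightarrow> G z = (case z of (p, t) \<Rightarrow> u p t)"
    using u_smooth unfolding smooth_on_def by blast
  interpret sphere_flow u "\<lambda>p t. G (p, t)" W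
    by unfold_locales (use WG u_pos u_eq in auto)
  have v_U: "v (inv_mercator x) y t = 1 / U x y t" if "t < 0" for x y t
    using that by (simp add: v_def sph_inv_mercator U_eq inverse_eq_divide)
  have uh_v: "uh t (x, y) = 1 / (v (inv_mercator x) y t * (cosh x)\<^sup>2)" if "t < 0" for x y t
    using that by (simp add: v_U uh_def)
  have lim: "((\<lambda>s. uh s (x, y)) \<longlongrightarrow> 1 / C0) at_bot" if y: "y \<in> {0..2 * pi}" for x y
  proof -
    have "((\<lambda>s. v (inv_mercator x) y s) \<longlongrightarrow> C0 * (cos (inv_mercator x))\<^sup>2) at_bot"
      using y inv_mercator_bounds[of x] by (intro v_lim) auto
    then have "((\<lambda>s. 1 / (v (inv_mercator x) y s * (cosh x)\<^sup>2)) \<longlongrightarrow> 1 / (C0 * (1 / cosh x)\<^sup>2 * (cosh x)\<^sup>2)) at_bot"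
      unfolding cos_inv_mercator using C0_pos by (intro tendsto_intros) auto
    then have "((\<lambda>s. 1 / (v (inv_mercator x) y s * (cosh x)\<^sup>2)) \<longlongrightarrow> 1 / C0) at_bot"
      by (simp add: power_one_over)
    moreover have "\<forall>\<^sub>F s in at_bot. 1 / (v (inv_mercator x) y s * (cosh x)\<^sup>2) = uh s (x, y)"
      using eventually_gt_at_bot[of 0] eventually_le_at_bot[of "-1"] by eventually_elim (simp add: uh_v)
    ultimately show ?thesis by (rule Lim_transform_eventually)
  qed
  \<comment> \<open>Equivalently w >= C0: uh increases backwards in time to its limit 1 /
    C0.\<close>
  have uh_le: "uh t (x, y) \<le> 1 / C0" if t: "t < 0" and y: "y \<in> {0..2 * pi}" for t x y
  proof (rule tendsto_lowerbound[OF lim[OF y]])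
    show "\<forall>\<^sub>F s in at_bot. uh t (x, y) \<le> uh s (x, y)"
      by (rule eventually_at_bot_linorderI[of "t - 1"]) (use uh_antimono[OF _ t y] in auto)
  qed simp
  \<comment> \<open>The factors come from the hypothesis on the angular derivative, from the lower
    bound V >= C0 / (cosh x)^2 raised to the power a - 3, and from cosh x >= exp |x| / 2.\<close>
  define B where "B = C' * C0 powr (a - 3) * 2 powr (2 * a)"
  have B: "B \<ge> 0" using C' by (simp add: B_def)
  have d_uh: "((\<lambda>y. uh s (x, y)) has_real_derivative uh s (x, y) * ly s (x, y)) (at y)" if s: "s < 0" for s x y
  proof -
    have "((\<lambda>y. exp (ln (U x y s)) / (cosh x)\<^sup>2) has_real_derivative exp (ln (U x y s)) * ly s (x, y) / (cosh x)\<^sup>2) (at y)"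
      by (intro DERIV_cdivide DERIV_chain2[OF DERIV_exp log_derivs_y(1)[OF s]])
    then show ?thesis by (simp add: uh_def U_pos[OF s])
  qed
  have d_bound: "\<bar>uh s (x, y) * ly s (x, y)\<bar> \<le> sqrt B * exp (- a * \<bar>x\<bar>)" if s: "s \<le> T0" and y: "y \<in> {0..2 * pi}" for s x y
  proof -
    have s0: "s < 0" using s T0 by simp
    define V where "V = v (inv_mercator x) y s"
    define c where "c = cosh x"
    have c: "c > 0" by (simp add: c_def)
    have VU: "V = 1 / U x y s" by (simp add: V_def v_U[OF s0])
    have V: "V > 0" using U_pos[OF s0, of x y] by (simp add: VU)
    have e: "(\<lambda>q. v (inv_mercator x) q s) = (\<lambda>q. exp (- ln (U x q s)))"
      using U_pos[OF s0] by (simp add: v_U[OF s0] exp_minus inverse_eq_divide)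
    have "((\<lambda>q. v (inv_mercator x) q s) has_real_derivative exp (- ln (U x y s)) * - ly s (x, y)) (at y)"
      unfolding e by (intro DERIV_chain2[OF DERIV_exp] DERIV_minus log_derivs_y(1)[OF s0])
    then have "((\<lambda>q. v (inv_mercator x) q s) has_real_derivative - (V * ly s (x, y))) (at y)"
      using U_pos[OF s0, of x y] by (simp add: VU exp_minus inverse_eq_divide)
    then have "deriv (\<lambda>q. v (inv_mercator x) q s) y = - (V * ly s (x, y))" by (rule DERIV_imp_deriv)
    then have "(V * ly s (x, y))\<^sup>2 \<le> C' * V powr (1 + a) * (1 / c)\<^sup>2"
      using v_theta[of "inv_mercator x" y s] inv_mercator_bounds[of x] y s
      by (simp add: V_def c_def cos_inv_mercator)
    \<comment> \<open>Since uh = 1 / (V c^2), this division converts the squared angular derivative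
      of v into that of uh.\<close>
    then have "(V * ly s (x, y))\<^sup>2 / (V^4 * c^4) \<le> C' * V powr (1 + a) * (1 / c)\<^sup>2 / (V^4 * c^4)"
      using V c by (intro divide_right_mono) auto
    also have "(V * ly s (x, y))\<^sup>2 / (V^4 * c^4) = (uh s (x, y) * ly s (x, y))\<^sup>2"
      unfolding uh_v[OF s0] V_def[symmetric] c_def[symmetric] using V c
      by (simp add: field_simps power2_eq_square power4_eq_xxxx)
    also have "C' * V powr (1 + a) * (1 / c)\<^sup>2 / (V^4 * c^4) = C' * (V powr (1 + a) / V powr 4) / c powr 6"
      using V c by (simp add: powr_numeral power_one_over field_simps flip: power_add)
    also have "V powr (1 + a) / V powr 4 = V powr (a - 3)"
      by (simp flip: powr_diff)
    \<comment> \<open>The exponent a - 3 is negative, so a lower bound on V is what is needed. The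
      powers of c then combine to - 2 a, and a > 0 gives decay.\<close>
    also have "C' * V powr (a - 3) / c powr 6 \<le> C' * (C0 / c powr 2) powr (a - 3) / c powr 6"
    proof (intro divide_right_mono mult_left_mono)
      have "1 / (V * c\<^sup>2) \<le> 1 / C0"
        using uh_le[OF s0 y, of x] unfolding uh_v[OF s0] V_def[symmetric] c_def[symmetric] .
      then have "C0 \<le> V * c\<^sup>2" using V c C0_pos by (simp add: field_simps)
      then have "C0 / c powr 2 \<le> V" using c by (simp add: powr_numeral field_simps)
      then show "V powr (a - 3) \<le> (C0 / c powr 2) powr (a - 3)"
        using a C0_pos c by (intro powr_mono2') auto
    qed (use C' in auto)
    also have "\<dots> = C' * C0 powr (a - 3) * c powr (- 2 * a)"
    proof -
      have "(C0 / c powr 2) powr (a - 3) = C0 powr (a - 3) / (c powr 2) powr (a - 3)"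
        by (rule powr_divide)
      then have 1: "(C0 / c powr 2) powr (a - 3) = C0 powr (a - 3) / c powr (2 * (a - 3))"
        by (simp only: powr_powr)
      have 2: "c powr (2 * a) = c powr (2 * (a - 3)) * c powr 6"
        unfolding powr_add[symmetric] by simp
      have 3: "c powr (- 2 * a) = 1 / c powr (2 * a)"
        using powr_minus_divide[of c "2 * a"] by simp
      show ?thesis
        unfolding 1 2 3 by (simp only: times_divide_eq_right divide_divide_eq_left mult_1_right)
    qed
    also have "\<dots> \<le> C' * C0 powr (a - 3) * (exp \<bar>x\<bar> / 2) powr (- 2 * a)"
    proof (intro mult_left_mono powr_mono2')
      show "exp \<bar>x\<bar> / 2 \<le> c" by (auto simp: c_def cosh_def abs_if)
    qed (use a C' in auto)
    also have "(exp \<bar>x\<bar> / 2) powr (- 2 * a) = 2 powr (2 * a) * (exp (- a * \<bar>x\<bar>))\<^sup>2"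
    proof -
      have "(exp \<bar>x\<bar> / 2) powr (- 2 * a) = exp \<bar>x\<bar> powr (- 2 * a) / 2 powr (- 2 * a)"
        by (simp add: powr_divide)
      also have "exp \<bar>x\<bar> powr (- 2 * a) = (exp (- a * \<bar>x\<bar>))\<^sup>2"
        by (simp add: powr_def mult_ac flip: exp_double)
      finally show ?thesis by (simp add: powr_minus_divide)
    qed
    finally have "(uh s (x, y) * ly s (x, y))\<^sup>2 \<le> B * (exp (- a * \<bar>x\<bar>))\<^sup>2"
      by (simp add: B_def mult_ac)
    then have "sqrt ((uh s (x, y) * ly s (x, y))\<^sup>2) \<le> sqrt (B * (exp (- a * \<bar>x\<bar>))\<^sup>2)"
      by (rule real_sqrt_le_mono)
    then show ?thesis by (simp add: real_sqrt_mult)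
  qed
  have dom: "\<bar>uh s (x, y) - uh s (x, y')\<bar> \<le> (2 * pi * sqrt B) * exp (- a * \<bar>x\<bar>)"
    if s: "s \<le> T0" and y: "y \<in> {0..2 * pi}" "y' \<in> {0..2 * pi}" for s x y y'
  proof -
    have s0: "s < 0" using s T0 by simp
    have "norm (uh s (x, y) - uh s (x, y')) \<le> sqrt B * exp (- a * \<bar>x\<bar>) * norm (y - y')"
      by (rule field_differentiable_bound[where S="{0..2 * pi}" and f="\<lambda>y. uh s (x, y)" and f'="\<lambda>y. uh s (x, y) * ly s (x, y)"])
         (use y d_uh[OF s0] d_bound[OF s] in \<open>auto intro: has_field_derivative_at_within\<close>)
    also have "\<dots> \<le> sqrt B * exp (- a * \<bar>x\<bar>) * (2 * pi)"
      using y B by (intro mult_left_mono) auto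
    finally show ?thesis by (simp add: mult_ac)
  qed
  have indep: "uh t (x, y) = uh t (x, y')" if "t < 0" "y \<in> {0..2 * pi}" "y' \<in> {0..2 * pi}" for t x y y'
    using uh_rotation_invariant[OF T0 a(1) _ dom lim that] B by simp
  interpret symmetric_sphere_flow u "\<lambda>p t. G (p, t)" W
    by unfold_locales (rule indep, auto)
  obtain w1 w2 w3 where dw: "\<And>x t. t < 0 \<Longrightarrow> ((\<lambda>x. w x t) has_real_derivative w1 x t) (at x)"
    "\<And>x t. t < 0 \<Longrightarrow> ((\<lambda>x. w1 x t) has_real_derivative w2 x t) (at x)"
    "\<And>x t. t < 0 \<Longrightarrow> ((\<lambda>x. w2 x t) has_real_derivative w3 x t) (at x)"
    and zero: "\<And>x t. t < 0 \<Longrightarrow> w3 x t = 4 * w1 x t"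
  proof (rule third_derivative)
    fix w1 w2 w3 :: "real \<Rightarrow> real \<Rightarrow> real"
    assume "\<And>x t. t < 0 \<Longrightarrow> ((\<lambda>x. w x t) has_real_derivative w1 x t) (at x)"
      "\<And>x t. t < 0 \<Longrightarrow> ((\<lambda>x. w1 x t) has_real_derivative w2 x t) (at x)"
      "\<And>x t. t < 0 \<Longrightarrow> ((\<lambda>x. w2 x t) has_real_derivative w3 x t) (at x)"
      "\<And>x t. t < 0 \<Longrightarrow> w3 x t = 4 * w1 x t"
    then show thesis by (rule that)
  qed
  define vb where "vb \<psi> t = v \<psi> 0 t" for \<psi> t
  have "v \<psi> \<theta> t = vb \<psi> t" if h: "\<bar>\<psi>\<bar> \<le> pi/2" "0 \<le> \<theta>" "\<theta> \<le> 2 * pi" "t < 0" for \<psi> \<theta> t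
  proof (cases "\<bar>\<psi>\<bar> < pi/2")
    case True
    have "v (inv_mercator (mercator \<psi>)) \<theta> t = v (inv_mercator (mercator \<psi>)) 0 t"
      using indep[of t \<theta> 0 "mercator \<psi>"] h by (simp add: v_U uh_def)
    then show ?thesis unfolding inv_mercator_mercator[OF True] vb_def .
  next
    \<comment> \<open>The chart misses the poles, but there the point on the sphere does not depend
      on the angle.\<close>
    case False
    then have "\<psi> = pi/2 \<or> \<psi> = - (pi/2)" using h(1) by (auto simp: abs_if split: if_splits)
    then have "cos \<psi> = 0" by (metis cos_minus cos_pi_half)
    then show ?thesis by (simp add: vb_def v_def sph_def)
  qed
  \<comment> \<open>The left side is 0; the value 1 is taken because the constant has to be
    positive.\<close>
  moreover have "H_of vb \<psi> t \<le> 1" if t: "t < 0" for \<psi> t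
  proof -
    have w: "w_of vb x t = w x t" for x
      using indep[of t 0 pi x] t
      by (simp add: w_of_def vb_def v_U cos_inv_mercator w_eq uh_def power_one_over)
    have 1: "deriv (\<lambda>z. w z t) = (\<lambda>z. w1 z t)" using DERIV_imp_deriv[OF dw(1)[OF t]] by auto
    have 2: "deriv (\<lambda>z. w1 z t) = (\<lambda>z. w2 z t)" using DERIV_imp_deriv[OF dw(2)[OF t]] by auto
    have Q: "Q_of vb x t = w2 x t - 4 * w x t" for x
      by (simp add: Q_of_def w 1 2)
    have "((\<lambda>x. w2 x t - 4 * w x t) has_real_derivative 0) (at x)" for x
      using DERIV_diff[OF dw(3)[OF t, of x] DERIV_cmult[OF dw(1)[OF t, of x], of 4]] zero[OF t, of x] by simp
    then have "deriv (\<lambda>x. w2 x t - 4 * w x t) x = 0" for x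
      by (rule DERIV_imp_deriv)
    then show ?thesis by (simp add: H_of_def F_of_def Q)
  qed
  ultimately show ?thesis
    by (intro exI[of _ vb]) (force intro: exI[of _ 1])
qed

end
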